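(* Let $\Gamma$ be any graph with $\nu=\nu(\Gamma)\ge 2$, and let $n$ be an integer satisfying $1\le n\le\frac{1}{2}\nu$, with $\Gamma$ sufficiently subdivided for $n$. Then $\mathrm{TC}(\mathrm{UD}^{n}(\Gamma))=2n+1$.
   Context: Graphs are finite connected 1-dimensional CW complexes; the vertices are the 0-cells and an edge means the closure of a 1-cell. A cycle is a sequence of vertices $(v_1,\dots,v_k,v_1)$ with $v_1,\dots,v_k$ distinct, together with edges joining consecutive vertices (cyclically), forming an embedded circle in $\Gamma$. Two cycles are vertex-disjoint if they have no vertices in common; $\nu(\Gamma)$ is the maximum cardinality of a collection of pairwise vertex-disjoint cycles in $\Gamma$. Topological complexity: for a path-connected space $X$, let $P(X)$ be the space of continuous paths $I\to X$ and $p:P(X)\to X\times X$, $p(\sigma)=(\sigma(0),\sigma(1))$. $\mathrm{TC}(X)$ is the smallest integer $k$ such that $X\times X$ is covered by open sets $U_1,\dots,U_k$ each admitting a continuous section $U_i\to P(X)$ of $p$ ($\infty$ if no such $k$ exists). Discrete configuration space: $\mathrm{D}^n(\Gamma)\subset\Gamma^n$ is the subcomplex consisting of all open cells $c_1\times\cdots\times c_n$ (each $c_i$ a vertex or an open edge of $\Gamma$) with $\overline{c_i}\cap\overline{c_j}=\emptyset$ for $i\neq j$, and $\mathrm{UD}^n(\Gamma)=\mathrm{D}^n(\Gamma)/S_n$, where the symmetric group $S_n$ permutes the coordinates. $\Gamma$ is sufficiently subdivided for $n$ if it has at least $n$ vertices, each path between distinct vertices of degree not equal to $2$ contains at least $n-1$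 edges, and each loop at a vertex that is not homotopic to a constant map contains at least $n+1$ edges. *)

theory Defs
  imports
    "HOL-Analysis.Analysis"
    "HOL-Combinatorics.Permutations"
    "HOL-Library.Extended_Nat"
begin

section \<open>Quotient topology\<close>

definition quotient_topology :: "'a topology \<Rightarrow> ('a \<Rightarrow> 'b) \<Rightarrow> 'b topology"
  where "quotient_topology X q =
    topology (\<lambda>U. U \<subseteq> q ` topspace X \<and> openin X {x \<in> topspace X. q x \<in> U})"

lemma openin_quotient_topology:
  "openin (quotient_topology X q) U \<longleftrightarrow>
    U \<subseteq> q ` topspace X \<and> openin X {x \<in> topspace X. q x \<in> U}"
proof -
  have int: "openin X {x \<in> topspace X. q x \<in> S \<inter> T}"
    if "openin X {x \<in> topspace X. q x \<in> S}" "openin X {x \<in> topspace X. q x \<in> T}" for S T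
  proof -
    have "{x \<in> topspace X. q x \<in> S \<inter> T} =
        {x \<in> topspace X. q x \<in> S} \<inter> {x \<in> topspace X. q x \<in> T}"
      by auto
    with that show ?thesis by auto
  qed
  have un: "openin X {x \<in> topspace X. q x \<in> \<Union>\<K>}"
    if "\<forall>K\<in>\<K>. openin X {x \<in> topspace X. q x \<in> K}" for \<K>
  proof -
    have "{x \<in> topspace X. q x \<in> \<Union>\<K>} = (\<Union>K\<in>\<K>. {x \<in> topspace X. q x \<in> K})"
      by auto
    with that show ?thesis by auto
  qed
  have "istopology (\<lambda>U. U \<subseteq> q ` topspace X \<and> openin X {x \<in> topspace X. q x \<in> U})"
    unfolding istopology_def using int un by blast
  then show ?thesis
    by (simp add: quotient_topology_def topology_inverse')
qed

lemma topspace_quotient_topology [simp]: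
  "topspace (quotient_topology X q) = q ` topspace X"
proof -
  have "openin (quotient_topology X q) (q ` topspace X)"
  proof -
    have "{x \<in> topspace X. q x \<in> q ` topspace X} = topspace X"
      by auto
    then show ?thesis
      by (simp add: openin_quotient_topology)
  qed
  moreover have "topspace (quotient_topology X q) \<subseteq> q ` topspace X"
    using openin_topspace openin_quotient_topology by metis
  ultimately show ?thesis
    using openin_subset by blast
qed

lemma quotient_map_quotient_topology: "quotient_map X (quotient_topology X q) q"
  by (auto simp: quotient_map_def openin_quotient_topology)


section \<open>Topological complexity\<close>

text \<open>A path is extended by \<^term>\<open>undefined\<close> outside the unit interval, so that two elements
  of the path space are equal iff they agree on the interval.\<close>

definition paths_in :: "'a topology \<Rightarrow> (real \<Rightarrow> 'a) set"
  where "paths_in X = {g \<in> extensional {0..1}. pathin X g}"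

text \<open>The path space with the compact-open topology.\<close>

definition path_space :: "'a topology \<Rightarrow> (real \<Rightarrow> 'a) topology"
  where "path_space X =
    topology_generated_by
      {{g \<in> paths_in X. g ` K \<subseteq> W} | K W. K \<subseteq> {0..1} \<and> compact K \<and> openin X W}"

lemma topspace_path_space [simp]: "topspace (path_space X) = paths_in X"
proof -
  have "paths_in X \<in> {{g \<in> paths_in X. g ` K \<subseteq> W} | K W. K \<subseteq> {0..1} \<and> compact K \<and> openin X W}"
    by (rule CollectI, rule exI[of _ "{}"], rule exI[of _ "{}"]) auto
  then show ?thesis
    unfolding path_space_def topology_generated_by_topspace by blast
qed

definition path_ends :: "(real \<Rightarrow> 'a) \<Rightarrow> 'a \<times> 'a"
  where "path_ends g = (g 0, g 1)"

definition has_path_section :: "'a topology \<Rightarrow> ('a \<times> 'a) set \<Rightarrow> bool"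
  where "has_path_section X U \<longleftrightarrow>
    (\<exists>s. continuous_map (subtopology (prod_topology X X) U) (path_space X) s \<and>
         (\<forall>z\<in>U. path_ends (s z) = z))"

text \<open>The unreduced convention: a nonempty contractible space has topological complexity 1.
  The infimum of the empty set is \<open>\<infinity>\<close>.\<close>

definition TC :: "'a topology \<Rightarrow> enat"
  where "TC X = Inf {enat k | k.
    \<exists>U :: nat \<Rightarrow> ('a \<times> 'a) set.
      (\<forall>i\<in>{1..k}. openin (prod_topology X X) (U i) \<and> has_path_section X (U i)) \<and>
      (\<Union>i\<in>{1..k}. U i) = topspace X \<times> topspace X}"


section \<open>Graphs\<close>

text \<open>A graph is a space with a finite CW structure of dimension at most one: the 0-cells are
  the points of \<open>verts\<close>, the 1-cells are indexed by \<open>edges\<close>, and \<open>chmap e\<close>, restricted to the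
  unit interval, is the characteristic map of the 1-cell \<open>e\<close>. Loops and multiple edges are
  allowed.\<close>

record ('v, 'e) graph =
  gspace :: "'v topology"
  verts :: "'v set"
  edges :: "'e set"
  chmap :: "'e \<Rightarrow> real \<Rightarrow> 'v"

definition open_edge :: "('v, 'e) graph \<Rightarrow> 'e \<Rightarrow> 'v set"
  where "open_edge G e = chmap G e ` {0<..<1}"

definition closed_edge :: "('v, 'e) graph \<Rightarrow> 'e \<Rightarrow> 'v set"
  where "closed_edge G e = chmap G e ` {0..1}"

text \<open>As there are finitely many cells and the space is Hausdorff, the weak topology condition
  and the fact that \<open>chmap G e\<close> is a homeomorphism from the open interval onto the open edge
  follow from compactness.\<close>

definition is_graph :: "('v, 'e) graph \<Rightarrow> bool"
  where "is_graph G \<longleftrightarrow>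
    Hausdorff_space (gspace G) \<and> connected_space (gspace G) \<and>
    finite (verts G) \<and> finite (edges G) \<and>
    (\<forall>e\<in>edges G. pathin (gspace G) (chmap G e) \<and> inj_on (chmap G e) {0<..<1} \<and>
       chmap G e 0 \<in> verts G \<and> chmap G e 1 \<in> verts G) \<and>
    topspace (gspace G) = verts G \<union> (\<Union>e\<in>edges G. open_edge G e) \<and>
    (\<forall>e\<in>edges G. disjnt (verts G) (open_edge G e)) \<and>
    pairwise (\<lambda>e e'. disjnt (open_edge G e) (open_edge G e')) (edges G)"

definition joins :: "('v, 'e) graph \<Rightarrow> 'e \<Rightarrow> 'v \<Rightarrow> 'v \<Rightarrow> bool"
  where "joins G e v w \<longleftrightarrow> {chmap G e 0, chmap G e 1} = {v, w}"

text \<open>The degree of a vertex counts the ends of edges at it, so a loop contributes two.\<close>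

definition vdegree :: "('v, 'e) graph \<Rightarrow> 'v \<Rightarrow> nat"
  where "vdegree G v =
    card {e \<in> edges G. chmap G e 0 = v} + card {e \<in> edges G. chmap G e 1 = v}"

text \<open>The cycle \<open>(v\<^sub>1, \<dots>, v\<^sub>k, v\<^sub>1)\<close> is represented by the list of vertices \<open>v\<^sub>1, \<dots>, v\<^sub>k\<close> together
  with the list of the \<open>k\<close> edges, the last of which joins \<open>v\<^sub>k\<close> to \<open>v\<^sub>1\<close>. Loops (\<open>k = 1\<close>) and pairs
  of parallel edges (\<open>k = 2\<close>) are included; the circle condition excludes traversing a single
  edge back and forth.\<close>

definition is_cycle :: "('v, 'e) graph \<Rightarrow> 'v list \<times> 'e list \<Rightarrow> bool"
  where "is_cycle G c \<longleftrightarrow> (case c of (vs, es) \<Rightarrow>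
    vs \<noteq> [] \<and> distinct vs \<and> set vs \<subseteq> verts G \<and>
    length es = length vs \<and> set es \<subseteq> edges G \<and>
    (\<forall>i<length vs. joins G (es ! i) (vs ! i) (vs ! (Suc i mod length vs))) \<and>
    subtopology (gspace G) (\<Union>e\<in>set es. closed_edge G e)
      homeomorphic_space top_of_set (sphere (0::complex) 1))"

definition vertex_disjoint :: "'v list \<times> 'e list \<Rightarrow> 'v list \<times> 'e list \<Rightarrow> bool"
  where "vertex_disjoint c d \<longleftrightarrow> set (fst c) \<inter> set (fst d) = {}"

definition cycle_number :: "('v, 'e) graph \<Rightarrow> nat"
  where "cycle_number G =
    Max {card C | C. finite C \<and> (\<forall>c\<in>C. is_cycle G c) \<and> pairwise vertex_disjoint C}"


section \<open>Discrete configuration spaces\<close>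

definition cells :: "('v, 'e) graph \<Rightarrow> 'v set set"
  where "cells G = {{v} | v. v \<in> verts G} \<union> {open_edge G e | e. e \<in> edges G}"

definition ordered_discrete_conf :: "nat \<Rightarrow> ('v, 'e) graph \<Rightarrow> (nat \<Rightarrow> 'v) topology"
  where "ordered_discrete_conf n G =
    subtopology (product_topology (\<lambda>_. gspace G) {..<n})
      (\<Union>c \<in> {c. (\<forall>i<n. c i \<in> cells G) \<and>
                (\<forall>i<n. \<forall>j<n. i \<noteq> j \<longrightarrow>
                  (gspace G closure_of c i) \<inter> (gspace G closure_of c j) = {})}.
         PiE {..<n} c)"

definition perm_orbit :: "nat \<Rightarrow> (nat \<Rightarrow> 'v) \<Rightarrow> (nat \<Rightarrow> 'v) set"
  where "perm_orbit n x = {x \<circ> \<pi> | \<pi>. \<pi> permutes {..<n}}"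

definition unordered_discrete_conf :: "nat \<Rightarrow> ('v, 'e) graph \<Rightarrow> (nat \<Rightarrow> 'v) set topology"
  where "unordered_discrete_conf n G =
    quotient_topology (ordered_discrete_conf n G) (perm_orbit n)"


section \<open>Sufficient subdivision\<close>

text \<open>Paths and loops are topological; such a path contains an edge if its image does.\<close>

definition edges_contained :: "('v, 'e) graph \<Rightarrow> (real \<Rightarrow> 'v) \<Rightarrow> 'e set"
  where "edges_contained G g = {e \<in> edges G. closed_edge G e \<subseteq> g ` {0..1}}"

text \<open>A homotopy of loops is a homotopy through closed paths, i.e. a homotopy of maps from the
  circle.\<close>

definition null_homotopic_loop :: "'a topology \<Rightarrow> (real \<Rightarrow> 'a) \<Rightarrow> bool"
  where "null_homotopic_loop X g \<longleftrightarrow>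
    (\<exists>a\<in>topspace X. homotopic_with (\<lambda>h. h 0 = h 1) (top_of_set {0..1}) X g (\<lambda>_. a))"

definition sufficiently_subdivided :: "nat \<Rightarrow> ('v, 'e) graph \<Rightarrow> bool"
  where "sufficiently_subdivided n G \<longleftrightarrow>
    n \<le> card (verts G) \<and>
    (\<forall>g. pathin (gspace G) g \<and> g 0 \<in> verts G \<and> g 1 \<in> verts G \<and> g 0 \<noteq> g 1 \<and>
         vdegree G (g 0) \<noteq> 2 \<and> vdegree G (g 1) \<noteq> 2 \<longrightarrow>
       int n - 1 \<le> int (card (edges_contained G g))) \<and>
    (\<forall>g. pathin (gspace G) g \<and> g 0 \<in> verts G \<and> g 1 = g 0 \<and>
         \<not> null_homotopic_loop (gspace G) g \<longrightarrow>
       n + 1 \<le> card (edges_contained G g))"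

end

theory Submission
  imports Defs
begin

text \<open>Let \<open>X\<close> be the unordered discrete configuration space of \<open>n\<close> points on \<open>\<Gamma>\<close>. Both
inequalities are proved by hand, without cohomology.

Upper bound. Fix \<open>2 * n + 1\<close> disjoint intervals in \<open>(0, 1/2)\<close>. The \<open>k\<close>-th band consists of the
points of the open edges whose parameter distance from the nearer end of the edge lies in the
\<open>k\<close>-th interval. The bands are disjoint, and a pair of configurations involves at most \<open>2 * n\<close>
points, so it misses some band altogether. Hence \<open>X \<times> X\<close> is covered by the open squares
\<open>V k \<times> V k\<close>, where \<open>V k\<close> is the set of configurations that miss the \<open>k\<close>-th band. Off this band, a
homotopy of \<open>\<Gamma>\<close> pushes every point along its edge to a vertex or to the midpoint of the edge. It
preserves closed cells and is applied to all points of a configuration at once, so it acts on \<open>X\<close>,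
and it moves \<open>V k\<close> to finitely many configurations. As \<open>X\<close> is path connected, paths chosen once
and for all between these finitely many configurations complete a motion planner on
\<open>V k \<times> V k\<close> (\<open>TC_le_if_covered_by_deformable_squares\<close>). Path connectedness
(\<open>path_connected_unordered_discrete_conf\<close>) is a statement about unlabelled tokens that slide along
the edges of a connected graph to unoccupied vertices: every set of occupied vertices can be turned
into every other one of the same size.

Lower bound. Choose \<open>2 * n\<close> vertex-disjoint cycles and one edge on each of them. Placing one point
on each of the first \<open>n\<close> cycles gives an \<open>n\<close>-torus in \<open>X\<close>, the last \<open>n\<close> cycles give another one, and
their product is a \<open>2 * n\<close>-torus in \<open>X \<times> X\<close>. For the \<open>i\<close>-th chosen edge, wrap this edge around the
circle, collapse the rest of \<open>\<Gamma>\<close> to \<open>1\<close>, and multiply the values over the points of a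
configuration; this defines a map \<open>\<phi>\<close> from \<open>X\<close> to the circle. On the torus, the quotient of the
values of \<open>\<phi>\<close> at the two configurations of a pair depends on the \<open>i\<close>-th coordinate only, and with
degree one in absolute value. On a set of pairs with a path section this quotient has a continuous
logarithm, namely the total change of the argument of \<open>\<phi>\<close> along the chosen path. So suppose that
\<open>2 * n\<close> open sets with sections cover \<open>X \<times> X\<close>, and pass to the universal cover of the torus: over the
\<open>i\<close>-th set, a function \<open>g\<close> of the \<open>i\<close>-th coordinate that satisfies \<open>g (t + 1) = g t + 1\<close> differs from
a continuous periodic function by a locally constant integer. Labelling the vertices of a fine grid in a large cube by the signs of these
integers contradicts Kuhn's lemma, the combinatorial form of the Poincare-Miranda theorem
(\<open>torus_no_small_motion_cover\<close>). This makes explicit the zero-divisor cup-length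
argument for the cohomology classes that the \<open>2 * n\<close> maps \<open>\<phi>\<close> pull back from the circle.\<close>

section \<open>Maps into the path space\<close>

text \<open>The compact-open topology admits currying: by the tube lemma, the points whose whole path over a
compact set of times lies in an open set form an open set.\<close>

lemma continuous_map_into_path_space:
  assumes s: "continuous_map (prod_topology Z (top_of_set {0..1})) X (\<lambda>(z, t). s z t)"
    and ext: "\<And>z. z \<in> topspace Z \<Longrightarrow> s z \<in> extensional {0..1}"
  shows "continuous_map Z (path_space X) s"
  unfolding path_space_def
proof (rule continuous_on_generated_topo)
  have paths: "s z \<in> paths_in X" if "z \<in> topspace Z" for z
  proof -
    have "continuous_map (top_of_set {0..1}) (prod_topology Z (top_of_set {0..1})) (\<lambda>t. (z, t))"
      using that by (simp add: continuous_map_paired)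
    from continuous_map_compose[OF this s] ext[OF that] show ?thesis
      by (simp add: paths_in_def pathin_def o_def)
  qed
  have "paths_in X \<in> {{g \<in> paths_in X. g ` K \<subseteq> W} | K W. K \<subseteq> {0..1} \<and> compact K \<and> openin X W}"
    by (rule CollectI, rule exI[of _ "{}"], rule exI[of _ "{}"]) auto
  then show "s ` topspace Z \<subseteq>
      \<Union> {{g \<in> paths_in X. g ` K \<subseteq> W} | K W. K \<subseteq> {0..1} \<and> compact K \<and> openin X W}"
    using paths by blast
  fix U
  assume "U \<in> {{g \<in> paths_in X. g ` K \<subseteq> W} | K W. K \<subseteq> {0..1} \<and> compact K \<and> openin X W}"
  then obtain K W where U: "U = {g \<in> paths_in X. g ` K \<subseteq> W}"
    and K: "K \<subseteq> {0..1}" "compact K" and W: "openin X W"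
    by blast
  have eq: "s -` U \<inter> topspace Z = {z \<in> topspace Z. s z ` K \<subseteq> W}"
    using paths by (auto simp: U)
  define W' where "W' = {p \<in> topspace (prod_topology Z (top_of_set {0..1})). (\<lambda>(z, t). s z t) p \<in> W}"
  have W': "openin (prod_topology Z (top_of_set {0..1})) W'"
    unfolding W'_def using openin_continuous_map_preimage[OF s W] .
  have K': "compactin (top_of_set {0..1}) K"
    using K by (simp add: compactin_subtopology)
  show "openin Z (s -` U \<inter> topspace Z)"
    unfolding eq
  proof (subst openin_subopen, intro ballI)
    fix z assume z: "z \<in> {z \<in> topspace Z. s z ` K \<subseteq> W}"
    then have zK: "z \<in> topspace Z" "{z} \<times> K \<subseteq> W'"
      using K by (auto simp: W'_def)
    obtain A B where AB: "openin Z A" "z \<in> A" "K \<subseteq> B" "A \<times> B \<subseteq> W'"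
      using tube_lemma_right[OF W' K' zK] by metis
    have "A \<subseteq> {z \<in> topspace Z. s z ` K \<subseteq> W}"
    proof
      fix w assume w: "w \<in> A"
      have "s w t \<in> W" if "t \<in> K" for t
      proof -
        have "(w, t) \<in> W'"
          using AB w that by blast
        then show ?thesis by (simp add: W'_def)
      qed
      then show "w \<in> {z \<in> topspace Z. s z ` K \<subseteq> W}"
        using w openin_subset[OF AB(1)] by auto
    qed
    with AB show "\<exists>T. openin Z T \<and> z \<in> T \<and> T \<subseteq> {z \<in> topspace Z. s z ` K \<subseteq> W}"
      by blast
  qed
qed

lemma openin_path_space:
  assumes "K \<subseteq> {0..1}" "compact K" "openin X W"
  shows "openin (path_space X) {g \<in> paths_in X. g ` K \<subseteq> W}"
  unfolding path_space_def by (rule topology_generated_by_Basis) (use assms in blast)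

lemma continuous_map_path_space_eval:
  assumes "t \<in> {0..1}"
  shows "continuous_map (path_space X) X (\<lambda>g. g t)"
  unfolding continuous_map_def
proof (intro conjI allI impI)
  show "(\<lambda>g. g t) \<in> topspace (path_space X) \<rightarrow> topspace X"
    using assms by (auto simp: paths_in_def dest!: path_image_subset_topspace)
  fix W assume "openin X W"
  from openin_path_space[OF _ _ this, of "{t}"] assms
  show "openin (path_space X) {g \<in> topspace (path_space X). g t \<in> W}"
    by simp
qed

section \<open>Motion planners on squares that deform to finitely many points\<close>

text \<open>A finite subspace of a \<open>T\<^sub>1\<close> space is discrete, so that a map with finite image is locally
constant.\<close>

lemma continuous_map_discrete_finite_image:
  assumes X: "t1_space X" and f: "continuous_map Z X f" and fin: "finite (f ` topspace Z)"
  shows "openin Z {z \<in> topspace Z. f z = p}"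
proof -
  let ?F = "f ` topspace Z"
  have F: "?F \<subseteq> topspace X"
    using f by (auto simp: continuous_map_def)
  then have "subtopology X ?F = discrete_topology ?F"
    using fin X by (intro finite_t1_space_imp_discrete_topology)
      (auto simp: t1_space_subtopology)
  then have f': "continuous_map Z (discrete_topology ?F) f"
    using f by (metis continuous_map_into_subtopology image_subset_iff_funcset order_refl)
  have "openin Z {z \<in> topspace Z. f z \<in> {p} \<inter> ?F}"
    by (rule openin_continuous_map_preimage[OF f']) auto
  moreover have "{z \<in> topspace Z. f z \<in> {p} \<inter> ?F} = {z \<in> topspace Z. f z = p}"
    by auto
  ultimately show ?thesis by simp
qed

text \<open>From \<open>x\<close> follow the homotopy to one of the finitely many end points, then a path chosen once
and for all between the two end points, then the homotopy of \<open>y\<close> backwards. The middle leg is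
continuous because the pair of end points is locally constant. Clamping the times to the unit
interval makes each leg continuous on the whole product, so that only the gluing along the times
\<open>1/3\<close> and \<open>2/3\<close> remains.\<close>

lemma has_path_section_if_deforms_to_finite:
  assumes X: "path_connected_space X" "t1_space X"
    and V: "openin X V"
    and H: "continuous_map (prod_topology X (top_of_set {0..1::real})) X H"
    and H0: "\<And>x. x \<in> topspace X \<Longrightarrow> H (x, 0) = x"
    and fin: "finite ((\<lambda>x. H (x, 1)) ` V)"
  shows "has_path_section X (V \<times> V)"
proof -
  define e where "e x = H (x, 1)" for x
  have VX: "V \<subseteq> topspace X" using openin_subset[OF V] .
  have Htop: "H (x, t) \<in> topspace X" if "x \<in> topspace X" "t \<in> {0..1}" for x t
    using funcset_mem[OF continuous_map_funspace[OF H], of "(x, t)"] that by simp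
  define \<gamma> where "\<gamma> p q = (SOME g. pathin X g \<and> g 0 = p \<and> g 1 = q)" for p q
  have \<gamma>: "pathin X (\<gamma> p q) \<and> \<gamma> p q 0 = p \<and> \<gamma> p q 1 = q"
    if "p \<in> topspace X" "q \<in> topspace X" for p q
  proof -
    have "\<exists>g. pathin X g \<and> g 0 = p \<and> g 1 = q"
      using X(1) that unfolding path_connected_space_def by simp
    then show ?thesis
      unfolding \<gamma>_def by (rule someI_ex)
  qed
  define Z where "Z = subtopology (prod_topology X X) (V \<times> V)"
  let ?I = "top_of_set {0..1::real}"
  have topZ: "topspace Z = V \<times> V"
    using VX by (auto simp: Z_def)
  have fst_Z: "continuous_map Z X fst" and snd_Z: "continuous_map Z X snd"
    unfolding Z_def by (rule continuous_map_from_subtopology, rule continuous_map_fst continuous_map_snd)+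
  have arg: "continuous_map (prod_topology Z ?I) ?I (\<lambda>p. h (snd p))"
    if "continuous_on UNIV h" "\<And>t. h t \<in> {0..1}" for h :: "real \<Rightarrow> real"
  proof -
    have h: "continuous_map ?I ?I h"
      using that by (auto intro: continuous_on_subset)
    show ?thesis
      using continuous_map_compose[OF continuous_map_snd h] by (simp add: o_def)
  qed
  have leg: "continuous_map (prod_topology Z ?I) X (\<lambda>p. H (f (fst p), h (snd p)))"
    if "continuous_on UNIV h" "\<And>t. h t \<in> {0..1}" "continuous_map Z X f"
    for h :: "real \<Rightarrow> real" and f
  proof -
    have "continuous_map (prod_topology Z ?I) X (\<lambda>p. f (fst p))"
      using continuous_map_compose[OF continuous_map_fst that(3)] by (simp add: o_def)
    then have "continuous_map (prod_topology Z ?I) (prod_topology X ?I) (\<lambda>p. (f (fst p), h (snd p)))"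
      by (rule continuous_map_pairedI[OF _ arg[OF that(1,2)]])
    from continuous_map_compose[OF this H] show ?thesis by (simp add: o_def)
  qed
  have e: "continuous_map X X e"
  proof -
    have "continuous_map X (prod_topology X ?I) (\<lambda>x. (x, 1))"
      by (simp add: continuous_map_paired)
    from continuous_map_compose[OF this H] show ?thesis by (simp add: o_def e_def[abs_def])
  qed
  define mid where "mid p = \<gamma> (e (fst (fst p))) (e (snd (fst p))) (max 0 (min 1 (3 * snd p - 1)))"
    for p :: "('a \<times> 'a) \<times> real"
  have mid: "continuous_map (prod_topology Z ?I) X mid"
  proof (rule pasting_lemma)
    let ?T = "\<lambda>(a, b). {z \<in> topspace Z. e (fst z) = a \<and> e (snd z) = b} \<times> {0..1::real}"
    let ?f = "\<lambda>(a, b) p. \<gamma> a b (max 0 (min 1 (3 * snd p - 1)))"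
    let ?J = "topspace X \<times> topspace X"
    show "openin (prod_topology Z ?I) (?T ab)" for ab
    proof -
      obtain a b where ab: "ab = (a, b)" by fastforce
      have fin': "finite ((\<lambda>z. e (fst z)) ` topspace Z)" "finite ((\<lambda>z. e (snd z)) ` topspace Z)"
        using fin by (auto simp: topZ e_def intro: finite_subset[OF _ fin])
      have "continuous_map Z X (\<lambda>z. e (fst z))" "continuous_map Z X (\<lambda>z. e (snd z))"
        using continuous_map_compose[OF fst_Z e] continuous_map_compose[OF snd_Z e]
        by (simp_all add: o_def)
      from this[THEN continuous_map_discrete_finite_image[OF X(2)]] fin'
      have "openin Z ({z \<in> topspace Z. e (fst z) = a} \<inter> {z \<in> topspace Z. e (snd z) = b})"
        by blast
      moreover have "{z \<in> topspace Z. e (fst z) = a} \<inter> {z \<in> topspace Z. e (snd z) = b} =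
          {z \<in> topspace Z. e (fst z) = a \<and> e (snd z) = b}" by auto
      moreover have "openin ?I {0..1}" by (simp add: openin_subtopology_self)
      ultimately show ?thesis
        by (auto simp: ab openin_prod_Times_iff)
    qed
    show "continuous_map (subtopology (prod_topology Z ?I) (?T ab)) X (?f ab)" if "ab \<in> ?J" for ab
    proof -
      obtain a b where ab: "ab = (a, b)" by fastforce
      have "continuous_map ?I X (\<gamma> a b)"
        using \<gamma>[of a b] that by (auto simp: ab pathin_def)
      moreover have "continuous_map (prod_topology Z ?I) ?I (\<lambda>p. max 0 (min 1 (3 * snd p - 1)))"
        by (rule arg) (auto intro!: continuous_intros)
      ultimately have "continuous_map (prod_topology Z ?I) X (\<gamma> a b \<circ> (\<lambda>p. max 0 (min 1 (3 * snd p - 1))))"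
        by (rule continuous_map_compose[rotated])
      then show ?thesis
        by (simp add: ab o_def continuous_map_from_subtopology)
    qed
    show "?f ab p = ?f cd p" if "p \<in> topspace (prod_topology Z ?I) \<inter> ?T ab \<inter> ?T cd" for ab cd p
      using that by auto
    show "\<exists>ab. ab \<in> ?J \<and> p \<in> ?T ab \<and> mid p = ?f ab p" if "p \<in> topspace (prod_topology Z ?I)" for p
      using that VX Htop by (intro exI[of _ "(e (fst (fst p)), e (snd (fst p)))"])
        (auto simp: topZ mid_def e_def)
  qed
  define s where "s z = restrict (\<lambda>t. if t \<le> 1/3 then H (fst z, max 0 (min 1 (3 * t)))
      else if t \<le> 2/3 then mid (z, t) else H (snd z, max 0 (min 1 (3 - 3 * t)))) {0..1}" for z
  have "continuous_map Z (path_space X) s"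
  proof (rule continuous_map_into_path_space)
    have snd_I: "continuous_map (prod_topology Z ?I) euclideanreal snd"
      by (rule continuous_map_into_fulltopology[OF continuous_map_snd])
    have *: "continuous_map (prod_topology Z ?I) X
      (\<lambda>p. if snd p \<le> 1/3 then H (fst (fst p), max 0 (min 1 (3 * snd p)))
        else if snd p \<le> 2/3 then mid p else H (snd (fst p), max 0 (min 1 (3 - 3 * snd p))))"
    proof (intro continuous_map_cases_le, goal_cases)
      case 3
      show ?case
        by (intro continuous_map_from_subtopology leg[of "\<lambda>t. max 0 (min 1 (3 * t))" fst] fst_Z)
          (auto intro!: continuous_intros)
    next
      case 6
      show ?case by (intro continuous_map_from_subtopology mid)
    next
      case 7
      show ?case
        by (intro continuous_map_from_subtopology leg[of "\<lambda>t. max 0 (min 1 (3 - 3 * t))" snd] snd_Z)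
          (auto intro!: continuous_intros)
    next
      case (8 p)
      then have "fst (fst p) \<in> topspace X" "snd (fst p) \<in> topspace X" "snd p = 2/3"
        using VX by (auto simp: topZ)
      with \<gamma>[OF Htop Htop, of "fst (fst p)" 1 "snd (fst p)" 1] show ?case
        by (cases p) (simp add: mid_def e_def)
    next
      case (9 p)
      then have "fst (fst p) \<in> topspace X" "snd (fst p) \<in> topspace X" "snd p = 1/3"
        using VX by (auto simp: topZ)
      with \<gamma>[OF Htop Htop, of "fst (fst p)" 1 "snd (fst p)" 1] show ?case
        by (cases p) (simp add: mid_def e_def)
    next
      case 1
      show ?case by (rule snd_I)
    next
      case 4
      show ?case by (intro continuous_map_from_subtopology snd_I)
    qed simp_all
    show "continuous_map (prod_topology Z ?I) X (\<lambda>(z, t). s z t)"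
      by (rule continuous_map_eq[OF *]) (auto simp: s_def)
  qed (auto simp: s_def)
  moreover have "path_ends (s z) = z" if "z \<in> V \<times> V" for z
    using that VX H0 by (auto simp: s_def path_ends_def)
  ultimately show ?thesis
    unfolding has_path_section_def Z_def by blast
qed

lemma TC_le_if_covered_by_deformable_squares:
  fixes V :: "nat \<Rightarrow> 'a set"
  assumes X: "path_connected_space X" "t1_space X"
    and V: "\<And>k. k \<in> {1..N} \<Longrightarrow> openin X (V k)"
    and H: "\<And>k. k \<in> {1..N} \<Longrightarrow> continuous_map (prod_topology X (top_of_set {0..1::real})) X (H k)"
    and H0: "\<And>k x. k \<in> {1..N} \<Longrightarrow> x \<in> topspace X \<Longrightarrow> H k (x, 0) = x"
    and fin: "\<And>k. k \<in> {1..N} \<Longrightarrow> finite ((\<lambda>x. H k (x, 1)) ` V k)"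
    and cover: "topspace X \<times> topspace X \<subseteq> (\<Union>k\<in>{1..N}. V k \<times> V k)"
  shows "TC X \<le> enat N"
proof -
  let ?U = "\<lambda>k. V k \<times> V k"
  have "openin (prod_topology X X) (?U k) \<and> has_path_section X (?U k)" if k: "k \<in> {1..N}" for k
    using V[OF k] has_path_section_if_deforms_to_finite[OF X V[OF k] H[OF k] H0[OF k] fin[OF k]]
    by (simp add: openin_prod_Times_iff)
  moreover have "(\<Union>k\<in>{1..N}. ?U k) = topspace X \<times> topspace X"
    using cover openin_subset[OF V] by blast
  ultimately have "\<exists>U. (\<forall>i\<in>{1..N}. openin (prod_topology X X) (U i) \<and> has_path_section X (U i)) \<and>
      (\<Union>i\<in>{1..N}. U i) = topspace X \<times> topspace X"
    by (intro exI[of _ ?U]) blast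
  then show ?thesis
    unfolding TC_def by (intro Inf_lower) blast
qed

section \<open>The change of argument along a path section\<close>

text \<open>The total change of the logarithm along a nowhere vanishing path. A logarithm along the path is
unique up to a constant, which the difference removes.\<close>

definition log_increment :: "(real \<Rightarrow> complex) \<Rightarrow> complex" where
  "log_increment \<alpha> =
    (let g = SOME g. continuous_on {0..1} g \<and> (\<forall>t\<in>{0..1}. \<alpha> t = exp (g t)) in g 1 - g 0)"

lemma log_increment_obtain:
  assumes "continuous_on {0..1} \<alpha>" "\<And>t. t \<in> {0..1} \<Longrightarrow> \<alpha> t \<noteq> 0"
  obtains g where "continuous_on {0..1} g" "\<And>t. t \<in> {0..1} \<Longrightarrow> \<alpha> t = exp (g t)"
    "log_increment \<alpha> = g 1 - g 0"
proof -
  let ?P = "\<lambda>g. continuous_on {0..1} g \<and> (\<forall>t\<in>{0..1}. \<alpha> t = exp (g t))"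
  have "contractible {0..1::real}"
    by (simp add: convex_imp_contractible)
  from continuous_logarithm_on_contractible[OF assms(1) this assms(2)]
  have "\<exists>g. ?P g"
    by metis
  then have "?P (SOME g. ?P g)"
    by (rule someI_ex)
  moreover have "log_increment \<alpha> = (SOME g. ?P g) 1 - (SOME g. ?P g) 0"
    unfolding log_increment_def Let_def ..
  ultimately show ?thesis
    using that by blast
qed

lemma exp_log_increment:
  assumes "continuous_on {0..1} \<alpha>" "\<And>t. t \<in> {0..1} \<Longrightarrow> \<alpha> t \<noteq> 0"
  shows "\<alpha> 1 = \<alpha> 0 * exp (log_increment \<alpha>)"
  by (rule log_increment_obtain[OF assms]) (auto simp: exp_diff)

text \<open>If two paths in the unit circle are closer than \<open>1\<close>, their quotient stays in the right half plane.
Hence the difference of logarithms along the two paths and the principal logarithm of the quotient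
differ by a continuous function with values in a discrete set. It follows that the change of the
logarithm is determined near a given path by the end points alone.\<close>

lemma log_increment_perturb:
  assumes \<alpha>: "continuous_on {0..1} \<alpha>" "\<And>t. t \<in> {0..1} \<Longrightarrow> norm (\<alpha> t) = 1"
    and \<beta>: "continuous_on {0..1} \<beta>" "\<And>t. t \<in> {0..1} \<Longrightarrow> norm (\<beta> t) = 1"
    and close: "\<And>t. t \<in> {0..1} \<Longrightarrow> norm (\<beta> t - \<alpha> t) < 1"
  shows "log_increment \<beta> = log_increment \<alpha> + (Ln (\<beta> 1 / \<alpha> 1) - Ln (\<beta> 0 / \<alpha> 0))"
proof -
  have nz: "\<alpha> t \<noteq> 0" "\<beta> t \<noteq> 0" if "t \<in> {0..1}" for t
    using \<alpha>(2)[OF that] \<beta>(2)[OF that] by auto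
  obtain a where a: "continuous_on {0..1} a" "\<And>t. t \<in> {0..1} \<Longrightarrow> \<alpha> t = exp (a t)"
    "log_increment \<alpha> = a 1 - a 0"
    using log_increment_obtain[OF \<alpha>(1) nz(1)] by blast
  obtain b where b: "continuous_on {0..1} b" "\<And>t. t \<in> {0..1} \<Longrightarrow> \<beta> t = exp (b t)"
    "log_increment \<beta> = b 1 - b 0"
    using log_increment_obtain[OF \<beta>(1) nz(2)] by blast
  have slit: "\<beta> t / \<alpha> t \<notin> \<real>\<^sub>\<le>\<^sub>0" if "t \<in> {0..1}" for t
  proof
    assume *: "\<beta> t / \<alpha> t \<in> \<real>\<^sub>\<le>\<^sub>0"
    have "norm (\<beta> t / \<alpha> t - 1) = norm ((\<beta> t - \<alpha> t) / \<alpha> t)"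
      using nz[OF that] by (simp add: diff_divide_distrib)
    also have "\<dots> < 1"
      using close[OF that] \<alpha>(2)[OF that] by (simp add: norm_divide)
    finally have "norm (\<beta> t / \<alpha> t - 1) < 1" .
    moreover have "\<bar>Re (\<beta> t / \<alpha> t - 1)\<bar> \<le> norm (\<beta> t / \<alpha> t - 1)"
      by (rule abs_Re_le_cmod)
    moreover have "Re (\<beta> t / \<alpha> t) \<le> 0"
      using * complex_nonpos_Reals_iff by blast
    then have "\<bar>Re (\<beta> t / \<alpha> t - 1)\<bar> \<ge> 1"
      unfolding minus_complex.sel one_complex.sel by linarith
    ultimately show False by linarith
  qed
  define h where "h t = b t - a t - Ln (\<beta> t / \<alpha> t)" for t
  have exp_h: "exp (h t) = 1" if "t \<in> {0..1}" for t
    using nz[OF that] a(2)[OF that] b(2)[OF that] by (simp add: h_def exp_diff)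
  have h: "continuous_on {0..1} h"
    unfolding h_def using slit nz by (intro continuous_intros a b \<alpha> \<beta>) auto
  have "\<exists>c. \<forall>t\<in>{0..1}. h t = c"
  proof (rule continuous_discrete_range_constant[OF _ h, unfolded constant_on_def])
    show "\<exists>e>0. \<forall>u. u \<in> {0..1} \<and> h u \<noteq> h t \<longrightarrow> e \<le> norm (h u - h t)" if "t \<in> {0..1}" for t
    proof (intro exI conjI allI impI)
      fix u assume u: "u \<in> {0..1} \<and> h u \<noteq> h t"
      then have "exp (h u - h t) = 1"
        using exp_h[OF that] exp_h[of u] by (simp add: exp_diff)
      then obtain n :: int where n: "Re (h u - h t) = 0" "Im (h u - h t) = of_int (2 * n) * pi"
        unfolding exp_eq_1 by blast
      with u have "n \<noteq> 0" by (auto simp: complex_eq_iff)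
      then have "1 \<le> \<bar>real_of_int n\<bar>" by linarith
      then have "1 \<le> \<bar>real_of_int n\<bar> * (2 * pi)"
        using mult_mono[of 1 "\<bar>real_of_int n\<bar>" 1 "2 * pi"] pi_gt3 by simp
      then have "1 \<le> \<bar>Im (h u - h t)\<bar>"
        using n(2) by (simp add: abs_mult mult_ac)
      then show "1 \<le> norm (h u - h t)"
        using abs_Im_le_cmod[of "h u - h t"] by linarith
    qed simp
  qed simp
  then have "h 0 = h 1" by (metis atLeastAtMost_iff order_refl zero_le_one)
  then show ?thesis
    by (simp add: a(3) b(3) h_def algebra_simps)
qed

text \<open>Near a given point, the path stays uniformly close to the path at that point (a condition on
finitely many compact time intervals), and there the previous lemma expresses the change of the
logarithm through the continuous end points of the path.\<close>

lemma continuous_map_log_increment_section: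
  assumes s: "continuous_map Z (path_space X) s"
    and \<phi>: "continuous_map X euclidean \<phi>" and unit: "\<And>x. x \<in> topspace X \<Longrightarrow> norm (\<phi> x) = 1"
  shows "continuous_map Z euclidean (\<lambda>z. log_increment (\<lambda>t. \<phi> (s z t)))"
proof -
  define \<alpha> where "\<alpha> z t = \<phi> (s z t)" for z t
  have path: "s z \<in> paths_in X" if "z \<in> topspace Z" for z
    using funcset_mem[OF continuous_map_funspace[OF s] that] by simp
  have top: "s z t \<in> topspace X" if "z \<in> topspace Z" "t \<in> {0..1}" for z t
    using path[OF that(1)] that(2) path_image_subset_topspace unfolding paths_in_def by fast
  have norm_\<alpha>: "norm (\<alpha> z t) = 1" if "z \<in> topspace Z" "t \<in> {0..1}" for z t
    unfolding \<alpha>_def by (rule unit) (rule top[OF that])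
  have cont_\<alpha>: "continuous_on {0..1} (\<alpha> z)" if "z \<in> topspace Z" for z
  proof -
    have "continuous_map (top_of_set {0..1}) X (s z)"
      using path[OF that] by (simp add: paths_in_def pathin_def)
    from continuous_map_compose[OF this \<phi>] show ?thesis
      by (simp add: \<alpha>_def[abs_def] o_def)
  qed
  have cont_end: "continuous_map Z euclidean (\<lambda>z. \<alpha> z t)" if "t \<in> {0..1}" for t
    using continuous_map_compose[OF continuous_map_compose[OF s continuous_map_path_space_eval[OF that]] \<phi>]
    by (simp add: \<alpha>_def o_def)
  have nbhd: "\<exists>T. openin Z T \<and> z0 \<in> T \<and> (\<forall>z\<in>T. \<forall>t\<in>{0..1}. norm (\<alpha> z t - \<alpha> z0 t) < 1)"
    if z0: "z0 \<in> topspace Z" for z0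
  proof -
    have "uniformly_continuous_on {0..1} (\<alpha> z0)"
      using cont_\<alpha>[OF z0] by (simp add: compact_uniformly_continuous)
    then obtain \<delta> where \<delta>: "\<delta> > 0"
      "\<And>t u. t \<in> {0..1} \<Longrightarrow> u \<in> {0..1} \<Longrightarrow> dist u t < \<delta> \<Longrightarrow> dist (\<alpha> z0 u) (\<alpha> z0 t) < 1/2"
      by (rule uniformly_continuous_onE[of _ _ "1/2"]) auto
    obtain N where N: "N > 0" "1 / real N < \<delta>"
      using real_arch_inverse[of \<delta>] \<delta>(1) by (auto simp: inverse_eq_divide)
    define K where "K j = {real j / N .. (real j + 1) / N}" for j
    define W where "W j = {x \<in> topspace X. \<phi> x \<in> ball (\<alpha> z0 (real j / N)) (1/2)}" for j
    define T where "T = topspace Z \<inter> (\<Inter>j<N. {z \<in> topspace Z. s z \<in> {g \<in> paths_in X. g ` K j \<subseteq> W j}})"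
    have K: "K j \<subseteq> {0..1}" if "j < N" for j
      using that N(1) by (auto simp: K_def field_simps)
    have W: "openin X (W j)" for j
      unfolding W_def by (rule openin_continuous_map_preimage[OF \<phi>]) simp
    have "openin Z {z \<in> topspace Z. s z \<in> {g \<in> paths_in X. g ` K j \<subseteq> W j}}" if "j < N" for j
      by (rule openin_continuous_map_preimage[OF s])
        (rule openin_path_space[OF K[OF that] _ W], simp add: K_def)
    then have T: "openin Z T"
      unfolding T_def using N(1) by (intro openin_Int openin_Inter) auto
    have near: "dist (\<alpha> z0 (real j / N)) (\<alpha> z0 t) < 1/2" if "j < N" "t \<in> K j" for j t
    proof (rule \<delta>(2))
      show "t \<in> {0..1}" using K that by blast
      show "real j / N \<in> {0..1}" using that by auto
      have "\<bar>real j / N - t\<bar> \<le> 1 / N"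
        using that(2) by (auto simp: K_def add_divide_distrib)
      then show "dist (real j / N) t < \<delta>"
        using N(2) by (simp add: dist_real_def)
    qed
    have "z0 \<in> T"
    proof -
      have "s z0 t \<in> W j" if "j < N" "t \<in> K j" for j t
        using near[OF that] top[OF z0, of t] K[OF that(1)] that(2) by (auto simp: W_def \<alpha>_def)
      then show ?thesis
        using z0 path[OF z0] by (auto simp: T_def)
    qed
    moreover have "norm (\<alpha> z t - \<alpha> z0 t) < 1" if z: "z \<in> T" and t: "t \<in> {0..1}" for z t
    proof -
      obtain j where j: "j < N" "t \<in> K j"
      proof (cases "t = 1")
        case True
        then show ?thesis using N(1) by (intro that[of "N - 1"]) (auto simp: K_def field_simps)
      next
        case False
        define j where "j = nat \<lfloor>t * N\<rfloor>"
        have "real j \<le> t * N" "t * N \<le> real j + 1"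
          using t by (auto simp: j_def)
        moreover have "t * N < N"
          using False t N(1) by simp
        ultimately show ?thesis
          using N(1) by (intro that[of j]) (linarith, simp add: K_def field_simps)
      qed
      have "s z t \<in> W j"
        using z j by (auto simp: T_def)
      then have "dist (\<alpha> z0 (real j / N)) (\<alpha> z t) < 1/2"
        by (simp add: W_def \<alpha>_def)
      with near[OF j] have "dist (\<alpha> z t) (\<alpha> z0 t) < 1"
        using dist_triangle3[of "\<alpha> z t" "\<alpha> z0 t" "\<alpha> z0 (real j / N)"] by linarith
      then show ?thesis by (simp add: dist_norm)
    qed
    ultimately show ?thesis using T by blast
  qed
  define I where "I = {(T, z0). openin Z T \<and> z0 \<in> topspace Z \<and>
      (\<forall>z\<in>T. \<forall>t\<in>{0..1}. norm (\<alpha> z t - \<alpha> z0 t) < 1)}"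
  have "continuous_map Z euclidean (\<lambda>z. log_increment (\<alpha> z))"
  proof (rule pasting_lemma[where I = I and T = fst and f = "\<lambda>_ z. log_increment (\<alpha> z)"])
    show "openin Z (fst i)" if "i \<in> I" for i
      using that by (auto simp: I_def)
    show "\<exists>j. j \<in> I \<and> z \<in> fst j \<and> log_increment (\<alpha> z) = log_increment (\<alpha> z)"
      if z: "z \<in> topspace Z" for z
    proof -
      obtain T where "openin Z T \<and> z \<in> T \<and> (\<forall>w\<in>T. \<forall>t\<in>{0..1}. norm (\<alpha> w t - \<alpha> z t) < 1)"
        using nbhd[OF z] by blast
      then show ?thesis using z by (intro exI[of _ "(T, z)"]) (simp add: I_def)
    qed
    show "continuous_map (subtopology Z (fst i)) euclidean (\<lambda>z. log_increment (\<alpha> z))" if i: "i \<in> I" for i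
    proof -
      obtain T z0 where T: "i = (T, z0)" "openin Z T" "z0 \<in> topspace Z"
        "\<And>z t. z \<in> T \<Longrightarrow> t \<in> {0..1} \<Longrightarrow> norm (\<alpha> z t - \<alpha> z0 t) < 1"
        using i unfolding I_def by auto
      have TZ: "T \<subseteq> topspace Z" using openin_subset[OF T(2)] .
      have Ln_end: "continuous_map (subtopology Z T) euclidean (\<lambda>z. Ln (\<alpha> z t / \<alpha> z0 t))"
        if t: "t \<in> {0..1}" for t
      proof -
        have nz: "\<alpha> z0 t \<noteq> 0" using norm_\<alpha>[OF T(3) t] by auto
        have "norm (\<alpha> z t / \<alpha> z0 t - 1) < 1" if "z \<in> T" for z
        proof -
          have "norm (\<alpha> z t / \<alpha> z0 t - 1) = norm ((\<alpha> z t - \<alpha> z0 t) / \<alpha> z0 t)"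
            using nz by (simp add: diff_divide_distrib)
          then show ?thesis
            using T(4)[OF that t] norm_\<alpha>[OF T(3) t] by (simp add: norm_divide)
        qed
        then have im: "(\<lambda>z. \<alpha> z t / \<alpha> z0 t) \<in> topspace (subtopology Z T) \<rightarrow> ball 1 1"
          by (auto simp: dist_norm norm_minus_commute)
        have "continuous_map euclidean euclidean (\<lambda>w. w / \<alpha> z0 t)"
          using nz by (auto intro!: continuous_intros)
        from continuous_map_compose[OF cont_end[OF t] this]
        have "continuous_map (subtopology Z T) euclidean (\<lambda>z. \<alpha> z t / \<alpha> z0 t)"
          by (simp add: o_def continuous_map_from_subtopology)
        then have "continuous_map (subtopology Z T) (top_of_set (ball 1 1)) (\<lambda>z. \<alpha> z t / \<alpha> z0 t)"
          using im by (rule continuous_map_into_subtopology)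
        moreover have "continuous_map (top_of_set (ball 1 1)) euclidean Ln"
        proof -
          have "w \<notin> \<real>\<^sub>\<le>\<^sub>0" if "w \<in> ball 1 1" for w :: complex
          proof
            assume "w \<in> \<real>\<^sub>\<le>\<^sub>0"
            then have "Re w \<le> 0" using complex_nonpos_Reals_iff by blast
            then have "\<bar>Re (1 - w)\<bar> \<ge> 1" by simp
            with that abs_Re_le_cmod[of "1 - w"] show False by (simp add: dist_norm)
          qed
          then show ?thesis by (auto intro!: continuous_on_Ln continuous_on_id)
        qed
        ultimately show ?thesis
          using continuous_map_compose[of _ _ _ euclidean Ln, unfolded o_def] by blast
      qed
      have "continuous_map (subtopology Z T) euclidean
          (\<lambda>z. log_increment (\<alpha> z0) + (Ln (\<alpha> z 1 / \<alpha> z0 1) - Ln (\<alpha> z 0 / \<alpha> z0 0)))"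
        by (intro continuous_map_add continuous_map_diff Ln_end) auto
      then have "continuous_map (subtopology Z T) euclidean (\<lambda>z. log_increment (\<alpha> z))"
      proof (rule continuous_map_eq)
        fix z assume "z \<in> topspace (subtopology Z T)"
        then have z: "z \<in> T" "z \<in> topspace Z" using TZ by auto
        show "log_increment (\<alpha> z0) + (Ln (\<alpha> z 1 / \<alpha> z0 1) - Ln (\<alpha> z 0 / \<alpha> z0 0)) = log_increment (\<alpha> z)"
          by (rule log_increment_perturb[symmetric])
            (use z T cont_\<alpha> norm_\<alpha> in auto)
      qed
      then show ?thesis by (simp add: T(1))
    qed
  qed simp
  then show ?thesis by (simp add: \<alpha>_def[abs_def])
qed

section \<open>A covering theorem for the torus\<close>

text \<open>Euclidean space of varying dimension \<open>m\<close> is realised inside the sequences of real numbers, by the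
sequences that vanish from index \<open>m\<close> on.\<close>

definition grid_cell :: "nat \<Rightarrow> nat \<Rightarrow> (nat \<Rightarrow> nat) \<Rightarrow> (nat \<Rightarrow> real) set" where
  "grid_cell m M y = {x. (\<forall>j<m. real (y j) / M \<le> x j \<and> x j \<le> (real (y j) + 1) / M) \<and> (\<forall>j\<ge>m. x j = 0)}"

lemma grid_cell_eq_PiE:
  "grid_cell m M y =
    PiE UNIV (\<lambda>j. if j < m then {real (y j) / M .. (real (y j) + 1) / M} else {0})"
  by (auto simp: grid_cell_def PiE_def Pi_def not_less split: if_splits)

lemma compact_grid_cell: "compact (grid_cell m M y)"
proof -
  have "compactin (product_topology (\<lambda>_. euclideanreal) UNIV) (grid_cell m M y)"
    unfolding grid_cell_eq_PiE compactin_PiE by auto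
  then show ?thesis by (simp add: euclidean_product_topology)
qed

text \<open>By Lebesgue's number lemma in the compact cube of all sequences in the unit interval. The metric on
sequences weighs the coordinates geometrically, so that cells with short sides have small diameter.\<close>

lemma grid_cells_refine_open_cover:
  fixes W :: "nat \<Rightarrow> (nat \<Rightarrow> real) set"
  assumes W: "\<And>i. i < m \<Longrightarrow> open (W i)" and cover: "(\<Union>i<m. W i) = UNIV"
  obtains M where "M > 0" "\<And>y. (\<And>j. j < m \<Longrightarrow> y j < M) \<Longrightarrow> \<exists>i<m. grid_cell m M y \<subseteq> W i"
proof -
  define S where "S = PiE UNIV (\<lambda>_::nat. {0..1::real})"
  have "compactin (product_topology (\<lambda>_. euclideanreal) UNIV) S"
    unfolding S_def compactin_PiE by auto
  then have S: "compact S" by (simp add: euclidean_product_topology)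
  have ne: "W ` {..<m} \<noteq> {}" using cover by auto
  have sub: "S \<subseteq> \<Union> (W ` {..<m})" using cover by simp
  have ope: "open B" if "B \<in> W ` {..<m}" for B using that W by auto
  obtain \<delta> where \<delta>: "0 < \<delta>" "\<And>T. \<lbrakk>T \<subseteq> S; diameter T < \<delta>\<rbrakk> \<Longrightarrow> \<exists>B\<in>W ` {..<m}. T \<subseteq> B"
    by (rule Lebesgue_number_lemma[OF S ne sub ope]) (assumption, rule that, assumption, blast)
  obtain N where N: "(1/2::real) ^ N < \<delta> / 4"
    using real_arch_pow_inv[of "\<delta>/4" "1/2"] \<delta>(1) by auto
  obtain M where M: "M > 0" "1 / real M < \<delta> / 8"
    using real_arch_inverse[of "\<delta> / 8"] \<delta>(1) by (auto simp: inverse_eq_divide)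
  show ?thesis
  proof (rule that[OF M(1)])
    fix y assume y: "\<And>j. j < m \<Longrightarrow> y j < M"
    let ?T = "grid_cell m M y"
    have "x j \<in> {0..1}" if x: "x \<in> ?T" for x j
    proof (cases "j < m")
      case True
      then have "0 \<le> real (y j) / M" "(real (y j) + 1) / M \<le> 1"
        using y[OF True] M(1) by (auto simp: field_simps)
      moreover have "real (y j) / M \<le> x j" "x j \<le> (real (y j) + 1) / M"
        using x True by (auto simp: grid_cell_def)
      ultimately show ?thesis unfolding atLeastAtMost_iff by linarith
    qed (use x in \<open>auto simp: grid_cell_def\<close>)
    then have TS: "?T \<subseteq> S" by (auto simp: S_def)
    have close: "dist (x j) (x' j) \<le> 1 / M" if "x \<in> ?T" "x' \<in> ?T" for x x' j
    proof (cases "j < m")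
      case True
      then have "real (y j) / M \<le> x j" "x j \<le> (real (y j) + 1) / M"
        "real (y j) / M \<le> x' j" "x' j \<le> (real (y j) + 1) / M"
        using that by (auto simp: grid_cell_def)
      then show ?thesis unfolding dist_real_def add_divide_distrib by linarith
    qed (use that in \<open>auto simp: grid_cell_def\<close>)
    have d: "dist x x' \<le> \<delta> / 2" if xx: "x \<in> ?T" "x' \<in> ?T" for x x'
    proof -
      have "Max {dist (x (from_nat n)) (x' (from_nat n)) |n. n \<le> N} \<le> 1 / M"
        by (rule Max.boundedI) (auto intro!: close xx)
      with dist_fun_le_dist_first_terms[of x x' N] N M(2) show ?thesis by linarith
    qed
    have "diameter ?T \<le> \<delta> / 2"
    proof (cases "?T = {}")
      case False
      show ?thesis
        unfolding diameter_def if_not_P[OF False] by (rule cSUP_least) (use False d in auto)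
    qed (use \<delta>(1) in simp)
    then obtain B where "B \<in> W ` {..<m}" "?T \<subseteq> B"
      using \<delta>(2)[OF TS] \<delta>(1) by auto
    then show "\<exists>i<m. ?T \<subseteq> W i" by blast
  qed
qed

text \<open>At \<open>z = (x, y)\<close> the change of the logarithm along the path from \<open>x\<close> to \<open>y\<close> is a logarithm of
\<open>\<phi> y / \<phi> x\<close>, and any two logarithms differ by an integer multiple of \<open>2 * pi * \<i>\<close>.\<close>

lemma section_log_increment:
  assumes s: "continuous_map (subtopology (prod_topology X X) U) (path_space X) s"
    and ends: "\<And>z. z \<in> U \<Longrightarrow> path_ends (s z) = z"
    and U: "U \<subseteq> topspace X \<times> topspace X"
    and \<phi>: "continuous_map X euclidean \<phi>" and unit: "\<And>x. x \<in> topspace X \<Longrightarrow> norm (\<phi> x) = 1"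
    and z: "z \<in> U" and g: "\<phi> (snd z) = \<phi> (fst z) * cis (2 * pi * a)"
  shows "a - Im (log_increment (\<lambda>t. \<phi> (s z t))) / (2 * pi) \<in> \<int>"
proof -
  let ?l = "log_increment (\<lambda>t. \<phi> (s z t))"
  have "s z \<in> paths_in X"
    using funcset_mem[OF continuous_map_funspace[OF s], of z] z U by auto
  then have p: "continuous_map (top_of_set {0..1}) X (s z)"
    by (simp add: paths_in_def pathin_def)
  have cont: "continuous_on {0..1} (\<lambda>t. \<phi> (s z t))"
    using continuous_map_compose[OF p \<phi>] by (simp add: o_def)
  have nz: "\<phi> (s z t) \<noteq> 0" if "t \<in> {0..1}" for t
  proof -
    have "s z t \<in> topspace X"
      using funcset_mem[OF continuous_map_funspace[OF p], of t] that by simp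
    from unit[OF this] show ?thesis by auto
  qed
  have e: "s z 0 = fst z" "s z 1 = snd z"
    using ends[OF z] unfolding path_ends_def by (metis fst_conv, metis snd_conv)
  have "\<phi> (snd z) = \<phi> (fst z) * exp ?l"
    using exp_log_increment[OF cont nz] by (simp add: e)
  then have "exp ?l = cis (2 * pi * a)"
    using g nz[of 0] by (simp add: e)
  then have "exp (\<i> * of_real (2 * pi * a) - ?l) = 1"
    by (simp add: exp_diff cis_conv_exp)
  then obtain n :: int where "Im (\<i> * of_real (2 * pi * a) - ?l) = of_int (2 * n) * pi"
    unfolding exp_eq_1 by blast
  then have "2 * pi * a - Im ?l = 2 * pi * of_int n"
    by simp
  then have "a - Im ?l / (2 * pi) = of_int n"
    by (simp add: field_simps)
  then show ?thesis by simp
qed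

lemma integer_valued_continuous_constant:
  fixes h :: "real \<Rightarrow> real"
  assumes h: "continuous_on {0..1} h" and int: "\<And>u. u \<in> {0..1} \<Longrightarrow> h u \<in> \<int>"
  shows "h 0 = h 1"
proof -
  have "h constant_on {0..1}"
  proof (rule continuous_discrete_range_constant[OF _ h])
    show "\<exists>e>0. \<forall>v. v \<in> {0..1} \<and> h v \<noteq> h u \<longrightarrow> e \<le> norm (h v - h u)" if u: "u \<in> {0..1}" for u
    proof (intro exI[of _ "1::real"] conjI allI impI)
      fix v assume v: "v \<in> {0..1} \<and> h v \<noteq> h u"
      then have "h v - h u \<in> \<int>" "h v - h u \<noteq> 0"
        using int u by auto
      then show "1 \<le> norm (h v - h u)"
        using Ints_nonzero_abs_ge1[of "h v - h u"] by simp
    qed simp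
  qed simp
  then show ?thesis
    unfolding constant_on_def by force
qed

text \<open>The map \<open>c\<close> plays the role of the universal cover of a torus in \<open>X \<times> X\<close>. With \<open>\<theta> i\<close> the change of
argument of \<open>\<phi> i\<close> along the section on \<open>U i\<close>, in full turns, the number \<open>g (x i) - \<theta> i (c x)\<close> is an
integer. On the cells of a fine grid one of the \<open>\<theta> i\<close> is defined and bounded by a constant \<open>B\<close>, which
periodicity makes independent of the cell; hence, where this bound holds, the integer has opposite signs on
opposite faces of a cube of side much larger than \<open>B\<close>. Kuhn's lemma for the labels given by these signs yields a cell on
whose vertices all labels change. But the cell is connected and lies over some \<open>U i\<close>, where the
integer cannot change.\<close>

lemma torus_no_small_motion_cover:
  fixes c :: "(nat \<Rightarrow> real) \<Rightarrow> 'a \<times> 'a" and g :: "real \<Rightarrow> real"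
  assumes c: "continuous_map euclidean (prod_topology X X) c"
    and per: "\<And>x z. (\<And>i. z i \<in> \<int>) \<Longrightarrow> c (\<lambda>i. x i + z i) = c x"
    and \<phi>: "\<And>i. i < m \<Longrightarrow> continuous_map X euclidean (\<phi> i)"
    and unit: "\<And>i x. i < m \<Longrightarrow> x \<in> topspace X \<Longrightarrow> norm (\<phi> i x) = 1"
    and g: "continuous_on UNIV g" "\<And>x. g (x + 1) = g x + 1"
    and rel: "\<And>i x. i < m \<Longrightarrow> \<phi> i (snd (c x)) = \<phi> i (fst (c x)) * cis (2 * pi * g (x i))"
    and U: "\<And>i. i < m \<Longrightarrow> openin (prod_topology X X) (U i)"
    and sec: "\<And>i. i < m \<Longrightarrow> has_path_section X (U i)"
    and cover: "topspace X \<times> topspace X \<subseteq> (\<Union>i<m. U i)"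
  shows False
proof -
  have "\<exists>s. continuous_map (subtopology (prod_topology X X) (U i)) (path_space X) s \<and>
         (\<forall>z\<in>U i. path_ends (s z) = z)" if "i < m" for i
    using sec[OF that] by (simp add: has_path_section_def)
  then have "\<forall>i\<in>{..<m}. \<exists>s. continuous_map (subtopology (prod_topology X X) (U i)) (path_space X) s \<and>
         (\<forall>z\<in>U i. path_ends (s z) = z)"
    by simp
  from bchoice[OF this] obtain s where
    "\<forall>i\<in>{..<m}. continuous_map (subtopology (prod_topology X X) (U i)) (path_space X) (s i) \<and>
         (\<forall>z\<in>U i. path_ends (s i z) = z)" ..
  then have s: "\<And>i. i < m \<Longrightarrow> continuous_map (subtopology (prod_topology X X) (U i)) (path_space X) (s i)"
    "\<And>i z. i < m \<Longrightarrow> z \<in> U i \<Longrightarrow> path_ends (s i z) = z"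
    by simp_all
  have UX: "U i \<subseteq> topspace X \<times> topspace X" if "i < m" for i
    using openin_subset[OF U[OF that]] by simp
  define \<theta> where "\<theta> i z = Im (log_increment (\<lambda>t. \<phi> i (s i z t))) / (2 * pi)" for i z
  have \<theta>: "continuous_map (subtopology (prod_topology X X) (U i)) euclideanreal (\<theta> i)" if "i < m" for i
  proof -
    have "continuous_map euclidean euclideanreal (\<lambda>w. Im w / (2 * pi))"
      by (auto intro!: continuous_intros)
    from continuous_map_compose[OF continuous_map_log_increment_section[OF s(1) \<phi> unit] this]
    show ?thesis using that by (simp add: \<theta>_def[abs_def] o_def)
  qed
  have int: "g (x i) - \<theta> i (c x) \<in> \<int>" if "i < m" "c x \<in> U i" for i x
    unfolding \<theta>_def
    using section_log_increment[OF s(1)[OF that(1)] s(2)[OF that(1)] UX[OF that(1)] \<phi>[OF that(1)]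
        unit[OF that(1)] that(2) rel[OF that(1)]] .
  define W where "W i = {x. c x \<in> U i}" for i
  have W: "open (W i)" if "i < m" for i
    using openin_continuous_map_preimage[OF c U[OF that]] by (simp add: W_def)
  have "c x \<in> topspace X \<times> topspace X" for x
    using funcset_mem[OF continuous_map_funspace[OF c], of x] by simp
  then have "c x \<in> (\<Union>i<m. U i)" for x
    using cover by (rule subsetD[rotated])
  then have "(\<Union>i<m. W i) = UNIV"
    by (auto simp: W_def)
  then obtain M where M: "M > 0" "\<And>y. (\<And>j. j < m \<Longrightarrow> y j < M) \<Longrightarrow> \<exists>i<m. grid_cell m M y \<subseteq> W i"
    by (rule grid_cells_refine_open_cover[OF W, rotated]) (rule that, assumption, blast, assumption)
  have \<theta>c: "continuous_on (W i) (\<lambda>x. \<theta> i (c x))" if "i < m" for i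
  proof -
    have "continuous_map (top_of_set (W i)) (subtopology (prod_topology X X) (U i)) c"
      by (rule continuous_map_into_subtopology) (auto simp: W_def intro: continuous_map_from_subtopology c)
    from continuous_map_compose[OF this \<theta>[OF that]] show ?thesis by (simp add: o_def)
  qed
  define Y where "Y = PiE {..<m} (\<lambda>_. {..<M})"
  have finY: "finite Y" unfolding Y_def by (intro finite_PiE) auto
  have "\<forall>y\<in>Y. \<exists>b. \<exists>i<m. grid_cell m M y \<subseteq> W i \<and> (\<forall>x\<in>grid_cell m M y. \<bar>\<theta> i (c x)\<bar> \<le> b)"
  proof
    fix y assume "y \<in> Y"
    then have "y j < M" if "j < m" for j using that by (auto simp: Y_def)
    then obtain i where i: "i < m" "grid_cell m M y \<subseteq> W i" using M(2) by blast
    have "compact ((\<lambda>x. \<theta> i (c x)) ` grid_cell m M y)"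
      by (rule compact_continuous_image[OF continuous_on_subset[OF \<theta>c[OF i(1)] i(2)] compact_grid_cell])
    then have "bounded ((\<lambda>x. \<theta> i (c x)) ` grid_cell m M y)"
      by (rule compact_imp_bounded)
    then obtain b where "\<forall>r\<in>(\<lambda>x. \<theta> i (c x)) ` grid_cell m M y. norm r \<le> b"
      unfolding bounded_iff by blast
    with i show "\<exists>b. \<exists>i<m. grid_cell m M y \<subseteq> W i \<and> (\<forall>x\<in>grid_cell m M y. \<bar>\<theta> i (c x)\<bar> \<le> b)"
      by auto
  qed
  from bchoice[OF this] obtain b where b: "\<forall>y\<in>Y. \<exists>i<m. grid_cell m M y \<subseteq> W i \<and> (\<forall>x\<in>grid_cell m M y. \<bar>\<theta> i (c x)\<bar> \<le> b y)"
    ..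
  define B where "B = Max (insert 0 (b ` Y))"
  have B: "b y \<le> B" if "y \<in> Y" for y
    unfolding B_def using that finY by (intro Max_ge) auto
  obtain N :: nat where N: "real N > B + \<bar>g 0\<bar>" "N > 0"
    using reals_Archimedean2[of "max 0 (B + \<bar>g 0\<bar>)"] by auto
  have g_nat: "g (x + real k) = g x + real k" for x k
  proof (induction k)
    case (Suc k)
    then show ?case using g(2)[of "x + real k"] by (simp add: add_ac)
  qed simp
  define p where "p = 2 * N * M"
  define pt where "pt q i = (if i < m then real (q i) / M - real N else 0)" for q :: "nat \<Rightarrow> nat" and i
  \<comment> \<open>Outside the region where \<open>\<theta> i\<close> is defined and bounded by \<open>B\<close>, the labels only have to satisfy the
    boundary conditions of Kuhn's lemma.\<close>
  define label :: "(nat \<Rightarrow> nat) \<Rightarrow> nat \<Rightarrow> nat" where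
    "label q i = (if c (pt q) \<in> U i \<and> \<bar>\<theta> i (c (pt q))\<bar> \<le> B
        then if g (pt q i) - \<theta> i (c (pt q)) \<ge> 0 then 1 else 0
        else if q i = p then 1 else 0)" for q i
  have p: "p > 0" using M(1) N(2) by (simp add: p_def)
  have g_low: "g (- real N) = g 0 - real N" and g_high: "g (real N) = g 0 + real N"
    using g_nat[of "- real N" N] g_nat[of 0 N] by simp_all
  have label0: "label x i = 0" if "i < m" "x i = 0" for x i
    using that p N g_low by (auto simp: label_def pt_def abs_le_iff)
  have label1: "label x i = 1" if "i < m" "x i = p" for x i
  proof -
    have "pt x i = real N" using that M(1) by (simp add: pt_def p_def)
    then show ?thesis using that N g_high by (auto simp: label_def abs_le_iff)
  qed
  have label01: "label x i = 0 \<or> label x i = 1" for x i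
    by (simp add: label_def)
  obtain q where q: "\<forall>i<m. q i < p"
    "\<forall>i<m. \<exists>r s. (\<forall>j<m. q j \<le> r j \<and> r j \<le> q j + 1) \<and> (\<forall>j<m. q j \<le> s j \<and> s j \<le> q j + 1) \<and>
       label r i \<noteq> label s i"
    by (rule kuhn_lemma[OF p, of m label]) (use label01 label0 label1 in blast)+
  define y where "y = restrict (\<lambda>j. q j mod M) {..<m}"
  have yY: "y \<in> Y" using M(1) by (auto simp: y_def Y_def)
  obtain i where i: "i < m" "grid_cell m M y \<subseteq> W i" "\<And>x. x \<in> grid_cell m M y \<Longrightarrow> \<bar>\<theta> i (c x)\<bar> \<le> B"
  proof -
    obtain i where i: "i < m" "grid_cell m M y \<subseteq> W i" "\<forall>x\<in>grid_cell m M y. \<bar>\<theta> i (c x)\<bar> \<le> b y"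
      using bspec[OF b yY] by (elim exE conjE)
    show ?thesis
      by (rule that[OF i(1,2)]) (use i(3) B[OF yY] in force)
  qed
  define Q where "Q = {x. (\<forall>j<m. real (q j) / M - N \<le> x j \<and> x j \<le> (real (q j) + 1) / M - N) \<and> (\<forall>j\<ge>m. x j = 0)}"
  have Q: "c x \<in> U i" "\<bar>\<theta> i (c x)\<bar> \<le> B" if x: "x \<in> Q" for x
  proof -
    \<comment> \<open>an integer translation that carries \<open>Q\<close> into the unit cube\<close>
    define z where "z j = (if j < m then real N - real (q j div M) else 0)" for j
    have "real (q j) / M = real (q j div M) + real (y j) / M" if "j < m" for j
    proof -
      have "real (q j) = real (q j div M) * M + real (q j mod M)"
        by (metis div_mult_mod_eq of_nat_add of_nat_mult)
      then show ?thesis using M(1) that by (simp add: y_def field_simps)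
    qed
    then have "(\<lambda>j. x j + z j) \<in> grid_cell m M y"
      using x by (force simp: Q_def grid_cell_def z_def add_divide_distrib)
    moreover have "c (\<lambda>j. x j + z j) = c x"
      by (rule per) (auto simp: z_def)
    ultimately show "c x \<in> U i" "\<bar>\<theta> i (c x)\<bar> \<le> B"
      using i(2) i(3)[of "\<lambda>j. x j + z j"] by (auto simp: W_def)
  qed
  obtain r s where rs: "\<forall>j<m. q j \<le> r j \<and> r j \<le> q j + 1" "\<forall>j<m. q j \<le> s j \<and> s j \<le> q j + 1"
    "label r i \<noteq> label s i"
    using q(2) i(1) by blast
  have ptQ: "pt r \<in> Q" if "\<forall>j<m. q j \<le> r j \<and> r j \<le> q j + 1" for r
  proof -
    have "real (q j) / M \<le> real (r j) / M \<and> real (r j) / M \<le> (real (q j) + 1) / M" if "j < m" for j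
      using \<open>\<forall>j<m. q j \<le> r j \<and> r j \<le> q j + 1\<close>[rule_format, OF that] M(1)
      by (intro conjI divide_right_mono) auto
    then show ?thesis by (simp add: Q_def pt_def)
  qed
  define seg where "seg u = (\<lambda>j. (1 - u) * pt r j + u * pt s j)" for u :: real
  have segQ: "seg u \<in> Q" if u: "u \<in> {0..1}" for u
  proof -
    have r: "pt r \<in> Q" and s: "pt s \<in> Q" using ptQ rs by auto
    have conv: "l \<le> (1 - u) * v + u * w \<and> (1 - u) * v + u * w \<le> h"
      if "l \<le> v \<and> v \<le> h" "l \<le> w \<and> w \<le> h" for l v w h :: real
      using convexD_alt[of "{l..h}" v w u] that u by auto
    have "real (q j) / M - N \<le> seg u j \<and> seg u j \<le> (real (q j) + 1) / M - N" if "j < m" for j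
      unfolding seg_def by (rule conv) (use r s that in \<open>auto simp: Q_def\<close>)
    moreover have "seg u j = 0" if "j \<ge> m" for j
      using that by (simp add: seg_def pt_def)
    ultimately show ?thesis by (simp add: Q_def)
  qed
  define \<kappa> where "\<kappa> x = g (x i) - \<theta> i (c x)" for x
  have "\<kappa> (seg 0) = \<kappa> (seg 1)"
  proof (rule integer_valued_continuous_constant)
    have seg: "continuous_on {0..1} seg"
      unfolding seg_def by (intro continuous_on_coordinatewise_then_product continuous_intros)
    have "continuous_on {0..1} (\<lambda>u. \<theta> i (c (seg u)))"
      by (rule continuous_on_compose2[OF \<theta>c[OF i(1)] seg]) (use segQ Q in \<open>auto simp: W_def\<close>)
    moreover have "continuous_on {0..1} (\<lambda>u. g (seg u i))"
      by (rule continuous_on_compose2[OF g(1)]) (auto simp: seg_def intro!: continuous_intros)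
    ultimately show "continuous_on {0..1} (\<lambda>u. \<kappa> (seg u))"
      unfolding \<kappa>_def by (rule continuous_on_diff[rotated])
    show "\<kappa> (seg u) \<in> \<int>" if "u \<in> {0..1}" for u
      unfolding \<kappa>_def by (rule int[OF i(1) Q(1)[OF segQ[OF that]]])
  qed
  then have "\<kappa> (pt r) = \<kappa> (pt s)" by (simp add: seg_def)
  moreover have "label t i = (if \<kappa> (pt t) \<ge> 0 then 1 else 0)" if "pt t \<in> Q" for t
    using Q[OF that] by (simp add: label_def \<kappa>_def)
  ultimately show False
    using rs ptQ by simp
qed

text \<open>A cover by fewer than \<open>m\<close> sets is padded with empty sets, on which a section exists trivially.\<close>

lemma TC_ge_if_torus:
  fixes c :: "(nat \<Rightarrow> real) \<Rightarrow> 'a \<times> 'a" and g :: "real \<Rightarrow> real"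
  assumes c: "continuous_map euclidean (prod_topology X X) c"
    and per: "\<And>x z. (\<And>i. z i \<in> \<int>) \<Longrightarrow> c (\<lambda>i. x i + z i) = c x"
    and \<phi>: "\<And>i. i < m \<Longrightarrow> continuous_map X euclidean (\<phi> i)"
    and unit: "\<And>i x. i < m \<Longrightarrow> x \<in> topspace X \<Longrightarrow> norm (\<phi> i x) = 1"
    and g: "continuous_on UNIV g" "\<And>x. g (x + 1) = g x + 1"
    and rel: "\<And>i x. i < m \<Longrightarrow> \<phi> i (snd (c x)) = \<phi> i (fst (c x)) * cis (2 * pi * g (x i))"
  shows "enat (m + 1) \<le> TC X"
  unfolding TC_def
proof (rule Inf_greatest)
  fix K assume "K \<in> {enat k |k. \<exists>U. (\<forall>i\<in>{1..k}. openin (prod_topology X X) (U i) \<and> has_path_section X (U i)) \<and>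
      (\<Union>i\<in>{1..k}. U i) = topspace X \<times> topspace X}"
  then obtain k U where K: "K = enat k"
    and U: "\<And>i. i \<in> {1..k} \<Longrightarrow> openin (prod_topology X X) (U i) \<and> has_path_section X (U i)"
    and cover: "(\<Union>i\<in>{1..k}. U i) = topspace X \<times> topspace X"
    by blast
  show "enat (m + 1) \<le> K"
  proof (rule ccontr)
    assume "\<not> enat (m + 1) \<le> K"
    then have km: "k \<le> m" by (simp add: K)
    define U' where "U' i = (if Suc i \<le> k then U (Suc i) else {})" for i
    show False
    proof (rule torus_no_small_motion_cover[OF c per \<phi> unit g rel])
      show "openin (prod_topology X X) (U' i)" for i
        using U[of "Suc i"] by (simp add: U'_def)
      show "has_path_section X (U' i)" for i
        using U[of "Suc i"] by (simp add: U'_def) (simp add: has_path_section_def continuous_map_on_empty)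
      show "topspace X \<times> topspace X \<subseteq> (\<Union>i<m. U' i)"
      proof
        fix z assume "z \<in> topspace X \<times> topspace X"
        then obtain i where "i \<in> {1..k}" "z \<in> U i" using cover by blast
        then show "z \<in> (\<Union>i<m. U' i)"
          using km by (intro UN_I[of "i - 1"]) (auto simp: U'_def)
      qed
    qed auto
  qed
qed

section \<open>Points and closed cells of a graph\<close>

text \<open>A finite union of continuous images of a compact space in a Hausdorff space carries the quotient
topology, because the maps are closed. Applied to the characteristic maps of the edges, this replaces
the weak topology of a CW complex.\<close>

lemma continuous_map_from_compact_cover:
  assumes P: "Hausdorff_space P" and Q: "compact_space Q" and fin: "finite \<Q>"
    and q: "\<And>q. q \<in> \<Q> \<Longrightarrow> continuous_map Q P q"
    and cover: "topspace P \<subseteq> (\<Union>q\<in>\<Q>. q ` topspace Q)"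
    and f: "\<And>q. q \<in> \<Q> \<Longrightarrow> continuous_map Q Y (\<lambda>x. f (q x))"
  shows "continuous_map P Y f"
  unfolding continuous_map_closedin
proof (intro conjI ballI allI impI)
  show "f \<in> topspace P \<rightarrow> topspace Y"
  proof
    fix x assume "x \<in> topspace P"
    then obtain q y where "q \<in> \<Q>" "y \<in> topspace Q" "x = q y"
      using cover by auto
    then show "f x \<in> topspace Y"
      using funcset_mem[OF continuous_map_funspace[OF f]] by simp
  qed
next
  fix C assume C: "closedin Y C"
  have img: "q ` topspace Q \<subseteq> topspace P" if "q \<in> \<Q>" for q
    using continuous_map_image_subset_topspace[OF q[OF that]] .
  have "{x \<in> topspace P. f x \<in> C} = (\<Union>q\<in>\<Q>. q ` {y \<in> topspace Q. f (q y) \<in> C})"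
  proof (intro equalityI subsetI)
    fix x assume x: "x \<in> {x \<in> topspace P. f x \<in> C}"
    then obtain q where "q \<in> \<Q>" "x \<in> q ` topspace Q" using cover by auto
    with x show "x \<in> (\<Union>q\<in>\<Q>. q ` {y \<in> topspace Q. f (q y) \<in> C})" by auto
  next
    fix x assume "x \<in> (\<Union>q\<in>\<Q>. q ` {y \<in> topspace Q. f (q y) \<in> C})"
    then obtain q y where "q \<in> \<Q>" "y \<in> topspace Q" "f (q y) \<in> C" "x = q y" by auto
    with img[of q] show "x \<in> {x \<in> topspace P. f x \<in> C}" by auto
  qed
  moreover have "closedin P (q ` {y \<in> topspace Q. f (q y) \<in> C})" if "q \<in> \<Q>" for q
  proof -
    have "closedin Q {y \<in> topspace Q. f (q y) \<in> C}"
      by (rule closedin_continuous_map_preimage[OF f[OF that] C])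
    then have "compactin Q {y \<in> topspace Q. f (q y) \<in> C}"
      using Q by (rule closedin_compact_space[rotated])
    then show ?thesis
      by (intro compactin_imp_closedin[OF P] image_compactin[OF _ q[OF that]])
  qed
  ultimately show "closedin P {x \<in> topspace P. f x \<in> C}"
    using fin by (auto intro!: closedin_Union)
qed

text \<open>The smallest closed cell that contains \<open>p\<close>. The conditions on cells in the definition of the
discrete configuration space become conditions on the points themselves in terms of these sets.\<close>

definition cell_hull :: "('v, 'e) graph \<Rightarrow> 'v \<Rightarrow> 'v set" where
  "cell_hull G p = (if p \<in> verts G then {p} else \<Union> (closed_edge G ` {e \<in> edges G. p \<in> open_edge G e}))"

lemma closed_edge_eq: "closed_edge G e = {chmap G e 0, chmap G e 1} \<union> open_edge G e"
proof -
  have "{0..1::real} = {0, 1} \<union> {0<..<1}" by auto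
  then show ?thesis unfolding closed_edge_def open_edge_def by auto
qed

lemma cell_hull_vertex: "v \<in> verts G \<Longrightarrow> cell_hull G v = {v}"
  by (simp add: cell_hull_def)

definition configurations :: "('v, 'e) graph \<Rightarrow> nat \<Rightarrow> (nat \<Rightarrow> 'v) set" where
  "configurations G n = {x \<in> PiE {..<n} (\<lambda>_. topspace (gspace G)).
    \<forall>i<n. \<forall>j<n. i \<noteq> j \<longrightarrow> cell_hull G (x i) \<inter> cell_hull G (x j) = {}}"

locale cw_graph =
  fixes G :: "('v, 'e) graph"
  assumes G: "is_graph G"
begin

lemma graph_Hausdorff: "Hausdorff_space (gspace G)"
  and graph_connected: "connected_space (gspace G)"
  and finite_verts: "finite (verts G)"
  and finite_edges: "finite (edges G)"
  and graph_topspace: "topspace (gspace G) = verts G \<union> (\<Union>e\<in>edges G. open_edge G e)"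
  using G by (simp_all add: is_graph_def)

lemma chmap_ends: "e \<in> edges G \<Longrightarrow> chmap G e 0 \<in> verts G" "e \<in> edges G \<Longrightarrow> chmap G e 1 \<in> verts G"
  using G by (simp_all add: is_graph_def)

lemma continuous_map_chmap: "e \<in> edges G \<Longrightarrow> continuous_map (top_of_set {0..1}) (gspace G) (chmap G e)"
  using G by (simp add: is_graph_def pathin_def)

lemma chmap_in_topspace: "e \<in> edges G \<Longrightarrow> t \<in> {0..1} \<Longrightarrow> chmap G e t \<in> topspace (gspace G)"
  using funcset_mem[OF continuous_map_funspace[OF continuous_map_chmap], of e t] by simp

lemma verts_subset_topspace: "v \<in> verts G \<Longrightarrow> v \<in> topspace (gspace G)"
  by (simp add: graph_topspace)

lemma chmap_notin_verts:
  assumes "e \<in> edges G" "t \<in> {0<..<1}"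
  shows "chmap G e t \<notin> verts G"
proof -
  have "disjnt (verts G) (open_edge G e)"
    using G assms(1) by (simp add: is_graph_def)
  moreover have "chmap G e t \<in> open_edge G e"
    using assms(2) unfolding open_edge_def by (rule imageI)
  ultimately show ?thesis unfolding disjnt_def by blast
qed

lemma chmap_interior_inj:
  assumes e: "e \<in> edges G" "e' \<in> edges G" and t: "t \<in> {0<..<1}" "t' \<in> {0<..<1}"
    and eq: "chmap G e t = chmap G e' t'"
  shows "e = e'" "t = t'"
proof -
  have pw: "pairwise (\<lambda>e e'. disjnt (open_edge G e) (open_edge G e')) (edges G)"
    using G by (simp add: is_graph_def)
  have "chmap G e t \<in> open_edge G e" "chmap G e' t' \<in> open_edge G e'"
    unfolding open_edge_def using t by (simp_all only: imageI)
  then have mem: "chmap G e t \<in> open_edge G e" "chmap G e t \<in> open_edge G e'"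
    unfolding eq by simp_all
  show "e = e'"
  proof (rule ccontr)
    assume "e \<noteq> e'"
    then have "disjnt (open_edge G e) (open_edge G e')"
      using pairwiseD[OF pw e] by simp
    with mem show False unfolding disjnt_def by blast
  qed
  with eq have "chmap G e t = chmap G e t'" by simp
  moreover have "inj_on (chmap G e) {0<..<1}"
    using G e(1) by (simp add: is_graph_def)
  ultimately show "t = t'" using t by (simp add: inj_on_eq_iff)
qed

lemma graph_point_cases:
  assumes "p \<in> topspace (gspace G)"
  obtains "p \<in> verts G" | e t where "e \<in> edges G" "t \<in> {0<..<1}" "p = chmap G e t" "p \<notin> verts G"
proof (cases "p \<in> verts G")
  case False
  then obtain e where e: "e \<in> edges G" "p \<in> open_edge G e"
    using assms by (auto simp: graph_topspace)
  then obtain t where "p = chmap G e t" "t \<in> {0<..<1}"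
    unfolding open_edge_def by (elim imageE)
  then show ?thesis by (intro that(2)[OF e(1) _ _ False])
qed

lemma closedin_chmap_image:
  assumes e: "e \<in> edges G" and K: "compact K" "K \<subseteq> {0..1}"
  shows "closedin (gspace G) (chmap G e ` K)"
proof -
  have "compactin (top_of_set {0..1}) K" using K by (simp add: compactin_subtopology)
  then show ?thesis
    by (intro compactin_imp_closedin[OF graph_Hausdorff] image_compactin[OF _ continuous_map_chmap[OF e]])
qed

lemma closure_of_vertex: "v \<in> verts G \<Longrightarrow> gspace G closure_of {v} = {v}"
  using Hausdorff_imp_t1_space[OF graph_Hausdorff] verts_subset_topspace
  by (intro closure_of_closedin) (simp add: t1_space_closedin_singleton)

lemma closure_of_open_edge:
  assumes e: "e \<in> edges G"
  shows "gspace G closure_of (open_edge G e) = closed_edge G e"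
proof
  have "closedin (gspace G) (closed_edge G e)"
    unfolding closed_edge_def by (rule closedin_chmap_image[OF e]) auto
  moreover have "open_edge G e \<subseteq> closed_edge G e" unfolding closed_edge_eq by blast
  ultimately show "gspace G closure_of (open_edge G e) \<subseteq> closed_edge G e"
    by (intro closure_of_minimal)
  have "top_of_set {0..1} closure_of {0<..<1} = {0..1::real}"
    by (auto simp: closure_of_subtopology Int_absorb1 greaterThanLessThan_subseteq_atLeastAtMost_iff)
  then show "closed_edge G e \<subseteq> gspace G closure_of (open_edge G e)"
    using continuous_map_image_closure_subset[OF continuous_map_chmap[OF e], of "{0<..<1}"]
    by (simp add: closed_edge_def open_edge_def)
qed

lemma cell_hull_interior:
  assumes "e \<in> edges G" "t \<in> {0<..<1}"
  shows "cell_hull G (chmap G e t) = closed_edge G e"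
proof -
  have "{e' \<in> edges G. chmap G e t \<in> open_edge G e'} = {e}"
  proof (intro equalityI subsetI)
    fix e' assume "e' \<in> {e' \<in> edges G. chmap G e t \<in> open_edge G e'}"
    then obtain t' where "e' \<in> edges G" "t' \<in> {0<..<1}" "chmap G e t = chmap G e' t'"
      by (auto simp: open_edge_def)
    with chmap_interior_inj(1)[OF assms(1) _ assms(2)] show "e' \<in> {e}" by blast
  qed (use assms in \<open>auto simp: open_edge_def\<close>)
  then show ?thesis
    using chmap_notin_verts[OF assms] by (simp add: cell_hull_def)
qed

lemma cell_hull_chmap_subset:
  assumes "e \<in> edges G" "t \<in> {0..1}"
  shows "cell_hull G (chmap G e t) \<subseteq> closed_edge G e"
proof (cases "t \<in> {0<..<1}")
  case True
  then show ?thesis by (simp add: cell_hull_interior[OF assms(1)])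
next
  case False
  then have "t = 0 \<or> t = 1" using assms(2) by auto
  then show ?thesis
    using chmap_ends[OF assms(1)] by (auto simp: cell_hull_vertex closed_edge_eq)
qed

lemma mem_cell_hull: "p \<in> topspace (gspace G) \<Longrightarrow> p \<in> cell_hull G p"
  by (cases rule: graph_point_cases)
    (auto simp: cell_hull_vertex cell_hull_interior closed_edge_def)

lemma cell_hull_eq_closure:
  assumes p: "p \<in> c" and c: "c \<in> cells G"
  shows "gspace G closure_of c = cell_hull G p"
proof -
  from c consider v where "v \<in> verts G" "c = {v}" | e where "e \<in> edges G" "c = open_edge G e"
    unfolding cells_def by blast
  then show ?thesis
  proof cases
    case 1
    then show ?thesis using p by (simp add: cell_hull_vertex closure_of_vertex)
  next
    case 2
    then obtain t where "t \<in> {0<..<1}" "p = chmap G e t"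
      using p unfolding open_edge_def by blast
    then show ?thesis using 2 by (simp add: cell_hull_interior closure_of_open_edge)
  qed
qed

lemma mem_some_cell:
  assumes "p \<in> topspace (gspace G)"
  obtains c where "c \<in> cells G" "p \<in> c"
  using assms by (auto simp: graph_topspace cells_def)

lemma cell_subset_topspace: "c \<in> cells G \<Longrightarrow> c \<subseteq> topspace (gspace G)"
  by (auto simp: graph_topspace cells_def)

lemma ordered_discrete_conf_eq:
  "ordered_discrete_conf n G = subtopology (product_topology (\<lambda>_. gspace G) {..<n}) (configurations G n)"
proof -
  let ?C = "{c. (\<forall>i<n. c i \<in> cells G) \<and> (\<forall>i<n. \<forall>j<n. i \<noteq> j \<longrightarrow>
                  (gspace G closure_of c i) \<inter> (gspace G closure_of c j) = {})}"
  have "(\<Union>c\<in>?C. PiE {..<n} c) = configurations G n"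
  proof (intro equalityI subsetI)
    fix x assume "x \<in> (\<Union>c\<in>?C. PiE {..<n} c)"
    then obtain c where "c \<in> ?C" and xP: "x \<in> PiE {..<n} c"
      by (elim UN_E)
    then have c: "\<And>i. i < n \<Longrightarrow> c i \<in> cells G"
      and dis: "\<And>i j. i < n \<Longrightarrow> j < n \<Longrightarrow> i \<noteq> j \<Longrightarrow>
                  (gspace G closure_of c i) \<inter> (gspace G closure_of c j) = {}"
      by simp_all
    have xc: "x i \<in> c i" if "i < n" for i using PiE_mem[OF xP] that by simp
    have "gspace G closure_of c i = cell_hull G (x i)" if "i < n" for i
      by (rule cell_hull_eq_closure[OF xc[OF that] c[OF that]])
    moreover have "x \<in> PiE {..<n} (\<lambda>_. topspace (gspace G))"
    proof (rule PiE_I)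
      show "x i \<in> topspace (gspace G)" if "i \<in> {..<n}" for i
        using cell_subset_topspace[OF c] xc that by blast
      show "x i = undefined" if "i \<notin> {..<n}" for i
        using PiE_arb[OF xP that] .
    qed
    ultimately show "x \<in> configurations G n"
      using dis by (simp add: configurations_def)
  next
    fix x assume x: "x \<in> configurations G n"
    define c where "c i = (SOME c. c \<in> cells G \<and> x i \<in> c)" for i
    have c: "c i \<in> cells G \<and> x i \<in> c i" if "i < n" for i
      unfolding c_def
    proof (rule someI_ex)
      have "x i \<in> topspace (gspace G)" using x that by (auto simp: configurations_def)
      then show "\<exists>c. c \<in> cells G \<and> x i \<in> c" by (rule mem_some_cell) blast
    qed
    have "gspace G closure_of c i = cell_hull G (x i)" if "i < n" for i
      by (rule cell_hull_eq_closure) (use c[OF that] in auto)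
    with x c have "c \<in> ?C"
      by (simp add: configurations_def)
    moreover have "x \<in> PiE {..<n} c"
      using x c by (simp add: configurations_def PiE_def Pi_def)
    ultimately show "x \<in> (\<Union>c\<in>?C. PiE {..<n} c)"
      by (rule UN_I[where B = "PiE {..<n}"])
  qed
  then show ?thesis by (simp add: ordered_discrete_conf_def)
qed

text \<open>The principle behind all motions of configurations below: points may move freely within their
own closed cells.\<close>

lemma configurations_mono:
  assumes x: "x \<in> configurations G n" and y: "y \<in> PiE {..<n} (\<lambda>_. topspace (gspace G))"
    and hull: "\<And>i. i < n \<Longrightarrow> cell_hull G (y i) \<subseteq> cell_hull G (x i)"
  shows "y \<in> configurations G n"
proof -
  have "cell_hull G (y i) \<inter> cell_hull G (y j) = {}" if "i < n" "j < n" "i \<noteq> j" for i j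
  proof -
    have "cell_hull G (x i) \<inter> cell_hull G (x j) = {}" using x that by (simp add: configurations_def)
    with hull[OF that(1)] hull[OF that(2)] show ?thesis by blast
  qed
  with y show ?thesis by (simp add: configurations_def)
qed

lemma topspace_ordered_discrete_conf: "topspace (ordered_discrete_conf n G) = configurations G n"
  by (auto simp: ordered_discrete_conf_eq configurations_def)

lemma continuous_map_into_configurations:
  assumes "\<And>i. i < n \<Longrightarrow> continuous_map Z (gspace G) (\<lambda>z. f z i)"
    and "\<And>z. z \<in> topspace Z \<Longrightarrow> f z \<in> configurations G n"
  shows "continuous_map Z (ordered_discrete_conf n G) f"
  unfolding ordered_discrete_conf_eq
proof (rule continuous_map_into_subtopology)
  show "continuous_map Z (product_topology (\<lambda>_. gspace G) {..<n}) f"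
    using assms by (auto simp: continuous_map_componentwise configurations_def PiE_def)
qed (use assms(2) in blast)

lemma continuous_map_configuration_component:
  "i < n \<Longrightarrow> continuous_map (ordered_discrete_conf n G) (gspace G) (\<lambda>x. x i)"
  unfolding ordered_discrete_conf_eq
  using continuous_map_product_projection[of i "{..<n}" "\<lambda>_. gspace G"]
  by (simp add: continuous_map_from_subtopology)

end

section \<open>Homotopies and circle-valued maps defined edge by edge\<close>

text \<open>The straight-line homotopy, in the parameter of each edge, from the identity to \<open>r\<close>. It is well
defined and continuous on the graph if \<open>r\<close> fixes \<open>0\<close> and \<open>1\<close>.\<close>

definition edge_homotopy :: "('v, 'e) graph \<Rightarrow> (real \<Rightarrow> real) \<Rightarrow> 'v \<times> real \<Rightarrow> 'v" where
  "edge_homotopy G r = (\<lambda>(p, s). if p \<in> verts G then p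
     else case (SOME (e, t). e \<in> edges G \<and> t \<in> {0<..<1} \<and> p = chmap G e t) of
       (e, t) \<Rightarrow> chmap G e ((1 - s) * t + s * r t))"

text \<open>The map that collapses the complement of an open edge to a point and identifies the quotient with
the unit circle.\<close>

definition edge_collapse :: "('v, 'e) graph \<Rightarrow> 'e \<Rightarrow> 'v \<Rightarrow> complex" where
  "edge_collapse G e p = (if p \<in> open_edge G e
     then cis (2 * pi * (THE t. t \<in> {0<..<1} \<and> chmap G e t = p)) else 1)"

definition edge_band :: "('v, 'e) graph \<Rightarrow> real \<Rightarrow> real \<Rightarrow> 'v set" where
  "edge_band G a b = (\<Union>e\<in>edges G. chmap G e ` ({a..b} \<union> {1-b..1-a}))"

text \<open>The piecewise linear function that takes the values \<open>0\<close> on \<open>[0, a]\<close>, \<open>1/2\<close> on \<open>[b, 1 - b]\<close> and \<open>1\<close> on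
\<open>[1 - a, 1]\<close>.\<close>

definition snap :: "real \<Rightarrow> real \<Rightarrow> real \<Rightarrow> real" where
  "snap a b t = (max 0 (min 1 ((t - a) / (b - a))) + max 0 (min 1 ((t - (1 - b)) / (b - a)))) / 2"

lemma continuous_snap: "a < b \<Longrightarrow> continuous_on UNIV (snap a b)"
  unfolding snap_def by (intro continuous_intros) auto

lemma snap_range: "snap a b t \<in> {0..1}"
  by (auto simp: snap_def)

lemma snap_values:
  assumes "0 < a" "a < b" "b < 1/2"
  shows "t \<le> a \<Longrightarrow> snap a b t = 0" "b \<le> t \<Longrightarrow> t \<le> 1 - b \<Longrightarrow> snap a b t = 1/2"
    "1 - a \<le> t \<Longrightarrow> snap a b t = 1"
proof -
  assume t: "t \<le> a"
  have "(t - a) / (b - a) \<le> 0" "(t - (1 - b)) / (b - a) \<le> 0"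
    using assms t by (auto intro!: divide_nonpos_nonneg)
  then show "snap a b t = 0" by (simp add: snap_def)
next
  assume t: "b \<le> t" "t \<le> 1 - b"
  have "(t - a) / (b - a) \<ge> 1" "(t - (1 - b)) / (b - a) \<le> 0"
    using assms t by (auto intro!: divide_nonpos_nonneg)
  then show "snap a b t = 1/2" by (simp add: snap_def)
next
  assume t: "1 - a \<le> t"
  have "(t - a) / (b - a) \<ge> 1" "(t - (1 - b)) / (b - a) \<ge> 1"
    using assms t by auto
  then show "snap a b t = 1" by (simp add: snap_def)
qed

context cw_graph
begin

lemma edge_homotopy_interior:
  assumes e: "e \<in> edges G" and t: "t \<in> {0<..<1}"
  shows "edge_homotopy G r (chmap G e t, s) = chmap G e ((1 - s) * t + s * r t)"
proof -
  let ?P = "\<lambda>z. case z of (e', t') \<Rightarrow> e' \<in> edges G \<and> t' \<in> {0<..<1} \<and> chmap G e t = chmap G e' t'"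
  have "(SOME z. ?P z) = (e, t)"
  proof (rule some_equality)
    show "?P (e, t)" using e t by simp
  next
    fix z assume "?P z"
    then show "z = (e, t)"
      using chmap_interior_inj[OF e _ t] by (cases z) fastforce
  qed
  then show ?thesis
    using chmap_notin_verts[OF e t] unfolding edge_homotopy_def by simp
qed

lemma edge_homotopy_vertex: "v \<in> verts G \<Longrightarrow> edge_homotopy G r (v, s) = v"
  by (simp add: edge_homotopy_def)

lemma edge_homotopy_chmap:
  assumes r: "r 0 = 0" "r 1 = 1" and e: "e \<in> edges G" and t: "t \<in> {0..1}"
  shows "edge_homotopy G r (chmap G e t, s) = chmap G e ((1 - s) * t + s * r t)"
proof -
  consider "t = 0" | "t = 1" | "t \<in> {0<..<1}" using t by fastforce
  then show ?thesis
  proof cases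
    case 1
    then show ?thesis using chmap_ends[OF e] by (simp add: r edge_homotopy_vertex)
  next
    case 2
    then show ?thesis using chmap_ends[OF e] by (simp add: r edge_homotopy_vertex)
  next
    case 3
    then show ?thesis by (rule edge_homotopy_interior[OF e])
  qed
qed

lemma convex_unit_real:
  assumes "s \<in> {0..1}" "t \<in> {0..1}" "u \<in> {0..1::real}"
  shows "(1 - s) * t + s * u \<in> {0..1}"
  using convexD_alt[of "{0..1}" t u s] assms by simp

lemma continuous_map_edge_homotopy:
  assumes r: "r 0 = 0" "r 1 = 1" "continuous_on UNIV r" "\<And>t. r t \<in> {0..1}"
  shows "continuous_map (prod_topology (gspace G) (top_of_set {0..1})) (gspace G) (edge_homotopy G r)"
proof (rule continuous_map_from_compact_cover)
  let ?I = "top_of_set {0..1::real}"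
  let ?\<Q> = "(\<lambda>e (t, s). (chmap G e t, s)) ` edges G \<union> (\<lambda>v (t::real, s). (v, s)) ` verts G"
  show "Hausdorff_space (prod_topology (gspace G) ?I)"
    using graph_Hausdorff by (simp add: Hausdorff_space_prod_topology Hausdorff_space_subtopology)
  show "compact_space (prod_topology ?I ?I)"
    by (simp add: compact_space_subtopology compact_Times)
  show "finite ?\<Q>" using finite_edges finite_verts by simp
  have edge: "continuous_map (prod_topology ?I ?I) (gspace G) (\<lambda>z. chmap G e (fst z))"
    if "e \<in> edges G" for e
    using continuous_map_compose[OF continuous_map_fst continuous_map_chmap[OF that]] unfolding o_def .
  show "continuous_map (prod_topology ?I ?I) (prod_topology (gspace G) ?I) q" if "q \<in> ?\<Q>" for q
    using that edge verts_subset_topspace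
    by (auto simp: case_prod_unfold intro!: continuous_map_pairedI continuous_intros)
  show "topspace (prod_topology (gspace G) ?I) \<subseteq> (\<Union>q\<in>?\<Q>. q ` topspace (prod_topology ?I ?I))"
  proof
    fix z assume "z \<in> topspace (prod_topology (gspace G) ?I)"
    then obtain p s where z: "z = (p, s)" "p \<in> topspace (gspace G)" "s \<in> {0..1}" by auto
    from z(2) show "z \<in> (\<Union>q\<in>?\<Q>. q ` topspace (prod_topology ?I ?I))"
    proof (cases rule: graph_point_cases)
      case 1
      then show ?thesis
        using z by (intro UN_I[of "\<lambda>(t, s). (p, s)"] image_eqI[of _ _ "(0, s)"]) auto
    next
      case (2 e t)
      then show ?thesis
        using z by (intro UN_I[of "\<lambda>(t, s). (chmap G e t, s)"] image_eqI[of _ _ "(t, s)"]) auto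
    qed
  qed
  show "continuous_map (prod_topology ?I ?I) (gspace G) (\<lambda>x. edge_homotopy G r (q x))" if q: "q \<in> ?\<Q>" for q
  proof -
    from q consider e where "e \<in> edges G" "q = (\<lambda>(t, s). (chmap G e t, s))"
      | v where "v \<in> verts G" "q = (\<lambda>(t, s). (v, s))" by auto
    then show ?thesis
    proof cases
      case 1
      have fs: "continuous_map (prod_topology ?I ?I) euclideanreal fst"
        "continuous_map (prod_topology ?I ?I) euclideanreal snd"
        by (rule continuous_map_into_fulltopology[OF continuous_map_fst],
            rule continuous_map_into_fulltopology[OF continuous_map_snd])
      have "continuous_map euclideanreal euclideanreal r" using r(3) by simp
      from continuous_map_compose[OF fs(1) this]
      have "continuous_map (prod_topology ?I ?I) euclideanreal (\<lambda>z. r (fst z))" by (simp add: o_def)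
      then have "continuous_map (prod_topology ?I ?I) euclideanreal
          (\<lambda>z. (1 - snd z) * fst z + snd z * r (fst z))"
        by (intro continuous_map_add continuous_map_real_mult continuous_map_diff fs) simp_all
      then have "continuous_map (prod_topology ?I ?I) ?I
          (\<lambda>z. (1 - snd z) * fst z + snd z * r (fst z))"
        by (rule continuous_map_into_subtopology)
          (auto simp only: topspace_prod_topology topspace_euclidean_subtopology fst_conv snd_conv
            intro!: convex_unit_real r(4))
      from continuous_map_compose[OF this continuous_map_chmap[OF 1(1)]]
      have "continuous_map (prod_topology ?I ?I) (gspace G)
          (\<lambda>z. chmap G e ((1 - snd z) * fst z + snd z * r (fst z)))" by (simp add: o_def)
      then show ?thesis
        by (rule continuous_map_eq) (auto simp: 1 edge_homotopy_chmap[OF r(1,2)])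
    next
      case 2
      then show ?thesis
        using verts_subset_topspace by (simp add: edge_homotopy_vertex case_prod_unfold)
    qed
  qed
qed

lemma edge_homotopy_0:
  assumes "p \<in> topspace (gspace G)"
  shows "edge_homotopy G r (p, 0) = p"
  using assms by (cases rule: graph_point_cases)
    (auto simp: edge_homotopy_vertex edge_homotopy_interior)

lemma cell_hull_edge_homotopy:
  assumes p: "p \<in> topspace (gspace G)" and s: "s \<in> {0..1}" and r: "\<And>t. r t \<in> {0..1}"
  shows "cell_hull G (edge_homotopy G r (p, s)) \<subseteq> cell_hull G p"
  using p
proof (cases rule: graph_point_cases)
  case 1
  then show ?thesis by (simp add: edge_homotopy_vertex)
next
  case (2 e t)
  then have "(1 - s) * t + s * r t \<in> {0..1}"
    using s r by (intro convex_unit_real) auto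
  then show ?thesis
    using 2 cell_hull_chmap_subset[OF 2(1)]
    by (simp add: edge_homotopy_interior cell_hull_interior)
qed

text \<open>The places to which points off an edge band are pushed.\<close>

definition landmarks :: "'v set" where
  "landmarks = verts G \<union> (\<lambda>e. chmap G e (1/2)) ` edges G"

lemma finite_landmarks: "finite landmarks"
  using finite_edges finite_verts by (simp add: landmarks_def)

lemma edge_homotopy_snap_1:
  assumes ab: "0 < a" "a < b" "b < 1/2"
    and p: "p \<in> topspace (gspace G)" "p \<notin> edge_band G a b"
  shows "edge_homotopy G (snap a b) (p, 1) \<in> landmarks"
  using p(1)
proof (cases rule: graph_point_cases)
  case 1
  then show ?thesis by (simp add: edge_homotopy_vertex landmarks_def)
next
  case (2 e t)
  then have "t \<notin> {a..b} \<union> {1-b..1-a}"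
    using p(2) unfolding edge_band_def by blast
  then have "t \<le> a \<or> (b \<le> t \<and> t \<le> 1 - b) \<or> 1 - a \<le> t" by auto
  then consider "snap a b t = 0" | "snap a b t = 1/2" | "snap a b t = 1"
    using snap_values[OF ab, of t] by blast
  then have "chmap G e (snap a b t) \<in> landmarks"
    by cases (use chmap_ends[OF 2(1)] 2(1) in \<open>auto simp only: landmarks_def\<close>)
  then show ?thesis
    using 2 by (simp add: edge_homotopy_interior)
qed

lemma closedin_edge_band:
  assumes "0 < a" "a < b" "b < 1/2"
  shows "closedin (gspace G) (edge_band G a b)"
  unfolding edge_band_def
  by (intro closedin_Union) (use assms finite_edges in \<open>auto intro!: closedin_chmap_image\<close>)

lemma edge_bands_disjoint:
  assumes ab: "0 < a" "a < b" "b < 1/2" and cd: "0 < c" "c < d" "d < 1/2"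
    and lt: "b < c"
  shows "edge_band G a b \<inter> edge_band G c d = {}"
proof -
  have False if p1: "p \<in> edge_band G a b" and p2: "p \<in> edge_band G c d" for p
  proof -
    obtain e t where et: "e \<in> edges G" "p = chmap G e t" "t \<in> {a..b} \<union> {1-b..1-a}"
      using p1 unfolding edge_band_def by (elim UN_E imageE) (rule that)
    obtain e' t' where et': "e' \<in> edges G" "p = chmap G e' t'" "t' \<in> {c..d} \<union> {1-d..1-c}"
      using p2 unfolding edge_band_def by (elim UN_E imageE) (rule that)
    have "t \<in> {0<..<1}" "t' \<in> {0<..<1}"
      using et(3) et'(3) ab cd by auto
    from chmap_interior_inj(2)[OF et(1) et'(1) this] et(2) et'(2) have "t = t'" by simp
    then show False using et(3) et'(3) ab cd lt by auto
  qed
  then show ?thesis by blast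
qed

lemma edge_collapse_chmap:
  assumes e: "e \<in> edges G" and t: "t \<in> {0..1}"
  shows "edge_collapse G e (chmap G e t) = cis (2 * pi * t)"
proof (cases "t \<in> {0<..<1}")
  case True
  have "(THE u. u \<in> {0<..<1} \<and> chmap G e u = chmap G e t) = t"
    using True chmap_interior_inj(2)[OF e e] by (intro the_equality) auto
  moreover have "chmap G e t \<in> open_edge G e"
    using True unfolding open_edge_def by (rule imageI)
  ultimately show ?thesis by (simp add: edge_collapse_def)
next
  case False
  then have t01: "t = 0 \<or> t = 1" using t by auto
  then have "chmap G e t \<in> verts G" using chmap_ends[OF e] by auto
  then have "chmap G e t \<notin> open_edge G e"
    using chmap_notin_verts[OF e] unfolding open_edge_def by auto
  then show ?thesis using t01 by (auto simp: edge_collapse_def complex_eq_iff)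
qed

lemma edge_collapse_outside: "p \<notin> open_edge G e \<Longrightarrow> edge_collapse G e p = 1"
  by (simp add: edge_collapse_def)

lemma vertex_notin_open_edge: "v \<in> verts G \<Longrightarrow> e \<in> edges G \<Longrightarrow> v \<notin> open_edge G e"
  using chmap_notin_verts by (auto simp: open_edge_def)

lemma closed_edge_Int_open_edge:
  assumes "e \<in> edges G" "e' \<in> edges G" "e \<noteq> e'"
  shows "closed_edge G e \<inter> open_edge G e' = {}"
proof -
  have "open_edge G e \<inter> open_edge G e' = {}"
    using chmap_interior_inj(1)[OF assms(1,2)] assms(3) by (force simp: open_edge_def)
  then show ?thesis
    using chmap_ends[OF assms(1)] vertex_notin_open_edge[OF _ assms(2)] by (auto simp: closed_edge_eq)
qed

lemma norm_edge_collapse: "norm (edge_collapse G e p) = 1"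
  by (simp add: edge_collapse_def)

lemma continuous_map_edge_collapse:
  assumes e: "e \<in> edges G"
  shows "continuous_map (gspace G) euclidean (edge_collapse G e)"
proof (rule continuous_map_from_compact_cover)
  let ?I = "top_of_set {0..1::real}"
  let ?\<Q> = "chmap G ` edges G \<union> (\<lambda>v (t::real). v) ` verts G"
  show "Hausdorff_space (gspace G)" by (rule graph_Hausdorff)
  show "compact_space ?I" by (simp add: compact_space_subtopology)
  show "finite ?\<Q>" using finite_edges finite_verts by simp
  show "continuous_map ?I (gspace G) q" if "q \<in> ?\<Q>" for q
    using that continuous_map_chmap verts_subset_topspace by auto
  show "topspace (gspace G) \<subseteq> (\<Union>q\<in>?\<Q>. q ` topspace ?I)"
  proof
    fix p assume "p \<in> topspace (gspace G)"
    then show "p \<in> (\<Union>q\<in>?\<Q>. q ` topspace ?I)"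
    proof (cases rule: graph_point_cases)
      case 1
      then show ?thesis by (intro UN_I[of "\<lambda>t. p"] image_eqI[of _ _ 0]) simp_all
    next
      case (2 e t)
      then show ?thesis by (intro UN_I[of "chmap G e"] image_eqI[of _ _ t]) auto
    qed
  qed
  show "continuous_map ?I euclidean (\<lambda>t. edge_collapse G e (q t))" if q: "q \<in> ?\<Q>" for q
  proof -
    from q consider "q = chmap G e" | e' where "e' \<in> edges G" "e' \<noteq> e" "q = chmap G e'"
      | v where "v \<in> verts G" "q = (\<lambda>t. v)" by auto
    then show ?thesis
    proof cases
      case 1
      have "continuous_map ?I euclidean (\<lambda>t. cis (2 * pi * t))"
        by (auto intro!: continuous_intros)
      then show ?thesis
        by (rule continuous_map_eq) (auto simp: 1 edge_collapse_chmap[OF e])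
    next
      case 2
      have "chmap G e' t \<notin> open_edge G e" if "t \<in> {0..1}" for t
        using closed_edge_Int_open_edge[OF 2(1) e 2(2)] that unfolding closed_edge_def by blast
      then have eq: "1 = edge_collapse G e (q t)" if "t \<in> topspace ?I" for t
        using that 2 by (simp add: edge_collapse_outside)
      have "continuous_map ?I euclidean (\<lambda>t::real. 1::complex)" by simp
      then show ?thesis by (rule continuous_map_eq) (rule eq)
    qed simp
  qed
qed

text \<open>Otherwise the vertices that can be reached from \<open>v\<close> and those that cannot, each together with the
edges at them, would separate the space into two disjoint nonempty closed sets.\<close>

lemma vertices_connected_by_edges:
  assumes v: "v \<in> verts G" and w: "w \<in> verts G"
  shows "(v, w) \<in> {(a, b). \<exists>e\<in>edges G. joins G e a b}\<^sup>*"
proof (rule ccontr)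
  let ?R = "{(a, b). \<exists>e\<in>edges G. joins G e a b}"
  assume nw: "(v, w) \<notin> ?R\<^sup>*"
  define A where "A = {u \<in> verts G. (v, u) \<in> ?R\<^sup>*}"
  define piece where "piece B = B \<union> \<Union> (closed_edge G ` {e \<in> edges G. chmap G e 0 \<in> B})" for B
  have fin: "finite A" unfolding A_def using finite_verts by simp
  have closed: "closedin (gspace G) (piece B)" if B: "B \<subseteq> verts G" for B
  proof -
    have "closedin (gspace G) B"
      using Hausdorff_imp_t1_space[OF graph_Hausdorff] B finite_subset[OF B finite_verts]
        verts_subset_topspace by (auto simp: t1_space_closedin_finite)
    moreover have "closedin (gspace G) (\<Union> (closed_edge G ` {e \<in> edges G. chmap G e 0 \<in> B}))"
      by (intro closedin_Union)
        (use finite_edges in \<open>auto simp: closed_edge_def intro!: closedin_chmap_image\<close>)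
    ultimately show ?thesis unfolding piece_def by (rule closedin_Un)
  qed
  have same: "chmap G e 0 \<in> A \<longleftrightarrow> chmap G e 1 \<in> A" if e: "e \<in> edges G" for e
  proof -
    have "joins G e (chmap G e 0) (chmap G e 1)" "joins G e (chmap G e 1) (chmap G e 0)"
      by (auto simp: joins_def)
    then have "(chmap G e 0, chmap G e 1) \<in> ?R" "(chmap G e 1, chmap G e 0) \<in> ?R"
      using e by auto
    then show ?thesis
      using chmap_ends[OF e] unfolding A_def by (auto intro: rtrancl_into_rtrancl)
  qed
  have in_piece: "p \<in> piece B \<longleftrightarrow> (p \<in> B \<or> (\<exists>e\<in>edges G. chmap G e 0 \<in> B \<and> p \<in> open_edge G e))"
    if "B = A \<or> B = verts G - A" for p B
  proof -
    have "chmap G e 0 \<in> B \<and> chmap G e 1 \<in> B" if "e \<in> edges G" "chmap G e 0 \<in> B" for e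
      using that \<open>B = A \<or> B = verts G - A\<close> same[OF that(1)] chmap_ends[OF that(1)] by auto
    then show ?thesis
      unfolding piece_def closed_edge_eq by blast
  qed
  have "topspace (gspace G) \<subseteq> piece A \<union> piece (verts G - A)"
  proof
    fix p assume "p \<in> topspace (gspace G)"
    then show "p \<in> piece A \<union> piece (verts G - A)"
      using chmap_ends by (auto simp: graph_topspace in_piece)
  qed
  moreover have "piece A \<inter> piece (verts G - A) = {}"
  proof -
    have False if p1: "p \<in> piece A" and p2: "p \<in> piece (verts G - A)" for p
    proof (cases "p \<in> verts G")
      case True
      then have "\<not> (\<exists>e\<in>edges G. p \<in> open_edge G e)" using vertex_notin_open_edge by blast
      then show False using p1 p2 by (auto simp: in_piece)
    next
      case False
      then obtain e e' where "e \<in> edges G" "chmap G e 0 \<in> A" "p \<in> open_edge G e"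
        "e' \<in> edges G" "chmap G e' 0 \<notin> A" "p \<in> open_edge G e'"
        using p1 p2 False by (auto simp: in_piece A_def)
      then show False
        using closed_edge_Int_open_edge[of e e'] by (auto simp: closed_edge_eq)
    qed
    then show ?thesis by blast
  qed
  moreover have "v \<in> piece A" "w \<in> piece (verts G - A)"
    using v w nw by (auto simp: piece_def A_def)
  moreover have "closedin (gspace G) (piece A)" "closedin (gspace G) (piece (verts G - A))"
    by (auto intro!: closed simp: A_def)
  ultimately show False
    using graph_connected unfolding connected_space_closedin by blast
qed

end

section \<open>Unordered configurations\<close>

lemma mem_perm_orbit_self: "x \<in> perm_orbit n x"
proof -
  have "x = x \<circ> id \<and> id permutes {..<n}"
    by (simp add: permutes_id)
  then show ?thesis unfolding perm_orbit_def by blast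
qed

lemma perm_orbit_compose:
  assumes \<pi>: "\<pi> permutes {..<n}"
  shows "perm_orbit n (x \<circ> \<pi>) = perm_orbit n x"
proof (intro equalityI subsetI)
  fix y assume "y \<in> perm_orbit n (x \<circ> \<pi>)"
  then obtain \<sigma> where "\<sigma> permutes {..<n}" "y = x \<circ> \<pi> \<circ> \<sigma>"
    by (auto simp: perm_orbit_def)
  then have "\<pi> \<circ> \<sigma> permutes {..<n}" "y = x \<circ> (\<pi> \<circ> \<sigma>)"
    using permutes_compose \<pi> by (auto simp: o_assoc)
  then show "y \<in> perm_orbit n x" unfolding perm_orbit_def by blast
next
  fix y assume "y \<in> perm_orbit n x"
  then obtain \<sigma> where \<sigma>: "\<sigma> permutes {..<n}" "y = x \<circ> \<sigma>"
    by (auto simp: perm_orbit_def)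
  have "inv \<pi> \<circ> \<sigma> permutes {..<n}"
    using permutes_compose[OF \<sigma>(1) permutes_inv[OF \<pi>]] .
  moreover have "y = x \<circ> \<pi> \<circ> (inv \<pi> \<circ> \<sigma>)"
    using \<sigma>(2) permutes_inv_o(1)[OF \<pi>] by (metis comp_assoc comp_id)
  ultimately show "y \<in> perm_orbit n (x \<circ> \<pi>)" unfolding perm_orbit_def by blast
qed

lemma perm_orbit_eqE:
  assumes "perm_orbit n x = perm_orbit n y"
  obtains \<pi> where "\<pi> permutes {..<n}" "x = y \<circ> \<pi>"
proof -
  have "x \<in> perm_orbit n y" using mem_perm_orbit_self[of x n] assms by simp
  then show ?thesis using that by (auto simp: perm_orbit_def)
qed

lemma finite_perm_orbit: "finite (perm_orbit n x)"
proof -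
  have "perm_orbit n x = (\<lambda>\<pi>. x \<circ> \<pi>) ` {\<pi>. \<pi> permutes {..<n}}"
    by (auto simp: perm_orbit_def)
  then show ?thesis by (simp add: finite_permutations)
qed

lemma restrict_compose_permutes:
  assumes "\<pi> permutes {..<n}"
  shows "restrict (\<lambda>i. F ((x \<circ> \<pi>) i)) {..<n} = restrict (\<lambda>i. F (x i)) {..<n} \<circ> \<pi>"
proof
  fix i
  show "restrict (\<lambda>i. F ((x \<circ> \<pi>) i)) {..<n} i = (restrict (\<lambda>i. F (x i)) {..<n} \<circ> \<pi>) i"
    using permutes_in_image[OF assms, of i] by (simp add: restrict_def)
qed

lemma quotient_map_perm_orbit:
  "quotient_map (ordered_discrete_conf n G) (unordered_discrete_conf n G) (perm_orbit n)"
  unfolding unordered_discrete_conf_def by (rule quotient_map_quotient_topology)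

context cw_graph
begin

lemma topspace_unordered_discrete_conf:
  "topspace (unordered_discrete_conf n G) = perm_orbit n ` configurations G n"
  by (simp add: unordered_discrete_conf_def topspace_ordered_discrete_conf)

lemma t1_space_unordered_discrete_conf: "t1_space (unordered_discrete_conf n G)"
  unfolding t1_space_closedin_singleton
proof
  fix A assume A: "A \<in> topspace (unordered_discrete_conf n G)"
  then obtain x where x: "A = perm_orbit n x" "x \<in> configurations G n"
    by (auto simp: topspace_unordered_discrete_conf)
  let ?D = "ordered_discrete_conf n G"
  have "Hausdorff_space ?D"
    using graph_Hausdorff
    by (simp add: ordered_discrete_conf_eq Hausdorff_space_subtopology Hausdorff_space_product_topology)
  then have "t1_space ?D" by (rule Hausdorff_imp_t1_space)
  moreover have "{y \<in> topspace ?D. perm_orbit n y \<in> {A}} \<subseteq> perm_orbit n x"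
  proof
    fix y assume "y \<in> {y \<in> topspace ?D. perm_orbit n y \<in> {A}}"
    then have "perm_orbit n y = perm_orbit n x" using x by simp
    then show "y \<in> perm_orbit n x" using mem_perm_orbit_self[of y n] by simp
  qed
  then have "finite {y \<in> topspace ?D. perm_orbit n y \<in> {A}}"
    by (rule finite_subset) (rule finite_perm_orbit)
  ultimately have closed_pre: "closedin ?D {y \<in> topspace ?D. perm_orbit n y \<in> {A}}"
    by (simp add: t1_space_closedin_finite)
  have "\<forall>B\<subseteq>topspace (unordered_discrete_conf n G).
      closedin ?D {y \<in> topspace ?D. perm_orbit n y \<in> B} \<longleftrightarrow> closedin (unordered_discrete_conf n G) B"
    using quotient_map_perm_orbit[of n G] unfolding quotient_map_closedin by (rule conjunct2)
  then show "closedin (unordered_discrete_conf n G) {A}"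
    using A closed_pre by (elim allE[of _ "{A}"]) simp
qed

lemma path_component_of_orbits:
  "path_component_of (ordered_discrete_conf n G) x y \<Longrightarrow>
    path_component_of (unordered_discrete_conf n G) (perm_orbit n x) (perm_orbit n y)"
  by (rule path_component_of_continuous_image[OF quotient_imp_continuous_map[OF quotient_map_perm_orbit]])

text \<open>A homotopy of the graph that preserves closed cells is applied to all points simultaneously, which
commutes with permutations. Since the unit interval is locally compact, the product of the orbit map
with the interval is again a quotient map, so that the induced homotopy is continuous.\<close>

lemma homotopy_descends_to_orbits:
  assumes F: "continuous_map (prod_topology (gspace G) (top_of_set {0..1})) (gspace G) F"
    and hull: "\<And>p s. p \<in> topspace (gspace G) \<Longrightarrow> s \<in> {0..1} \<Longrightarrow> cell_hull G (F (p, s)) \<subseteq> cell_hull G p"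
  obtains H where
    "continuous_map (prod_topology (unordered_discrete_conf n G) (top_of_set {0..1::real})) (unordered_discrete_conf n G) H"
    "\<And>x s. x \<in> configurations G n \<Longrightarrow> s \<in> {0..1} \<Longrightarrow>
      H (perm_orbit n x, s) = perm_orbit n (restrict (\<lambda>i. F (x i, s)) {..<n})"
proof -
  let ?D = "ordered_discrete_conf n G" and ?U = "unordered_discrete_conf n G"
  let ?I = "top_of_set {0..1::real}"
  let ?F = "\<lambda>(x, s). restrict (\<lambda>i. F (x i, s)) {..<n}"
  have Ftop: "F (p, s) \<in> topspace (gspace G)" if "p \<in> topspace (gspace G)" "s \<in> {0..1}" for p s
    using funcset_mem[OF continuous_map_funspace[OF F], of "(p, s)"] that by simp
  have xi: "x i \<in> topspace (gspace G)" if "x \<in> configurations G n" "i < n" for x i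
    using that by (auto simp: configurations_def)
  have mem: "restrict (\<lambda>i. F (x i, s)) {..<n} \<in> configurations G n"
    if "x \<in> configurations G n" "s \<in> {0..1}" for x s
    by (rule configurations_mono[OF that(1)]) (use that xi Ftop hull in auto)
  have "continuous_map (prod_topology ?D ?I) ?D ?F"
  proof (rule continuous_map_into_configurations)
    fix i assume i: "i < n"
    have "continuous_map (prod_topology ?D ?I) (gspace G) (\<lambda>z. fst z i)"
      using continuous_map_compose[OF continuous_map_fst continuous_map_configuration_component[OF i]]
      unfolding o_def .
    then have "continuous_map (prod_topology ?D ?I) (prod_topology (gspace G) ?I) (\<lambda>z. (fst z i, snd z))"
      by (intro continuous_map_pairedI continuous_map_snd)
    from continuous_map_compose[OF this F]
    show "continuous_map (prod_topology ?D ?I) (gspace G) (\<lambda>z. ?F z i)"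
      using i by (simp add: o_def case_prod_unfold)
  qed (use mem in \<open>auto simp: topspace_ordered_discrete_conf\<close>)
  from continuous_map_compose[OF this quotient_imp_continuous_map[OF quotient_map_perm_orbit]]
  have cont: "continuous_map (prod_topology ?D ?I) ?U (\<lambda>z. perm_orbit n (?F z))"
    unfolding o_def .
  have quot: "quotient_map (prod_topology ?D ?I) (prod_topology ?U ?I) (\<lambda>(x, s). (perm_orbit n x, s))"
    by (rule quotient_map_prod_left[OF _ _ quotient_map_perm_orbit])
      (simp_all add: compact_imp_locally_compact_space compact_space_subtopology Hausdorff_space_subtopology)
  have inv: "perm_orbit n (?F z) = perm_orbit n (?F w)"
    if "(\<lambda>(x, s). (perm_orbit n x, s)) z = (\<lambda>(x, s). (perm_orbit n x, s)) w" for z w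
  proof -
    obtain x s y where zw: "z = (x, s)" "w = (y, s)" and eq: "perm_orbit n x = perm_orbit n y"
      using \<open>(\<lambda>(x, s). (perm_orbit n x, s)) z = (\<lambda>(x, s). (perm_orbit n x, s)) w\<close>
      by (cases z, cases w) simp
    obtain \<pi> where \<pi>: "\<pi> permutes {..<n}" "x = y \<circ> \<pi>"
      by (rule perm_orbit_eqE[OF eq])
    then show ?thesis
      using restrict_compose_permutes[OF \<pi>(1), of "\<lambda>p. F (p, s)" y]
      by (simp add: zw perm_orbit_compose)
  qed
  obtain H where H: "continuous_map (prod_topology ?U ?I) ?U H"
    "\<And>z. z \<in> topspace (prod_topology ?D ?I) \<Longrightarrow> H ((\<lambda>(x, s). (perm_orbit n x, s)) z) = perm_orbit n (?F z)"
    by (rule quotient_map_lift_exists[OF quot cont inv]) (assumption, rule that, assumption, assumption)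
  show ?thesis
  proof (rule that[OF H(1)])
    show "H (perm_orbit n x, s) = perm_orbit n (restrict (\<lambda>i. F (x i, s)) {..<n})"
      if "x \<in> configurations G n" "s \<in> {0..1}" for x s
      using H(2)[of "(x, s)"] that by (simp add: topspace_ordered_discrete_conf)
  qed
qed

lemma openin_orbits_avoiding:
  assumes B: "closedin (gspace G) B"
  shows "openin (unordered_discrete_conf n G)
    {A \<in> topspace (unordered_discrete_conf n G). \<forall>x\<in>A. \<forall>i<n. x i \<notin> B}"
proof -
  let ?D = "ordered_discrete_conf n G" and ?U = "unordered_discrete_conf n G"
  have all: "(\<forall>y\<in>perm_orbit n x. \<forall>i<n. y i \<notin> B) \<longleftrightarrow> (\<forall>i<n. x i \<notin> B)" for x
  proof
    assume "\<forall>y\<in>perm_orbit n x. \<forall>i<n. y i \<notin> B"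
    then show "\<forall>i<n. x i \<notin> B" using mem_perm_orbit_self by blast
  next
    assume *: "\<forall>i<n. x i \<notin> B"
    show "\<forall>y\<in>perm_orbit n x. \<forall>i<n. y i \<notin> B"
    proof (intro ballI allI impI)
      fix y i assume "y \<in> perm_orbit n x" "i < n"
      then obtain \<pi> where "\<pi> permutes {..<n}" "y = x \<circ> \<pi>" by (auto simp: perm_orbit_def)
      with * \<open>i < n\<close> show "y i \<notin> B" using permutes_in_image[of \<pi> "{..<n}" i] by simp
    qed
  qed
  have "openin ?D {x \<in> topspace ?D. x i \<in> topspace (gspace G) - B}" if "i < n" for i
    by (rule openin_continuous_map_preimage[OF continuous_map_configuration_component[OF that]])
      (use B in auto)
  then have "openin ?D (topspace ?D \<inter> (\<Inter>i<n. {x \<in> topspace ?D. x i \<in> topspace (gspace G) - B}))"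
    by (cases "n = 0") (auto intro!: openin_Int openin_Inter)
  also have "topspace ?D \<inter> (\<Inter>i<n. {x \<in> topspace ?D. x i \<in> topspace (gspace G) - B}) =
      {x \<in> topspace ?D. perm_orbit n x \<in> {A \<in> topspace ?U. \<forall>x\<in>A. \<forall>i<n. x i \<notin> B}}"
  proof (rule Collect_cong[THEN trans[rotated]])
    show "topspace ?D \<inter> (\<Inter>i<n. {x \<in> topspace ?D. x i \<in> topspace (gspace G) - B}) =
        {x. x \<in> configurations G n \<and> (\<forall>i<n. x i \<notin> B)}"
      by (auto simp: topspace_ordered_discrete_conf configurations_def)
    fix x
    show "(x \<in> configurations G n \<and> (\<forall>i<n. x i \<notin> B)) = (x \<in> topspace ?D \<and>
        perm_orbit n x \<in> {A \<in> topspace ?U. \<forall>x\<in>A. \<forall>i<n. x i \<notin> B})"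
      by (auto simp: topspace_ordered_discrete_conf topspace_unordered_discrete_conf all)
  qed
  finally have open_pre: "openin ?D
      {x \<in> topspace ?D. perm_orbit n x \<in> {A \<in> topspace ?U. \<forall>x\<in>A. \<forall>i<n. x i \<notin> B}}" .
  have "\<forall>V\<subseteq>topspace ?U. openin ?D {x \<in> topspace ?D. perm_orbit n x \<in> V} \<longleftrightarrow> openin ?U V"
    using quotient_map_perm_orbit[of n G] unfolding quotient_map_def by (rule conjunct2)
  then show ?thesis
    using open_pre by (elim allE[of _ "{A \<in> topspace ?U. \<forall>x\<in>A. \<forall>i<n. x i \<notin> B}"]) simp
qed

section \<open>Path connectedness\<close>

lemma configuration_inj:
  assumes "x \<in> configurations G n" "i < n" "j < n" "x i = x j"
  shows "i = j"
proof (rule ccontr)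
  assume "i \<noteq> j"
  moreover have "\<forall>i<n. \<forall>j<n. i \<noteq> j \<longrightarrow> cell_hull G (x i) \<inter> cell_hull G (x j) = {}"
    using assms(1) by (simp add: configurations_def)
  ultimately have "cell_hull G (x i) \<inter> cell_hull G (x j) = {}"
    using assms(2,3) by blast
  moreover have "x i \<in> cell_hull G (x i)"
    using assms by (intro mem_cell_hull) (auto simp: configurations_def)
  ultimately show False using assms(4) by auto
qed

definition vertex_configurations :: "nat \<Rightarrow> (nat \<Rightarrow> 'v) set" where
  "vertex_configurations n = {x \<in> configurations G n. x ` {..<n} \<subseteq> verts G}"

lemma vertex_configurationsI:
  assumes "x \<in> extensional {..<n}" "inj_on x {..<n}" "x ` {..<n} \<subseteq> verts G"
  shows "x \<in> vertex_configurations n"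
proof -
  have v: "x i \<in> verts G" if "i < n" for i using assms(3) that by auto
  have "x \<in> PiE {..<n} (\<lambda>_. topspace (gspace G))"
    using assms(1) v verts_subset_topspace by (auto simp: PiE_def)
  moreover have "cell_hull G (x i) \<inter> cell_hull G (x j) = {}" if "i < n" "j < n" "i \<noteq> j" for i j
    using v[OF that(1)] v[OF that(2)] inj_onD[OF assms(2), of i j] that by (auto simp: cell_hull_vertex)
  ultimately show ?thesis
    using assms(3) by (simp add: vertex_configurations_def configurations_def)
qed

lemma vertex_configurations_same_orbit:
  assumes x: "x \<in> vertex_configurations n" and y: "y \<in> vertex_configurations n"
    and im: "x ` {..<n} = y ` {..<n}"
  shows "perm_orbit n x = perm_orbit n y"
proof -
  have inj: "inj_on x {..<n}" "inj_on y {..<n}"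
    using x y configuration_inj by (auto simp: vertex_configurations_def inj_on_def)
  define \<pi> where "\<pi> i = (if i < n then the_inv_into {..<n} x (y i) else i)" for i
  have "bij_betw (the_inv_into {..<n} x \<circ> y) {..<n} {..<n}"
    using bij_betw_trans[of y "{..<n}" "y ` {..<n}" "the_inv_into {..<n} x" "{..<n}"] inj im
      bij_betw_the_inv_into[of x "{..<n}" "x ` {..<n}"] by (simp add: bij_betw_def)
  then have "bij_betw \<pi> {..<n} {..<n}"
    by (rule bij_betw_cong[THEN iffD1, rotated]) (simp add: \<pi>_def)
  then have \<pi>: "\<pi> permutes {..<n}"
    by (rule bij_imp_permutes) (simp add: \<pi>_def)
  have "y = x \<circ> \<pi>"
  proof
    fix i
    show "y i = (x \<circ> \<pi>) i"
    proof (cases "i < n")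
      case True
      then have "y i \<in> x ` {..<n}" using im by auto
      then show ?thesis using True f_the_inv_into_f[OF inj(1)] by (simp add: \<pi>_def)
    next
      case False
      then show ?thesis
        using x y by (simp add: \<pi>_def vertex_configurations_def configurations_def PiE_def extensional_def)
    qed
  qed
  then show ?thesis unfolding perm_orbit_compose[OF \<pi>] by (simp only: perm_orbit_compose[OF \<pi>])
qed

lemma vertex_configuration_exists:
  assumes "S \<subseteq> verts G" "card S = n"
  shows "\<exists>x. x \<in> vertex_configurations n \<and> x ` {..<n} = S"
proof -
  have "finite S" using assms(1) finite_verts by (rule finite_subset)
  from ex_bij_betw_nat_finite[OF this] obtain h where "bij_betw h {0..<card S} S" ..
  then have h: "inj_on h {..<n}" "h ` {..<n} = S"
    using assms(2) by (auto simp: bij_betw_def atLeast0LessThan)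
  have r: "restrict h {..<n} ` {..<n} = S" using h(2) by simp
  have "restrict h {..<n} \<in> vertex_configurations n"
    by (rule vertex_configurationsI) (use h r assms(1) in \<open>auto simp: inj_on_restrict_eq\<close>)
  then show ?thesis using r by blast
qed

text \<open>The unordered configuration that occupies the vertices in \<open>S\<close>; it is independent of the chosen
enumeration by the preceding lemmas.\<close>

definition vertex_orbit :: "nat \<Rightarrow> 'v set \<Rightarrow> (nat \<Rightarrow> 'v) set" where
  "vertex_orbit n S = perm_orbit n (SOME x. x \<in> vertex_configurations n \<and> x ` {..<n} = S)"

lemma vertex_orbit_eq:
  assumes "x \<in> vertex_configurations n"
  shows "vertex_orbit n (x ` {..<n}) = perm_orbit n x"
proof -
  have "\<exists>y. y \<in> vertex_configurations n \<and> y ` {..<n} = x ` {..<n}" using assms by blast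
  from someI_ex[OF this] show ?thesis
    unfolding vertex_orbit_def by (intro vertex_configurations_same_orbit[OF _ assms]) simp_all
qed

abbreviation (input) linked :: "nat \<Rightarrow> 'v set \<Rightarrow> 'v set \<Rightarrow> bool" where
  "linked n S T \<equiv> path_component_of (unordered_discrete_conf n G) (vertex_orbit n S) (vertex_orbit n T)"

lemma joined_vertices_path:
  assumes e: "e \<in> edges G" and j: "joins G e v w"
  obtains g where "continuous_map (top_of_set {0..1::real}) (gspace G) g" "g 0 = v" "g 1 = w"
    "\<And>s. s \<in> {0..1} \<Longrightarrow> cell_hull G (g s) \<subseteq> closed_edge G e"
proof -
  from j consider "chmap G e 0 = v" "chmap G e 1 = w" | "chmap G e 0 = w" "chmap G e 1 = v"
    unfolding joins_def by (auto simp: doubleton_eq_iff)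
  then show ?thesis
  proof cases
    case 1
    then show ?thesis
      using continuous_map_chmap[OF e] cell_hull_chmap_subset[OF e] by (intro that[of "chmap G e"])
  next
    case 2
    have "continuous_map (top_of_set {0..1}) (top_of_set {0..1::real}) (\<lambda>t. 1 - t)"
      by (auto intro!: continuous_intros)
    from continuous_map_compose[OF this continuous_map_chmap[OF e]]
    have "continuous_map (top_of_set {0..1}) (gspace G) (\<lambda>t. chmap G e (1 - t))" unfolding o_def .
    then show ?thesis
      using 2 cell_hull_chmap_subset[OF e] by (intro that[of "\<lambda>t. chmap G e (1 - t)"]) simp_all
  qed
qed

lemma linked_slide:
  assumes S: "S \<subseteq> verts G" "card S = n" and v: "v \<in> S" and w: "w \<in> verts G" "w \<notin> S"
    and e: "e \<in> edges G" "joins G e v w"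
  shows "linked n S (insert w (S - {v}))"
proof -
  obtain x where x: "x \<in> vertex_configurations n" "x ` {..<n} = S"
    using vertex_configuration_exists[OF S] by blast
  then have xc: "x \<in> configurations G n" and xv: "x ` {..<n} \<subseteq> verts G"
    by (auto simp: vertex_configurations_def)
  obtain k where k: "k < n" "x k = v" using v x(2) by auto
  have inj: "inj_on x {..<n}" using configuration_inj[OF xc] by (simp add: inj_on_def)
  obtain g where g: "continuous_map (top_of_set {0..1::real}) (gspace G) g" "g 0 = v" "g 1 = w"
    "\<And>s. s \<in> {0..1} \<Longrightarrow> cell_hull G (g s) \<subseteq> closed_edge G e"
    by (rule joined_vertices_path[OF e]) (rule that, assumption, assumption, assumption, blast)
  have gtop: "g s \<in> topspace (gspace G)" if "s \<in> {0..1}" for s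
    using funcset_mem[OF continuous_map_funspace[OF g(1)], of s] that by simp
  have xi: "x i \<in> verts G" "x i \<in> topspace (gspace G)" if "i < n" for i
    using xv that verts_subset_topspace by auto
  have off: "x i \<notin> closed_edge G e" if "i < n" "i \<noteq> k" for i
  proof -
    have "x i \<noteq> v" using inj k that by (auto simp: inj_on_def)
    moreover have "x i \<noteq> w" using x(2) w(2) that by auto
    moreover have "{chmap G e 0, chmap G e 1} = {v, w}" using e(2) by (simp add: joins_def)
    ultimately show ?thesis
      using vertex_notin_open_edge[OF xi(1)[OF that(1)] e(1)] by (auto simp: closed_edge_eq)
  qed
  have mem: "x(k := g s) \<in> configurations G n" if s: "s \<in> {0..1}" for s
  proof -
    have "x(k := g s) \<in> PiE {..<n} (\<lambda>_. topspace (gspace G))"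
      using xc k gtop[OF s] by (auto simp: configurations_def PiE_def extensional_def)
    moreover have "cell_hull G ((x(k := g s)) i) \<inter> cell_hull G ((x(k := g s)) j) = {}"
      if ij: "i < n" "j < n" "i \<noteq> j" for i j
    proof -
      have vh: "cell_hull G (x l) = {x l}" if "l < n" for l
        using xi(1)[OF that] by (rule cell_hull_vertex)
      consider "i = k" | "j = k" | "i \<noteq> k" "j \<noteq> k" by blast
      then show ?thesis
      proof cases
        case 1
        then show ?thesis using g(4)[OF s] off[OF ij(2)] vh[OF ij(2)] ij(3) by auto
      next
        case 2
        then show ?thesis using g(4)[OF s] off[OF ij(1)] vh[OF ij(1)] ij(3) by auto
      next
        case 3
        then show ?thesis using xc ij by (simp add: configurations_def)
      qed
    qed
    ultimately show ?thesis by (simp add: configurations_def)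
  qed
  have "continuous_map (top_of_set {0..1}) (ordered_discrete_conf n G) (\<lambda>s. x(k := g s))"
  proof (rule continuous_map_into_configurations)
    show "continuous_map (top_of_set {0..1}) (gspace G) (\<lambda>s. (x(k := g s)) i)" if "i < n" for i
      using g(1) xi(2)[OF that] by (cases "i = k") simp_all
  qed (use mem in simp)
  then have "path_component_of (ordered_discrete_conf n G) (x(k := g 0)) (x(k := g 1))"
    unfolding path_component_of_def pathin_def by blast
  then have "path_component_of (ordered_discrete_conf n G) x (x(k := w))"
    unfolding g(2,3) k(2)[symmetric] by simp
  then have pc: "path_component_of (unordered_discrete_conf n G) (perm_orbit n x) (perm_orbit n (x(k := w)))"
    by (rule path_component_of_orbits)
  have im: "x(k := w) ` {..<n} = insert w (S - {v})"
  proof -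
    have "x(k := w) ` {..<n} = insert w (x ` ({..<n} - {k}))" using k(1) by auto
    also have "x ` ({..<n} - {k}) = S - {v}"
      using inj_on_image_set_diff[OF inj, of "{..<n}" "{k}"] k x(2) by auto
    finally show ?thesis .
  qed
  have "x(k := w) \<in> vertex_configurations n"
    using mem[of 1] g(3) im S(1) w(1) by (auto simp: vertex_configurations_def)
  from vertex_orbit_eq[OF this, unfolded im] vertex_orbit_eq[OF x(1), unfolded x(2)] pc
  show ?thesis by simp
qed

text \<open>Tokens are slid along a walk from \<open>v\<close> to \<open>w\<close>, by induction on the walk. If the next vertex \<open>u\<close> is
free, the token at \<open>v\<close> moves there and continues to \<open>w\<close>. If \<open>u\<close> is occupied, the token at \<open>u\<close> goes to
\<open>w\<close> first and the token at \<open>v\<close> then takes its place; as tokens are unlabelled, the result is the same.\<close>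

lemma linked_exchange:
  assumes vw: "(v, w) \<in> {(a, b). \<exists>e\<in>edges G. joins G e a b}\<^sup>*"
    and w: "w \<in> verts G"
    and S: "S \<subseteq> verts G" "card S = n" "v \<in> S" "w \<notin> S"
  shows "linked n S (insert w (S - {v}))"
  using vw S
proof (induction arbitrary: S rule: converse_rtrancl_induct)
  case base
  then show ?case by simp
next
  case (step v u)
  obtain e where e: "e \<in> edges G" "joins G e v u" using step.hyps(1) by auto
  have fin: "finite S" using step.prems(1) finite_verts by (rule finite_subset)
  have "{chmap G e 0, chmap G e 1} = {v, u}" using e(2) by (simp add: joins_def)
  then have u: "u \<in> verts G" using chmap_ends[OF e(1)] by (auto simp: doubleton_eq_iff)
  have ex: "card (insert b (S - {a})) = n" if "a \<in> S" "b \<notin> S" for a b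
    using fin that step.prems(2) card_Suc_Diff1[OF fin that(1)] by simp
  show ?case
  proof (cases "u \<in> S")
    case False
    let ?S = "insert u (S - {v})"
    have 1: "linked n S ?S"
      using step.prems u False e by (intro linked_slide)
    show ?thesis
    proof (cases "u = w")
      case True
      then show ?thesis using 1 by simp
    next
      case False
      have "linked n ?S (insert w (?S - {u}))"
        using step.prems u False ex[OF step.prems(3) \<open>u \<notin> S\<close>] by (intro step.IH) auto
      moreover have "insert w (?S - {u}) = insert w (S - {v})" using \<open>u \<notin> S\<close> by auto
      ultimately show ?thesis using 1 path_component_of_trans by metis
    qed
  next
    case True
    have 1: "linked n S (insert w (S - {u}))"
      using step.prems True by (intro step.IH)
    show ?thesis
    proof (cases "u = v")
      case True
      then show ?thesis using 1 by simp
    next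
      case False
      let ?S = "insert w (S - {u})"
      have "linked n ?S (insert u (?S - {v}))"
      proof (rule linked_slide[OF _ _ _ u _ e])
        show "?S \<subseteq> verts G" using step.prems(1) w by auto
        show "card ?S = n" by (rule ex[OF True step.prems(4)])
        show "v \<in> ?S" using False step.prems(3) by simp
        show "u \<notin> ?S" using True step.prems(4) by auto
      qed
      moreover have "insert u (?S - {v}) = insert w (S - {v})"
        using False True step.prems(3,4) by auto
      ultimately show ?thesis using 1 path_component_of_trans by metis
    qed
  qed
qed

lemma linked_all:
  assumes "S \<subseteq> verts G" "card S = n" "T \<subseteq> verts G" "card T = n"
  shows "linked n S T"
  using assms(1,2)
proof (induction "card (S - T)" arbitrary: S rule: less_induct)
  case less
  have fin: "finite S" "finite T"
    using less.prems(1) assms(3) finite_verts finite_subset by auto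
  show ?case
  proof (cases "S = T")
    case True
    obtain x where x: "x \<in> vertex_configurations n" "x ` {..<n} = S"
      using vertex_configuration_exists[OF less.prems] by blast
    have "vertex_orbit n S \<in> topspace (unordered_discrete_conf n G)"
      using vertex_orbit_eq[OF x(1)] x by (simp add: topspace_unordered_discrete_conf vertex_configurations_def)
    then show ?thesis using True by (simp add: path_component_of_refl)
  next
    case False
    have "\<not> S \<subseteq> T" using card_subset_eq[OF fin(2), of S] less.prems(2) assms(4) False by auto
    then obtain v where v: "v \<in> S" "v \<notin> T" by blast
    have "\<not> T \<subseteq> S" using card_subset_eq[OF fin(1), of T] less.prems(2) assms(4) False by auto
    then obtain w where w: "w \<in> T" "w \<notin> S" by blast
    let ?S = "insert w (S - {v})"
    have vw: "v \<in> verts G" "w \<in> verts G" using v w less.prems(1) assms(3) by auto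
    have 1: "linked n S ?S"
      by (rule linked_exchange[OF vertices_connected_by_edges[OF vw] vw(2) less.prems v(1) w(2)])
    have "?S - T = (S - T) - {v}" using w by auto
    moreover have "card ((S - T) - {v}) < card (S - T)"
      by (rule card_Diff1_less) (use fin v in auto)
    ultimately have "card (?S - T) < card (S - T)"
      by (simp only:)
    moreover have "?S \<subseteq> verts G" using less.prems(1) vw by auto
    moreover have "card ?S = n"
      using fin(1) v(1) w(2) less.prems(2) card_Suc_Diff1[OF fin(1) v(1)] by simp
    ultimately have "linked n ?S T" by (rule less.hyps)
    with 1 show ?thesis by (rule path_component_of_trans)
  qed
qed

lemma slide_to_vertices:
  assumes x: "x \<in> configurations G n"
  obtains y where "y \<in> vertex_configurations n" "path_component_of (ordered_discrete_conf n G) x y"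
proof -
  have "\<exists>g. continuous_map (top_of_set {0..1::real}) (gspace G) g \<and> g 0 = x i \<and> g 1 \<in> verts G \<and>
      (\<forall>s\<in>{0..1}. cell_hull G (g s) \<subseteq> cell_hull G (x i))" if "i < n" for i
  proof -
    have "x i \<in> topspace (gspace G)" using x that by (auto simp: configurations_def)
    then show ?thesis
    proof (cases rule: graph_point_cases)
      case 1
      then show ?thesis using verts_subset_topspace by (intro exI[of _ "\<lambda>_. x i"]) simp
    next
      case (2 e t)
      have "continuous_map (top_of_set {0..1}) (top_of_set {0..1}) (\<lambda>s. (1 - s) * t)"
        using 2(2) by (auto intro!: continuous_intros mult_le_one)
      from continuous_map_compose[OF this continuous_map_chmap[OF 2(1)]]
      have "continuous_map (top_of_set {0..1}) (gspace G) (\<lambda>s. chmap G e ((1 - s) * t))" unfolding o_def .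
      moreover have "cell_hull G (chmap G e ((1 - s) * t)) \<subseteq> cell_hull G (x i)" if "s \<in> {0..1}" for s
      proof -
        have "(1 - s) * t \<in> {0..1}" using that 2(2) by (auto intro!: mult_le_one)
        then show ?thesis
          using cell_hull_chmap_subset[OF 2(1)] cell_hull_interior[OF 2(1,2)] 2(3) by simp
      qed
      ultimately show ?thesis
        using 2 chmap_ends[OF 2(1)] by (intro exI[of _ "\<lambda>s. chmap G e ((1 - s) * t)"]) simp
    qed
  qed
  then have "\<forall>i\<in>{..<n}. \<exists>g. continuous_map (top_of_set {0..1::real}) (gspace G) g \<and> g 0 = x i \<and> g 1 \<in> verts G \<and>
      (\<forall>s\<in>{0..1}. cell_hull G (g s) \<subseteq> cell_hull G (x i))" by simp
  from bchoice[OF this] obtain g where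
    "\<forall>i\<in>{..<n}. continuous_map (top_of_set {0..1::real}) (gspace G) (g i) \<and> g i 0 = x i \<and> g i 1 \<in> verts G \<and>
      (\<forall>s\<in>{0..1}. cell_hull G (g i s) \<subseteq> cell_hull G (x i))" ..
  then have g: "\<And>i. i < n \<Longrightarrow> continuous_map (top_of_set {0..1::real}) (gspace G) (g i)"
    "\<And>i. i < n \<Longrightarrow> g i 0 = x i" "\<And>i. i < n \<Longrightarrow> g i 1 \<in> verts G"
    "\<And>i s. i < n \<Longrightarrow> s \<in> {0..1} \<Longrightarrow> cell_hull G (g i s) \<subseteq> cell_hull G (x i)" by simp_all
  define p where "p s = restrict (\<lambda>i. g i s) {..<n}" for s
  have p: "p s \<in> configurations G n" if s: "s \<in> {0..1}" for s
  proof (rule configurations_mono[OF x])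
    have "g i s \<in> topspace (gspace G)" if "i < n" for i
      using funcset_mem[OF continuous_map_funspace[OF g(1)[OF that]], of s] s by simp
    then show "p s \<in> PiE {..<n} (\<lambda>_. topspace (gspace G))" by (simp add: p_def)
    show "cell_hull G (p s i) \<subseteq> cell_hull G (x i)" if "i < n" for i
      using g(4)[OF that s] that by (simp add: p_def)
  qed
  have "continuous_map (top_of_set {0..1}) (ordered_discrete_conf n G) p"
  proof (rule continuous_map_into_configurations)
    show "continuous_map (top_of_set {0..1}) (gspace G) (\<lambda>s. p s i)" if "i < n" for i
      using g(1)[OF that] that by (simp add: p_def)
  qed (use p in simp)
  then have "path_component_of (ordered_discrete_conf n G) (p 0) (p 1)"
    unfolding path_component_of_def pathin_def by blast
  moreover have "p 0 = x"
    using x g(2) by (auto simp: p_def configurations_def PiE_def extensional_def restrict_def)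
  moreover have "p 1 \<in> vertex_configurations n"
    using p[of 1] g(3) by (auto simp: vertex_configurations_def p_def)
  ultimately show ?thesis using that by metis
qed

lemma path_connected_unordered_discrete_conf: "path_connected_space (unordered_discrete_conf n G)"
  unfolding path_connected_space_iff_path_component
proof (intro ballI)
  let ?U = "unordered_discrete_conf n G"
  fix A B assume "A \<in> topspace ?U" "B \<in> topspace ?U"
  then obtain x y where x: "x \<in> configurations G n" "A = perm_orbit n x"
    and y: "y \<in> configurations G n" "B = perm_orbit n y"
    by (auto simp: topspace_unordered_discrete_conf)
  obtain x' where x': "x' \<in> vertex_configurations n" "path_component_of (ordered_discrete_conf n G) x x'"
    by (rule slide_to_vertices[OF x(1)])
  obtain y' where y': "y' \<in> vertex_configurations n" "path_component_of (ordered_discrete_conf n G) y y'"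
    by (rule slide_to_vertices[OF y(1)])
  have card: "card (z ` {..<n}) = n" "z ` {..<n} \<subseteq> verts G" if z: "z \<in> vertex_configurations n" for z
  proof -
    have "inj_on z {..<n}"
      using z configuration_inj by (auto simp: vertex_configurations_def inj_on_def)
    then show "card (z ` {..<n}) = n" by (simp add: card_image)
    show "z ` {..<n} \<subseteq> verts G" using z by (simp add: vertex_configurations_def)
  qed
  have "linked n (x' ` {..<n}) (y' ` {..<n})"
    by (rule linked_all) (rule card x' y')+
  then have "path_component_of ?U (perm_orbit n x') (perm_orbit n y')"
    by (simp add: vertex_orbit_eq x'(1) y'(1))
  from path_component_of_trans[OF path_component_of_orbits[OF x'(2)] this]
  show "path_component_of ?U A B"
    using path_component_of_sym[OF path_component_of_orbits[OF y'(2)]] unfolding x(2) y(2)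
    by (rule path_component_of_trans)
qed

section \<open>The upper bound\<close>

theorem TC_unordered_discrete_conf_le: "TC (unordered_discrete_conf n G) \<le> enat (2 * n + 1)"
proof -
  let ?U = "unordered_discrete_conf n G" and ?I = "top_of_set {0..1::real}"
  \<comment> \<open>The denominator only has to exceed \<open>2 * (4 * n + 3)\<close>, so that all intervals lie below \<open>1/2\<close>.\<close>
  define d where "d = 8 * real n + 8"
  define a where "a k = 2 * real k / d" for k
  define b where "b k = (2 * real k + 1) / d" for k
  have d: "d > 0" by (simp add: d_def)
  have ab: "0 < a k" "a k < b k" "b k < 1/2" if "k \<in> {1..2 * n + 1}" for k
    using that d by (auto simp: a_def b_def d_def field_simps)
  have b_less_a: "b k < a l" if "k < l" for k l
    unfolding a_def b_def using that d by (intro divide_strict_right_mono) auto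
  define V where "V k = {A \<in> topspace ?U. \<forall>x\<in>A. \<forall>i<n. x i \<notin> edge_band G (a k) (b k)}" for k
  have "\<exists>H. continuous_map (prod_topology ?U ?I) ?U H \<and>
      (\<forall>x s. x \<in> configurations G n \<and> s \<in> {0..1} \<longrightarrow>
      H (perm_orbit n x, s) = perm_orbit n (restrict (\<lambda>i. edge_homotopy G (snap (a k) (b k)) (x i, s)) {..<n}))"
    if k: "k \<in> {1..2 * n + 1}" for k
  proof -
    have s01: "snap (a k) (b k) 0 = 0" "snap (a k) (b k) 1 = 1"
      using snap_values[OF ab[OF k]] ab[OF k] by simp_all
    have c: "continuous_map (prod_topology (gspace G) ?I) (gspace G) (edge_homotopy G (snap (a k) (b k)))"
      by (rule continuous_map_edge_homotopy[OF s01 continuous_snap snap_range]) (rule ab[OF k])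
    obtain H where "continuous_map (prod_topology ?U ?I) ?U H"
      "\<And>x s. x \<in> configurations G n \<Longrightarrow> s \<in> {0..1} \<Longrightarrow>
        H (perm_orbit n x, s) = perm_orbit n (restrict (\<lambda>i. edge_homotopy G (snap (a k) (b k)) (x i, s)) {..<n})"
      by (rule homotopy_descends_to_orbits[OF c cell_hull_edge_homotopy[OF _ _ snap_range]])
        (assumption, assumption, rule that, assumption, assumption)
    then show ?thesis by blast
  qed
  then have "\<forall>k\<in>{1..2 * n + 1}. \<exists>H. continuous_map (prod_topology ?U ?I) ?U H \<and>
      (\<forall>x s. x \<in> configurations G n \<and> s \<in> {0..1} \<longrightarrow>
      H (perm_orbit n x, s) = perm_orbit n (restrict (\<lambda>i. edge_homotopy G (snap (a k) (b k)) (x i, s)) {..<n}))"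
    by (rule ballI)
  from bchoice[OF this] obtain H where H: "\<forall>k\<in>{1..2 * n + 1}. continuous_map (prod_topology ?U ?I) ?U (H k) \<and>
      (\<forall>x s. x \<in> configurations G n \<and> s \<in> {0..1} \<longrightarrow>
      H k (perm_orbit n x, s) = perm_orbit n (restrict (\<lambda>i. edge_homotopy G (snap (a k) (b k)) (x i, s)) {..<n}))" ..
  show ?thesis
  proof (rule TC_le_if_covered_by_deformable_squares[OF path_connected_unordered_discrete_conf
        t1_space_unordered_discrete_conf, where V = V and H = H])
    fix k assume k: "k \<in> {1..2 * n + 1}"
    show "openin ?U (V k)"
      unfolding V_def by (rule openin_orbits_avoiding[OF closedin_edge_band[OF ab[OF k]]])
    show "continuous_map (prod_topology ?U ?I) ?U (H k)"
      using H k by blast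
    have Hk: "H k (perm_orbit n x, s) = perm_orbit n (restrict (\<lambda>i. edge_homotopy G (snap (a k) (b k)) (x i, s)) {..<n})"
      if "x \<in> configurations G n" "s \<in> {0..1}" for x s
      using H k that by blast
    show "H k (A, 0) = A" if A: "A \<in> topspace ?U" for A
    proof -
      obtain x where x: "x \<in> configurations G n" "A = perm_orbit n x"
        using A by (auto simp: topspace_unordered_discrete_conf)
      have "restrict (\<lambda>i. edge_homotopy G (snap (a k) (b k)) (x i, 0)) {..<n} = x"
      proof
        fix i
        show "restrict (\<lambda>i. edge_homotopy G (snap (a k) (b k)) (x i, 0)) {..<n} i = x i"
          using x(1) edge_homotopy_0[of "x i"] by (auto simp: configurations_def PiE_def extensional_def)
      qed
      then show ?thesis using Hk[OF x(1), of 0] x(2) by simp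
    qed
    show "finite ((\<lambda>A. H k (A, 1)) ` V k)"
    proof (rule finite_subset)
      show "finite (perm_orbit n ` PiE {..<n} (\<lambda>_. landmarks))"
        by (intro finite_imageI finite_PiE finite_landmarks) simp
      show "(\<lambda>A. H k (A, 1)) ` V k \<subseteq> perm_orbit n ` PiE {..<n} (\<lambda>_. landmarks)"
      proof
        fix C assume "C \<in> (\<lambda>A. H k (A, 1)) ` V k"
        then obtain A where A: "A \<in> V k" "C = H k (A, 1)" by blast
        then obtain x where x: "x \<in> configurations G n" "A = perm_orbit n x"
          by (auto simp: V_def topspace_unordered_discrete_conf)
        have "x i \<notin> edge_band G (a k) (b k)" if "i < n" for i
          using A(1) that mem_perm_orbit_self[of x n] unfolding x(2) V_def by blast
        moreover have "x i \<in> topspace (gspace G)" if "i < n" for i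
          using x(1) that by (auto simp: configurations_def)
        ultimately have "edge_homotopy G (snap (a k) (b k)) (x i, 1) \<in> landmarks" if "i < n" for i
          using edge_homotopy_snap_1[OF ab[OF k]] that by simp
        then have "restrict (\<lambda>i. edge_homotopy G (snap (a k) (b k)) (x i, 1)) {..<n} \<in> PiE {..<n} (\<lambda>_. landmarks)"
          by simp
        moreover have "C = perm_orbit n (restrict (\<lambda>i. edge_homotopy G (snap (a k) (b k)) (x i, 1)) {..<n})"
          using Hk[OF x(1), of 1] A(2) x(2) by simp
        ultimately show "C \<in> perm_orbit n ` PiE {..<n} (\<lambda>_. landmarks)" by simp
      qed
    qed
  next
    show "topspace ?U \<times> topspace ?U \<subseteq> (\<Union>k\<in>{1..2 * n + 1}. V k \<times> V k)"
    proof
      fix z assume "z \<in> topspace ?U \<times> topspace ?U"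
      then obtain x y where x: "x \<in> configurations G n" and y: "y \<in> configurations G n"
        and z: "z = (perm_orbit n x, perm_orbit n y)"
        by (auto simp: topspace_unordered_discrete_conf)
      let ?P = "x ` {..<n} \<union> y ` {..<n}"
      have "\<exists>k\<in>{1..2 * n + 1}. ?P \<inter> edge_band G (a k) (b k) = {}"
      proof (rule ccontr)
        assume "\<not> (\<exists>k\<in>{1..2 * n + 1}. ?P \<inter> edge_band G (a k) (b k) = {})"
        then have "\<forall>k\<in>{1..2 * n + 1}. \<exists>p. p \<in> ?P \<and> p \<in> edge_band G (a k) (b k)" by blast
        from bchoice[OF this] obtain f where f: "\<forall>k\<in>{1..2 * n + 1}. f k \<in> ?P \<and> f k \<in> edge_band G (a k) (b k)" ..
        have ne: "f k \<noteq> f l" if "k \<in> {1..2 * n + 1}" "l \<in> {1..2 * n + 1}" "k < l" for k l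
        proof
          assume "f k = f l"
          moreover have "f k \<in> edge_band G (a k) (b k)" "f l \<in> edge_band G (a l) (b l)" using f that by blast+
          ultimately have "f k \<in> edge_band G (a k) (b k) \<inter> edge_band G (a l) (b l)" by simp
          then show False using edge_bands_disjoint[OF ab[OF that(1)] ab[OF that(2)] b_less_a[OF that(3)]] by auto
        qed
        have "inj_on f {1..2 * n + 1}"
          by (rule linorder_inj_onI') (use ne in blast)
        then have "card {1..2 * n + 1} \<le> card ?P"
          using f by (intro card_inj_on_le[of f]) auto
        also have "card ?P \<le> card (x ` {..<n}) + card (y ` {..<n})" by (rule card_Un_le)
        also have "\<dots> \<le> n + n"
          using card_image_le[of "{..<n}" x] card_image_le[of "{..<n}" y] by simp
        finally show False by simp
      qed
      then obtain k where k: "k \<in> {1..2 * n + 1}" "?P \<inter> edge_band G (a k) (b k) = {}" ..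
      have in_V: "perm_orbit n w \<in> V k" if w: "w \<in> configurations G n" "w ` {..<n} \<subseteq> ?P" for w
      proof -
        have "v i \<notin> edge_band G (a k) (b k)" if v: "v \<in> perm_orbit n w" and i: "i < n" for v i
        proof -
          obtain \<pi> where \<pi>: "\<pi> permutes {..<n}" "v = w \<circ> \<pi>" using v by (auto simp: perm_orbit_def)
          then have "v i \<in> w ` {..<n}" using i permutes_in_image[OF \<pi>(1), of i] by auto
          then show ?thesis using w(2) k(2) by blast
        qed
        then show ?thesis using w(1) by (simp add: V_def topspace_unordered_discrete_conf)
      qed
      show "z \<in> (\<Union>k\<in>{1..2 * n + 1}. V k \<times> V k)"
        unfolding z by (rule UN_I[OF k(1)]) (use in_V[OF x] in_V[OF y] in simp)
    qed
  qed
qed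

end

section \<open>Cycles as loops that cross one edge once\<close>

text \<open>The preimage of a closed set is the sum of a compact set and the integers, hence closed; at the seam
one uses that \<open>\<gamma>\<close> is a loop.\<close>

lemma continuous_map_periodic_extension:
  assumes \<gamma>: "continuous_map (top_of_set {0..1}) X \<gamma>" and closed: "\<gamma> 0 = \<gamma> (1::real)"
  shows "continuous_map euclideanreal X (\<lambda>t. \<gamma> (frac t))"
  unfolding continuous_map_closedin
proof (intro conjI allI impI)
  have fr: "frac t \<in> {0..1}" for t :: real
    using frac_ge_0[of t] frac_lt_1[of t] by simp
  show "(\<lambda>t. \<gamma> (frac t)) \<in> topspace euclideanreal \<rightarrow> topspace X"
    using funcset_mem[OF continuous_map_funspace[OF \<gamma>]] fr by simp
  fix C assume C: "closedin X C"
  define B where "B = {t \<in> {0..1}. \<gamma> t \<in> C}"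
  have "closedin (top_of_set {0..1}) B"
    using closedin_continuous_map_preimage[OF \<gamma> C] by (simp add: B_def)
  then have "compact B"
    by (rule closedin_compact[rotated]) simp
  then have "closed (\<Union>a\<in>B. \<Union>k\<in>\<int>. {a + k})"
    by (rule compact_closed_sums) simp
  moreover have "{t \<in> topspace euclideanreal. \<gamma> (frac t) \<in> C} = (\<Union>a\<in>B. \<Union>k\<in>\<int>. {a + k})"
  proof (intro equalityI subsetI)
    fix t assume "t \<in> {t \<in> topspace euclideanreal. \<gamma> (frac t) \<in> C}"
    then have "frac t \<in> B" using fr by (simp add: B_def)
    moreover have "t = frac t + of_int \<lfloor>t\<rfloor>" by (simp add: frac_def)
    ultimately show "t \<in> (\<Union>a\<in>B. \<Union>k\<in>\<int>. {a + k})"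
      by (intro UN_I[of "frac t"] UN_I[of "of_int \<lfloor>t\<rfloor>"]) simp_all
  next
    fix t assume "t \<in> (\<Union>a\<in>B. \<Union>k\<in>\<int>. {a + k})"
    then obtain a k where t: "a \<in> B" "k \<in> \<int>" "t = a + k" by (elim UN_E singletonE)
    obtain m where k: "k = of_int m" using t(2) by (rule Ints_cases)
    have a: "a \<in> {0..1}" "\<gamma> a \<in> C" using t(1) by (simp_all add: B_def)
    have "\<gamma> (frac t) = \<gamma> a"
    proof (cases "a = 1")
      case True
      then have "t = of_int (m + 1)" using t(3) k by simp
      then have "frac t = 0" by (simp only: frac_of_int)
      then show ?thesis using closed True by (simp only:)
    next
      case False
      then have "\<lfloor>t\<rfloor> = m" using a(1) t(3) k by (simp add: floor_eq_iff)
      then show ?thesis using t(3) k by (simp add: frac_def)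
    qed
    then show "t \<in> {t \<in> topspace euclideanreal. \<gamma> (frac t) \<in> C}" using a(2) by simp
  qed
  ultimately show "closedin euclideanreal {t \<in> topspace euclideanreal. \<gamma> (frac t) \<in> C}"
    by simp
qed

lemma frac_add_Ints: "k \<in> \<int> \<Longrightarrow> frac (t + k) = frac (t :: real)"
  by (elim Ints_cases) (simp add: frac_def)

text \<open>Climbs by one unit on the first half of each unit interval and is constant on the second half. It
describes the angle of a loop that runs through one edge in the first half of the time and through the
rest of a cycle in the second half.\<close>

definition stairs :: "real \<Rightarrow> real" where
  "stairs t = t + (min 1 (2 * frac t) - frac t)"

lemma continuous_stairs: "continuous_on UNIV stairs"
proof -
  have "continuous_map (top_of_set {0..1}) euclideanreal (\<lambda>u. min 1 (2 * u) - u)"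
    by (auto intro!: continuous_intros)
  from continuous_map_periodic_extension[OF this]
  have "continuous_on UNIV (\<lambda>t. min 1 (2 * frac t) - frac t :: real)" by simp
  then show ?thesis
    unfolding stairs_def[abs_def] by (intro continuous_on_add continuous_on_id)
qed

lemma stairs_add_1: "stairs (t + 1) = stairs t + 1"
  by (simp add: stairs_def frac_add_Ints)

lemma cis_stairs: "cis (2 * pi * stairs t) = cis (2 * pi * min 1 (2 * frac t))"
proof -
  have "2 * pi * stairs t = 2 * pi * min 1 (2 * frac t) + 2 * pi * of_int \<lfloor>t\<rfloor>"
    by (simp add: stairs_def frac_def algebra_simps)
  then have "cis (2 * pi * stairs t) = cis (2 * pi * min 1 (2 * frac t)) * cis (2 * pi * of_int \<lfloor>t\<rfloor>)"
    by (simp only: cis_mult)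
  then show ?thesis by (simp add: cis_multiple_2pi)
qed

text \<open>The embedded circle traced out by a cycle.\<close>

definition carrier :: "('v, 'e) graph \<Rightarrow> 'v list \<times> 'e list \<Rightarrow> 'v set" where
  "carrier G c = \<Union> (closed_edge G ` set (snd c))"

context cw_graph
begin

text \<open>An edge with distinct ends is an arc, and arcs are contractible, whereas the circle is not.\<close>

lemma closed_edge_not_circle:
  assumes e: "e \<in> edges G" and ne: "chmap G e 0 \<noteq> chmap G e 1"
  shows "\<not> subtopology (gspace G) (closed_edge G e) homeomorphic_space top_of_set (sphere (0::complex) 1)"
proof
  assume circle: "subtopology (gspace G) (closed_edge G e) homeomorphic_space top_of_set (sphere (0::complex) 1)"
  have inj: "inj_on (chmap G e) {0..1}"
  proof (rule inj_onI)
    fix s t :: real assume st: "s \<in> {0..1}" "t \<in> {0..1}" and eq: "chmap G e s = chmap G e t"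
    have *: "u \<in> {0<..<1} \<or> (u = 0 \<or> u = 1) \<and> chmap G e u \<in> verts G" if "u \<in> {0..1}" for u
      using chmap_ends[OF e] that by fastforce
    show "s = t"
    proof (cases "s \<in> {0<..<1}")
      case True
      then have "t \<in> {0<..<1}" using *[OF st(2)] eq chmap_notin_verts[OF e True] by auto
      then show ?thesis using chmap_interior_inj(2)[OF e e True _ eq] by simp
    next
      case False
      then have s: "s = 0 \<or> s = 1" "chmap G e s \<in> verts G" using *[OF st(1)] by auto
      then have "t \<notin> {0<..<1}" using eq chmap_notin_verts[OF e, of t] by auto
      then have "t = 0 \<or> t = 1" using *[OF st(2)] by auto
      then show ?thesis using s(1) eq ne by auto
    qed
  qed
  have "compact_space (top_of_set {0..1::real})" by (simp add: compact_space_subtopology)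
  then have "closed_map (top_of_set {0..1}) (gspace G) (chmap G e)"
    by (rule T1_Spaces.continuous_imp_closed_map[OF continuous_map_chmap[OF e] _ graph_Hausdorff])
  then have "embedding_map (top_of_set {0..1}) (gspace G) (chmap G e)"
    by (rule injective_closed_imp_embedding_map[OF continuous_map_chmap[OF e]]) (use inj in simp)
  from embedding_map_imp_homeomorphic_space[OF this]
  have "top_of_set {0..1::real} homeomorphic_space subtopology (gspace G) (closed_edge G e)"
    by (simp add: closed_edge_def)
  from homeomorphic_space_trans[OF this circle]
  have "contractible_space (top_of_set {0..1::real}) \<longleftrightarrow> contractible_space (top_of_set (sphere (0::complex) 1))"
    by (rule homeomorphic_space_contractibility)
  moreover have "contractible {0..1::real}"
    by (simp add: convex_imp_contractible)
  ultimately show False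
    by (simp add: contractible_sphere)
qed

lemma is_cycle_unfold:
  assumes "is_cycle G (vs, es)"
  shows "vs \<noteq> []" "distinct vs" "set vs \<subseteq> verts G" "length es = length vs" "set es \<subseteq> edges G"
    "\<And>i. i < length vs \<Longrightarrow> joins G (es ! i) (vs ! i) (vs ! (Suc i mod length vs))"
    "subtopology (gspace G) (\<Union>e\<in>set es. closed_edge G e) homeomorphic_space top_of_set (sphere (0::complex) 1)"
  using assms by (simp_all add: is_cycle_def)

text \<open>Since the vertices of a cycle are distinct, the first edge can only recur in a cycle of length two
that runs back and forth along it, but the carrier of such a sequence is an arc.\<close>

lemma cycle_first_edge_unrepeated:
  assumes c: "is_cycle G (vs, es)" and i: "0 < i" "i < length vs"
  shows "es ! i \<noteq> es ! 0"
proof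
  note cyc = is_cycle_unfold[OF c]
  let ?k = "length vs"
  assume eq: "es ! i = es ! 0"
  have k: "?k \<ge> 2" using i by simp
  have nth_eq: "vs ! a = vs ! b \<longleftrightarrow> a = b" if "a < ?k" "b < ?k" for a b
    using nth_eq_iff_index_eq[OF cyc(2) that] .
  have "{vs ! i, vs ! (Suc i mod ?k)} = {vs ! 0, vs ! 1}"
  proof -
    have "{chmap G (es ! 0) 0, chmap G (es ! 0) 1} = {vs ! 0, vs ! 1}"
      using cyc(6)[of 0] k cyc(1) by (simp add: joins_def)
    then show ?thesis using cyc(6)[OF i(2)] eq by (simp add: joins_def)
  qed
  moreover have "vs ! i \<noteq> vs ! 0" using nth_eq[of i 0] i cyc(1) by simp
  ultimately have "vs ! i = vs ! 1" "vs ! (Suc i mod ?k) = vs ! 0"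
    by (auto simp: doubleton_eq_iff)
  then have i1: "i = 1" and "Suc i mod ?k = 0"
    using nth_eq[of i 1] nth_eq[of "Suc i mod ?k" 0] i k cyc(1) by auto
  then have k2: "?k = 2" using k by (cases "?k = 2") (auto simp: mod_less)
  have "set es = {es ! 0}"
  proof -
    have "set es = {es ! j | j. j < 2}" using cyc(4) k2 by (simp add: set_conv_nth)
    also have "\<dots> = {es ! 0}" using eq i1 by (auto simp: less_2_cases_iff)
    finally show ?thesis .
  qed
  moreover have e0: "es ! 0 \<in> edges G" using cyc(4,5) k by (auto intro!: subsetD[OF cyc(5)] nth_mem)
  moreover have "chmap G (es ! 0) 0 \<noteq> chmap G (es ! 0) 1"
  proof
    assume "chmap G (es ! 0) 0 = chmap G (es ! 0) 1"
    then have "vs ! 0 = vs ! 1"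
      using cyc(6)[of 0] k cyc(1) by (auto simp: joins_def doubleton_eq_iff)
    then show False using nth_eq[of 0 1] k cyc(1) by auto
  qed
  ultimately show False
    using closed_edge_not_circle[OF e0] cyc(7) by simp
qed

lemma cycle_edge_ends:
  assumes c: "is_cycle G (vs, es)" and e: "e \<in> set es"
  shows "chmap G e 0 \<in> set vs" "chmap G e 1 \<in> set vs"
proof -
  note cyc = is_cycle_unfold[OF c]
  obtain i where i: "i < length vs" "e = es ! i"
    using e cyc(4) by (auto simp: in_set_conv_nth)
  have "{chmap G e 0, chmap G e 1} = {vs ! i, vs ! (Suc i mod length vs)}"
    using cyc(6)[OF i(1)] i(2) by (simp add: joins_def)
  moreover have "vs ! i \<in> set vs" "vs ! (Suc i mod length vs) \<in> set vs"
    using i(1) by (auto intro!: nth_mem mod_less_divisor)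
  ultimately show "chmap G e 0 \<in> set vs" "chmap G e 1 \<in> set vs"
    by (auto simp: doubleton_eq_iff)
qed

lemma carriers_disjoint:
  assumes c: "is_cycle G c" and d: "is_cycle G d" and dis: "vertex_disjoint c d"
  shows "carrier G c \<inter> carrier G d = {}"
proof -
  obtain vs es where c': "c = (vs, es)" by fastforce
  obtain ws fs where d': "d = (ws, fs)" by fastforce
  have dis': "set vs \<inter> set ws = {}" using dis by (simp add: vertex_disjoint_def c' d')
  have ends_vs: "chmap G e 0 \<in> set vs" "chmap G e 1 \<in> set vs" if "e \<in> set es" for e
    using cycle_edge_ends[OF c[unfolded c'] that] .
  have ends_ws: "chmap G f 0 \<in> set ws" "chmap G f 1 \<in> set ws" if "f \<in> set fs" for f
    using cycle_edge_ends[OF d[unfolded d'] that] .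
  have False if p1: "p \<in> carrier G c" and p2: "p \<in> carrier G d" for p
  proof -
    obtain e where e: "e \<in> set es" "p \<in> closed_edge G e"
      using p1 unfolding carrier_def c' snd_conv by (elim UN_E)
    obtain f where f: "f \<in> set fs" "p \<in> closed_edge G f"
      using p2 unfolding carrier_def d' snd_conv by (elim UN_E)
    have ef: "e \<in> edges G" "f \<in> edges G"
      using e(1) f(1) is_cycle_unfold(5)[OF c[unfolded c']] is_cycle_unfold(5)[OF d[unfolded d']] by auto
    have ne: "e \<noteq> f"
    proof
      assume "e = f"
      then have "chmap G e 0 \<in> set vs \<inter> set ws" using ends_vs(1)[OF e(1)] ends_ws(1)[OF f(1)] by simp
      then show False using dis' by simp
    qed
    have "p \<notin> open_edge G f" "p \<notin> open_edge G e"
      using closed_edge_Int_open_edge[OF ef ne] closed_edge_Int_open_edge[OF ef(2,1) ne[symmetric]] e(2) f(2)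
      by blast+
    then have "p \<in> {chmap G e 0, chmap G e 1}" "p \<in> {chmap G f 0, chmap G f 1}"
      using e(2) f(2) unfolding closed_edge_eq by simp_all
    then have "p \<in> set vs" "p \<in> set ws"
      using ends_vs[OF e(1)] ends_ws[OF f(1)] by auto
    then show False using dis' by blast
  qed
  then show ?thesis by blast
qed

lemma cell_hull_subset_carrier:
  assumes c: "is_cycle G c" and p: "p \<in> carrier G c"
  shows "cell_hull G p \<subseteq> carrier G c"
proof -
  obtain e where e: "e \<in> set (snd c)" "p \<in> closed_edge G e" using p by (auto simp: carrier_def)
  obtain t where t: "p = chmap G e t" "t \<in> {0..1}" using e(2) unfolding closed_edge_def by (elim imageE)
  have "e \<in> edges G" using e(1) is_cycle_unfold(5)[of "fst c" "snd c"] c by auto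
  then have "cell_hull G p \<subseteq> closed_edge G e" using t cell_hull_chmap_subset by simp
  then show ?thesis using e(1) unfolding carrier_def by blast
qed

text \<open>The remaining edges of the cycle lead from one end of the first edge to the other, and they meet the
first edge at its ends only.\<close>

lemma cycle_minus_edge_path:
  assumes c: "is_cycle G (vs, es)"
  obtains \<delta> where "continuous_map (top_of_set {0..1::real}) (gspace G) \<delta>"
    "\<delta> 0 = chmap G (es ! 0) 1" "\<delta> 1 = chmap G (es ! 0) 0"
    "\<And>s. s \<in> {0..1} \<Longrightarrow> \<delta> s \<in> carrier G (vs, es) - open_edge G (es ! 0)"
proof -
  note cyc = is_cycle_unfold[OF c]
  let ?k = "length vs" and ?e = "es ! 0"
  let ?S = "carrier G (vs, es) - open_edge G ?e"
  let ?X = "subtopology (gspace G) ?S"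
  have k: "?k > 0" using cyc(1) by simp
  have es: "es ! i \<in> set es" "es ! i \<in> edges G" if "i < ?k" for i
    using that cyc(4,5) nth_mem[of i es] by auto
  have carrier_top: "carrier G (vs, es) \<subseteq> topspace (gspace G)"
    using cyc(5) chmap_in_topspace by (auto simp: carrier_def closed_edge_def)
  have vS: "vs ! i \<in> ?S" if i: "i < ?k" for i
  proof -
    have "vs ! i \<in> {chmap G (es ! i) 0, chmap G (es ! i) 1}"
      using cyc(6)[OF i] by (simp add: joins_def)
    then have "vs ! i \<in> closed_edge G (es ! i)" unfolding closed_edge_eq by blast
    then have "vs ! i \<in> carrier G (vs, es)" using es(1)[OF i] by (auto simp: carrier_def)
    moreover have "vs ! i \<in> verts G" using i cyc(3) nth_mem[OF i] by blast
    ultimately show ?thesis using vertex_notin_open_edge[OF _ es(2)[OF k]] by simp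
  qed
  have chain: "path_component_of ?X (vs ! (1 mod ?k)) (vs ! (Suc j mod ?k))" if "j < ?k" for j
    using that
  proof (induction j)
    case 0
    have "vs ! (1 mod ?k) \<in> topspace ?X"
      using vS[OF mod_less_divisor[OF k], of 1] carrier_top unfolding topspace_subtopology by blast
    then show ?case by (simp add: path_component_of_refl)
  next
    case (Suc j)
    then have j: "Suc j < ?k" by simp
    have jn: "joins G (es ! Suc j) (vs ! Suc j) (vs ! (Suc (Suc j) mod ?k))" using cyc(6)[OF j] .
    obtain g where g: "continuous_map (top_of_set {0..1::real}) (gspace G) g"
      "g 0 = vs ! Suc j" "g 1 = vs ! (Suc (Suc j) mod ?k)"
      "\<And>s. s \<in> {0..1} \<Longrightarrow> cell_hull G (g s) \<subseteq> closed_edge G (es ! Suc j)"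
      by (rule joined_vertices_path[OF es(2)[OF j] jn]) (rule that, assumption, assumption, assumption, blast)
    have "g s \<in> ?S" if s: "s \<in> {0..1}" for s
    proof -
      have "g s \<in> topspace (gspace G)"
        using funcset_mem[OF continuous_map_funspace[OF g(1)], of s] s by simp
      then have "g s \<in> closed_edge G (es ! Suc j)" using mem_cell_hull g(4)[OF s] by blast
      moreover have "closed_edge G (es ! Suc j) \<inter> open_edge G ?e = {}"
        using cycle_first_edge_unrepeated[OF c _ j] by (intro closed_edge_Int_open_edge es j k) simp
      ultimately show ?thesis using es(1)[OF j] unfolding carrier_def by auto
    qed
    then have "continuous_map (top_of_set {0..1}) ?X g"
      by (intro continuous_map_into_subtopology[OF g(1)]) simp
    then have "path_component_of ?X (g 0) (g 1)"
      unfolding path_component_of_def pathin_def by blast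
    then have step: "path_component_of ?X (vs ! (Suc j mod ?k)) (vs ! (Suc (Suc j) mod ?k))"
      unfolding g(2,3) using j by simp
    have "j < ?k" using j by simp
    from path_component_of_trans[OF Suc.IH[OF this] step] show ?case .
  qed
  have "path_component_of ?X (vs ! (1 mod ?k)) (vs ! 0)"
    using chain[of "?k - 1"] k by simp
  moreover have "{chmap G ?e 0, chmap G ?e 1} = {vs ! 0, vs ! (1 mod ?k)}"
    using cyc(6)[OF k] by (simp add: joins_def)
  ultimately have "path_component_of ?X (chmap G ?e 1) (chmap G ?e 0)"
    unfolding doubleton_eq_iff by (elim disjE conjE) (simp_all only: path_component_of_sym)
  then obtain \<delta> where \<delta>: "continuous_map (top_of_set {0..1::real}) ?X \<delta>"
    "\<delta> 0 = chmap G ?e 1" "\<delta> 1 = chmap G ?e 0"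
    unfolding path_component_of_def pathin_def by blast
  show ?thesis
  proof (rule that[OF _ \<delta>(2,3)])
    show "continuous_map (top_of_set {0..1}) (gspace G) \<delta>"
      using \<delta>(1) by (simp add: continuous_map_in_subtopology)
    show "\<delta> s \<in> ?S" if "s \<in> {0..1}" for s
      using funcset_mem[OF continuous_map_funspace[OF \<delta>(1)], of s] that by simp
  qed
qed

text \<open>The loop \<open>l\<close> runs through the first edge from its initial to its terminal end, and then back through
the rest of the cycle, which \<open>edge_collapse\<close> maps to \<open>1\<close>.\<close>

lemma cycle_parametrization:
  assumes c: "is_cycle G c"
  shows "\<exists>e l. e \<in> edges G \<and> open_edge G e \<subseteq> carrier G c \<and> continuous_map euclideanreal (gspace G) l \<and>
    (\<forall>t. \<forall>k\<in>\<int>. l (t + k) = l t) \<and> (\<forall>t. l t \<in> carrier G c) \<and>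
    (\<forall>t. edge_collapse G e (l t) = cis (2 * pi * stairs t))"
proof -
  obtain vs es where c': "c = (vs, es)" by fastforce
  note cyc = is_cycle_unfold[OF c[unfolded c']]
  define e where "e = es ! 0"
  have e: "e \<in> set es" "e \<in> edges G"
    using cyc(1,4,5) nth_mem[of 0 es] by (auto simp: e_def)
  have e_car: "closed_edge G e \<subseteq> carrier G c" using e(1) by (auto simp: carrier_def c')
  obtain \<delta> where \<delta>0: "continuous_map (top_of_set {0..1::real}) (gspace G) \<delta>"
    "\<delta> 0 = chmap G (es ! 0) 1" "\<delta> 1 = chmap G (es ! 0) 0"
    "\<And>s. s \<in> {0..1} \<Longrightarrow> \<delta> s \<in> carrier G (vs, es) - open_edge G (es ! 0)"
    by (rule cycle_minus_edge_path[OF c[unfolded c']]) (rule that, assumption, assumption, assumption, blast)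
  note \<delta> = \<delta>0[folded e_def c']
  define \<gamma> where "\<gamma> u = (if u \<le> 1/2 then chmap G e (max 0 (min 1 (2 * u))) else \<delta> (max 0 (min 1 (2 * u - 1))))" for u :: real
  let ?I = "top_of_set {0..1::real}"
  have clamp: "continuous_map ?I ?I (\<lambda>u. max 0 (min 1 (h u)))" if "continuous_on UNIV h" for h :: "real \<Rightarrow> real"
    using continuous_on_subset[OF that subset_UNIV] by (auto intro!: continuous_intros)
  have "continuous_map ?I (gspace G) \<gamma>"
    unfolding \<gamma>_def
  proof (intro continuous_map_cases_le)
    show "continuous_map ?I euclideanreal (\<lambda>u. u)" by simp
    have "continuous_map ?I (gspace G) (\<lambda>u. chmap G e (max 0 (min 1 (2 * u))))"
      using continuous_map_compose[OF clamp continuous_map_chmap[OF e(2)], of "\<lambda>u. 2 * u", unfolded o_def]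
      by (simp add: continuous_on_mult_left)
    then show "continuous_map (subtopology ?I {u \<in> topspace ?I. u \<le> 1/2}) (gspace G)
        (\<lambda>u. chmap G e (max 0 (min 1 (2 * u))))"
      by (rule continuous_map_from_subtopology)
    have "continuous_on UNIV (\<lambda>u::real. 2 * u - 1)" by (intro continuous_intros)
    from continuous_map_compose[OF clamp[OF this] \<delta>(1), unfolded o_def]
    show "continuous_map (subtopology ?I {u \<in> topspace ?I. 1/2 \<le> u}) (gspace G)
        (\<lambda>u. \<delta> (max 0 (min 1 (2 * u - 1))))"
      by (rule continuous_map_from_subtopology)
  qed (simp_all add: \<delta>(2))
  moreover have "\<gamma> 0 = \<gamma> 1" by (simp add: \<gamma>_def \<delta>(3))
  ultimately have cont: "continuous_map euclideanreal (gspace G) (\<lambda>t. \<gamma> (frac t))"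
    by (rule continuous_map_periodic_extension)
  have car: "\<gamma> u \<in> carrier G c" for u
    using \<delta>(4)[of "max 0 (min 1 (2 * u - 1))"] subsetD[OF e_car, of "chmap G e (max 0 (min 1 (2 * u)))"]
    by (auto simp: \<gamma>_def closed_edge_def)
  have col: "edge_collapse G e (\<gamma> u) = cis (2 * pi * min 1 (2 * u))" if u: "u \<in> {0..1}" for u
  proof (cases "u \<le> 1/2")
    case True
    then have "\<gamma> u = chmap G e (2 * u)" "2 * u \<in> {0..1}" using u by (auto simp: \<gamma>_def)
    then show ?thesis using edge_collapse_chmap[OF e(2)] by simp
  next
    case False
    then have "\<gamma> u \<notin> open_edge G e"
      using \<delta>(4)[of "max 0 (min 1 (2 * u - 1))"] by (simp add: \<gamma>_def)
    moreover have "min 1 (2 * u) = 1" using False by simp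
    ultimately show ?thesis by (simp add: edge_collapse_outside complex_eq_iff)
  qed
  have "edge_collapse G e (\<gamma> (frac t)) = cis (2 * pi * stairs t)" for t
    using col[of "frac t"] frac_ge_0[of t] frac_lt_1[of t] by (simp add: cis_stairs)
  moreover have "open_edge G e \<subseteq> carrier G c" using e_car by (auto simp: closed_edge_eq)
  ultimately show ?thesis
    using e(2) cont car by (intro exI[of _ e] exI[of _ "\<lambda>t. \<gamma> (frac t)"]) (simp add: frac_add_Ints)
qed

text \<open>A family of vertex-disjoint cycles has at most as many members as there are vertices, so the maximum
in the definition of \<open>cycle_number\<close> is attained.\<close>

lemma disjoint_cycles_exist:
  assumes "m \<le> cycle_number G"
  obtains c where "\<And>i. i < m \<Longrightarrow> is_cycle G (c i)"
    "\<And>i j. i < m \<Longrightarrow> j < m \<Longrightarrow> i \<noteq> j \<Longrightarrow> vertex_disjoint (c i) (c j)"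
proof -
  let ?P = "\<lambda>C. finite C \<and> (\<forall>c\<in>C. is_cycle G c) \<and> pairwise vertex_disjoint C"
  let ?N = "{card C | C. ?P C}"
  have "card C \<le> card (verts G)" if C: "?P C" for C
  proof (rule card_inj_on_le[of "\<lambda>c. hd (fst c)"])
    have hd: "hd (fst c) \<in> set (fst c)" "set (fst c) \<subseteq> verts G" if "c \<in> C" for c
      using C that is_cycle_unfold(1,3)[of "fst c" "snd c"] by auto
    show "inj_on (\<lambda>c. hd (fst c)) C"
    proof (rule inj_onI)
      fix c d assume cd: "c \<in> C" "d \<in> C" and eq: "hd (fst c) = hd (fst d)"
      show "c = d"
      proof (rule ccontr)
        assume "c \<noteq> d"
        then have "vertex_disjoint c d" using C cd pairwiseD by metis
        then show False using hd(1)[OF cd(1)] hd(1)[OF cd(2)] eq by (auto simp: vertex_disjoint_def)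
      qed
    qed
    show "(\<lambda>c. hd (fst c)) ` C \<subseteq> verts G" using hd by blast
  qed (rule finite_verts)
  then have "?N \<subseteq> {..card (verts G)}" by auto
  then have fin: "finite ?N" by (rule finite_subset) simp
  have "?P {}" by simp
  then have "?N \<noteq> {}" by blast
  from Max_in[OF fin this] have "cycle_number G \<in> ?N" by (simp add: cycle_number_def)
  then obtain C where C: "cycle_number G = card C" "?P C" by blast
  then obtain h where h: "bij_betw h {0..<card C} C" using ex_bij_betw_nat_finite by blast
  have mC: "i < card C" if "i < m" for i using that assms C(1) by simp
  show ?thesis
  proof (rule that[of h])
    show "is_cycle G (h i)" if "i < m" for i
      using C(2) bij_betwE[OF h] mC[OF that] by simp
    show "vertex_disjoint (h i) (h j)" if "i < m" "j < m" "i \<noteq> j" for i j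
    proof -
      have "h i \<noteq> h j" using h mC[OF that(1)] mC[OF that(2)] that(3) by (auto simp: bij_betw_def inj_on_def)
      moreover have "h i \<in> C" "h j \<in> C" using bij_betwE[OF h] mC that by auto
      ultimately show ?thesis using C(2) pairwiseD by metis
    qed
  qed
qed

section \<open>The lower bound\<close>

text \<open>A product over the points of a configuration does not depend on their order.\<close>

lemma product_over_particles:
  fixes f :: "'v \<Rightarrow> complex"
  assumes f: "continuous_map (gspace G) euclidean f"
  obtains \<psi> where "continuous_map (unordered_discrete_conf n G) euclidean \<psi>"
    "\<And>x. x \<in> configurations G n \<Longrightarrow> \<psi> (perm_orbit n x) = (\<Prod>j<n. f (x j))"
proof -
  let ?D = "ordered_discrete_conf n G" and ?U = "unordered_discrete_conf n G"
  have "continuous_map ?D euclidean (\<lambda>x. f (x j))" if "j < n" for j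
    using continuous_map_compose[OF continuous_map_configuration_component[OF that] f] by (simp add: o_def)
  then have cont: "continuous_map ?D euclidean (\<lambda>x. \<Prod>j<n. f (x j))"
    by (auto simp: continuous_map_atin intro!: tendsto_prod)
  have inv: "(\<Prod>j<n. f (x j)) = (\<Prod>j<n. f (y j))" if eq: "perm_orbit n x = perm_orbit n y" for x y
  proof -
    obtain \<pi> where \<pi>: "\<pi> permutes {..<n}" "x = y \<circ> \<pi>" by (rule perm_orbit_eqE[OF eq])
    show ?thesis
      using prod.permute[OF \<pi>(1), of "\<lambda>j. f (y j)"] by (simp add: \<pi>(2) o_def)
  qed
  obtain \<psi> where "continuous_map ?U euclidean \<psi>"
    "\<And>x. x \<in> topspace ?D \<Longrightarrow> \<psi> (perm_orbit n x) = (\<Prod>j<n. f (x j))"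
    by (rule quotient_map_lift_exists[OF quotient_map_perm_orbit cont inv]) (assumption, rule that, assumption, assumption)
  then show ?thesis by (intro that) (simp_all add: topspace_ordered_discrete_conf)
qed

text \<open>The map \<open>T o'\<close> places the \<open>j\<close>-th point on the cycle with index \<open>j + o'\<close>, so that \<open>T 0\<close> and \<open>T n\<close> sweep
out the two tori. On the first torus the coordinate enters through the starting configuration of the
motion, on the second through its final configuration; conjugating the first \<open>n\<close> maps makes the
quotients turn in the same direction.\<close>

theorem TC_unordered_discrete_conf_ge:
  assumes n: "2 * n \<le> cycle_number G"
  shows "enat (2 * n + 1) \<le> TC (unordered_discrete_conf n G)"
proof -
  let ?U = "unordered_discrete_conf n G"
  obtain c where c: "\<And>i. i < 2 * n \<Longrightarrow> is_cycle G (c i)"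
    "\<And>i j. i < 2 * n \<Longrightarrow> j < 2 * n \<Longrightarrow> i \<noteq> j \<Longrightarrow> vertex_disjoint (c i) (c j)"
    by (rule disjoint_cycles_exist[OF n]) (rule that, assumption, assumption)
  define K where "K i = carrier G (c i)" for i
  have "\<forall>i\<in>{..<2 * n}. \<exists>el. fst el \<in> edges G \<and> open_edge G (fst el) \<subseteq> K i \<and>
      continuous_map euclideanreal (gspace G) (snd el) \<and>
      (\<forall>t. \<forall>k\<in>\<int>. snd el (t + k) = snd el t) \<and> (\<forall>t. snd el t \<in> K i) \<and>
      (\<forall>t. edge_collapse G (fst el) (snd el t) = cis (2 * pi * stairs t))"
  proof
    fix i assume "i \<in> {..<2 * n}"
    then have "is_cycle G (c i)" using c(1) by simp
    from cycle_parametrization[OF this, folded K_def]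
    show "\<exists>el. fst el \<in> edges G \<and> open_edge G (fst el) \<subseteq> K i \<and>
      continuous_map euclideanreal (gspace G) (snd el) \<and>
      (\<forall>t. \<forall>k\<in>\<int>. snd el (t + k) = snd el t) \<and> (\<forall>t. snd el t \<in> K i) \<and>
      (\<forall>t. edge_collapse G (fst el) (snd el t) = cis (2 * pi * stairs t))"
      by simp
  qed
  from bchoice[OF this] obtain el where el: "\<forall>i\<in>{..<2 * n}. fst (el i) \<in> edges G \<and> open_edge G (fst (el i)) \<subseteq> K i \<and>
      continuous_map euclideanreal (gspace G) (snd (el i)) \<and>
      (\<forall>t. \<forall>k\<in>\<int>. snd (el i) (t + k) = snd (el i) t) \<and> (\<forall>t. snd (el i) t \<in> K i) \<and>
      (\<forall>t. edge_collapse G (fst (el i)) (snd (el i) t) = cis (2 * pi * stairs t))" ..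
  define e where "e i = fst (el i)" for i
  define l where "l i = snd (el i)" for i
  have e: "e i \<in> edges G" "open_edge G (e i) \<subseteq> K i"
    and l: "continuous_map euclideanreal (gspace G) (l i)" "\<And>t k. k \<in> \<int> \<Longrightarrow> l i (t + k) = l i t"
      "\<And>t. l i t \<in> K i" "\<And>t. edge_collapse G (e i) (l i t) = cis (2 * pi * stairs t)"
    if "i < 2 * n" for i
    using el that by (simp_all add: e_def l_def)
  have K: "K i \<inter> K j = {}" if "i < 2 * n" "j < 2 * n" "i \<noteq> j" for i j
    unfolding K_def using carriers_disjoint[OF c(1)[OF that(1)] c(1)[OF that(2)] c(2)[OF that]] .
  have off: "edge_collapse G (e i) (l j t) = 1" if "i < 2 * n" "j < 2 * n" "i \<noteq> j" for i j t
    using K[OF that] e(2)[OF that(1)] l(3)[OF that(2)] by (intro edge_collapse_outside) blast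
  define T where "T o' x = restrict (\<lambda>j. l (j + o') (x (j + o'))) {..<n}" for o' :: nat and x :: "nat \<Rightarrow> real"
  have ltop: "l i t \<in> topspace (gspace G)" if "i < 2 * n" for i t
    using funcset_mem[OF continuous_map_funspace[OF l(1)[OF that]], of t] by simp
  have Tconf: "T o' x \<in> configurations G n" if o': "o' \<le> n" for o' x
  proof -
    have "T o' x \<in> PiE {..<n} (\<lambda>_. topspace (gspace G))"
      using ltop o' by (simp add: T_def)
    moreover have "cell_hull G (T o' x i) \<inter> cell_hull G (T o' x j) = {}" if ij: "i < n" "j < n" "i \<noteq> j" for i j
    proof -
      have hull: "cell_hull G (T o' x k) \<subseteq> K (k + o')" if "k < n" for k
        using cell_hull_subset_carrier[OF c(1)[of "k + o'"], folded K_def] l(3)[of "k + o'"] that o'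
        by (simp add: T_def)
      have "K (i + o') \<inter> K (j + o') = {}" using K[of "i + o'" "j + o'"] ij o' by simp
      with hull[OF ij(1)] hull[OF ij(2)] show ?thesis by blast
    qed
    ultimately show ?thesis by (simp add: configurations_def)
  qed
  have Tcont: "continuous_map euclidean ?U (\<lambda>x. perm_orbit n (T o' x))" if o': "o' \<le> n" for o'
  proof -
    have "continuous_map euclidean (ordered_discrete_conf n G) (T o')"
    proof (rule continuous_map_into_configurations)
      fix i assume i: "i < n"
      have "continuous_map euclidean euclideanreal (\<lambda>x::nat \<Rightarrow> real. x (i + o'))" by simp
      from continuous_map_compose[OF this l(1)[of "i + o'"]] i o'
      show "continuous_map euclidean (gspace G) (\<lambda>x. T o' x i)" by (simp add: T_def o_def)
    qed (rule Tconf[OF o'])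
    from continuous_map_compose[OF this quotient_imp_continuous_map[OF quotient_map_perm_orbit]]
    show ?thesis unfolding o_def .
  qed
  define f where "f i p = (if i < n then cnj (edge_collapse G (e i) p) else edge_collapse G (e i) p)" for i p
  have fcont: "continuous_map (gspace G) euclidean (f i)" if "i < 2 * n" for i
  proof -
    have "continuous_map euclidean euclidean cnj" by (simp add: continuous_on_cnj continuous_on_id)
    from continuous_map_compose[OF continuous_map_edge_collapse[OF e(1)[OF that]] this]
    show ?thesis using continuous_map_edge_collapse[OF e(1)[OF that]]
      by (cases "i < n") (simp_all add: f_def[abs_def] o_def)
  qed
  have "\<forall>i\<in>{..<2 * n}. \<exists>\<psi>. continuous_map ?U euclidean \<psi> \<and>
      (\<forall>x\<in>configurations G n. \<psi> (perm_orbit n x) = (\<Prod>j<n. f i (x j)))"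
  proof
    fix i assume "i \<in> {..<2 * n}"
    then have fi: "continuous_map (gspace G) euclidean (f i)" using fcont by simp
    obtain \<psi> where "continuous_map ?U euclidean \<psi>"
      "\<And>x. x \<in> configurations G n \<Longrightarrow> \<psi> (perm_orbit n x) = (\<Prod>j<n. f i (x j))"
      by (rule product_over_particles[OF fi]) (rule that, assumption, assumption)
    then show "\<exists>\<psi>. continuous_map ?U euclidean \<psi> \<and>
      (\<forall>x\<in>configurations G n. \<psi> (perm_orbit n x) = (\<Prod>j<n. f i (x j)))" by blast
  qed
  from bchoice[OF this] obtain \<psi> where \<psi>: "\<forall>i\<in>{..<2 * n}. continuous_map ?U euclidean (\<psi> i) \<and>
      (\<forall>x\<in>configurations G n. \<psi> i (perm_orbit n x) = (\<Prod>j<n. f i (x j)))" ..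
  have \<psi>T: "\<psi> i (perm_orbit n (T o' x)) = (if o' \<le> i \<and> i < n + o' then f i (l i (x i)) else 1)"
    if i: "i < 2 * n" and o': "o' \<le> n" for i o' x
  proof -
    have "\<psi> i (perm_orbit n (T o' x)) = (\<Prod>j<n. f i (T o' x j))"
      using \<psi> i Tconf[OF o'] by simp
    also have "\<dots> = (\<Prod>j<n. if j + o' = i then f i (l i (x i)) else 1)"
    proof (rule prod.cong[OF refl])
      fix j assume "j \<in> {..<n}"
      then show "f i (T o' x j) = (if j + o' = i then f i (l i (x i)) else 1)"
        using off[OF i, of "j + o'"] o' by (auto simp: T_def f_def)
    qed
    also have "\<dots> = (if o' \<le> i \<and> i < n + o' then f i (l i (x i)) else 1)"
    proof (cases "o' \<le> i \<and> i < n + o'")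
      case True
      then have "(j + o' = i) = (j = i - o')" for j by auto
      then show ?thesis using True by (simp add: prod.delta less_diff_conv2)
    next
      case False
      then have "j + o' \<noteq> i" if "j < n" for j using that by auto
      then show ?thesis unfolding if_not_P[OF False] by (simp add: prod.neutral)
    qed
    finally show ?thesis .
  qed
  show ?thesis
  proof (rule TC_ge_if_torus[where c = "\<lambda>x. (perm_orbit n (T 0 x), perm_orbit n (T n x))" and \<phi> = \<psi> and g = stairs])
    show "continuous_map euclidean (prod_topology ?U ?U) (\<lambda>x. (perm_orbit n (T 0 x), perm_orbit n (T n x)))"
      by (intro continuous_map_pairedI Tcont) simp_all
    show "(perm_orbit n (T 0 (\<lambda>i. x i + z i)), perm_orbit n (T n (\<lambda>i. x i + z i))) =
        (perm_orbit n (T 0 x), perm_orbit n (T n x))" if z: "\<And>i. z i \<in> \<int>" for x z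
    proof -
      have "T o' (\<lambda>i. x i + z i) = T o' x" if "o' \<le> n" for o'
        unfolding T_def by (rule restrict_ext) (use l(2) z that in simp)
      then show ?thesis by simp
    qed
    show "continuous_map ?U euclidean (\<psi> i)" if "i < 2 * n" for i using \<psi> that by simp
    show "norm (\<psi> i A) = 1" if i: "i < 2 * n" and A: "A \<in> topspace ?U" for i A
    proof -
      obtain x where x: "x \<in> configurations G n" "A = perm_orbit n x"
        using A by (auto simp: topspace_unordered_discrete_conf)
      have "norm (f i p) = 1" for p by (simp add: f_def norm_edge_collapse)
      then show ?thesis using \<psi> i x by (simp add: prod_norm[symmetric])
    qed
    show "continuous_on UNIV stairs" by (rule continuous_stairs)
    show "stairs (t + 1) = stairs t + 1" for t by (rule stairs_add_1)
    show "\<psi> i (snd (perm_orbit n (T 0 x), perm_orbit n (T n x))) =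
        \<psi> i (fst (perm_orbit n (T 0 x), perm_orbit n (T n x))) * cis (2 * pi * stairs (x i))"
      if i: "i < 2 * n" for i x
      using \<psi>T[OF i, of 0 x] \<psi>T[OF i, of n x] i l(4)[OF i]
      by (cases "i < n") (simp_all add: f_def cis_cnj cis_mult)
  qed
qed

end

theorem theorem1p9:
  fixes \<Gamma> :: "('v, 'e) graph" and n :: nat
  assumes "is_graph \<Gamma>"
    and "cycle_number \<Gamma> \<ge> 2"
    and "1 \<le> n" and "real n \<le> 1 / 2 * real (cycle_number \<Gamma>)"
    and "sufficiently_subdivided n \<Gamma>"
  shows "TC (unordered_discrete_conf n \<Gamma>) = enat (2 * n + 1)"
proof -
  interpret cw_graph \<Gamma> by standard (rule assms(1))
  have "2 * n \<le> cycle_number \<Gamma>" using assms(4) by linarith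
  then show ?thesis
    by (intro antisym TC_unordered_discrete_conf_le TC_unordered_discrete_conf_ge)
qed

end
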